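(* Let $(M^{2n+1},T^{1,0})$ be a CR manifold and let $k\in\{0,\dots,2n+1\}$. Then $H_R^k(M;\mathbb R)$ is isomorphic to the $k$-th de Rham cohomology group of $M$.
   Context: A CR manifold $(M^{2n+1},T^{1,0})$ is a connected real $(2n+1)$-manifold with a complex rank $n$ distribution $T^{1,0}\subset TM\otimes\mathbb C$ such that, with $T^{0,1}:=\overline{T^{1,0}}$, one has $T^{1,0}\cap T^{0,1}=\{0\}$, $[T^{1,0},T^{1,0}]\subset T^{1,0}$, and, for every real one-form $\theta$ on an open set $U$ with $\ker\theta=H|_U$, where $H:=\operatorname{Re}(T^{1,0}\oplus T^{0,1})$, the Levi form $L(Z,W):=-i\,d\theta(Z,\overline W)$ is a nondegenerate hermitian form on $T^{1,0}|_U$. Such a $\theta$ is called a local contact form. Let $\mathscr A^k$ be the sheaf of smooth real $k$-forms. For $k\le n$ put $\mathscr R^k:=\{\omega\in\mathscr A^k:\theta\wedge\omega\wedge d\theta^{n+1-k}=0,\ \theta\wedge d\omega\wedge d\theta^{n-k}=0\}$; for $k\ge n+1$ put $\mathscr R^k:=\{\omega\in\mathscr A^k:\theta\wedge\omega=0,\ \theta\wedge d\omega=0\}$, $\theta$ any local contact form (the choice is irrelevant). Then $d(\mathscr R^k)\subset\mathscr R^{k+1}$. Let $\mathcal R^k$ be the global sections of $\mathscr R^k$, with $\mathcal R^{-1}:=\mathcal R^{2n+2}:=0$, and $H_R^k(M;\mathbb R):=\ker(d\colon\mathcal R^k\to\mathcal R^{k+1})/\operatorname{im}(d\colon\mathcal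 R^{k-1}\to\mathcal R^k)$. *)

theory Defs
  imports "HOL-Analysis.Analysis" "HOL-Combinatorics.Permutations"
begin

section \<open>Smooth maps on open subsets of Euclidean space\<close>

text \<open>Only used for open \<open>S\<close>. In finite dimensions, continuity of all iterated directional
  derivatives of differentiable functions is the usual notion of class \<open>C\<close> to the \<open>k\<close>.\<close>

primrec Ck_on :: "nat \<Rightarrow> 'a::euclidean_space set \<Rightarrow> ('a \<Rightarrow> 'b::real_normed_vector) \<Rightarrow> bool" where
  "Ck_on 0 S f \<longleftrightarrow> continuous_on S f"
| "Ck_on (Suc k) S f \<longleftrightarrow>
     (\<forall>x\<in>S. f differentiable (at x)) \<and> (\<forall>v. Ck_on k S (\<lambda>x. frechet_derivative f (at x) v))"

definition smooth_on :: "'a::euclidean_space set \<Rightarrow> ('a \<Rightarrow> 'b::real_normed_vector) \<Rightarrow> bool" where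
  "smooth_on S f \<longleftrightarrow> (\<forall>k. Ck_on k S f)"

section \<open>Alternating multilinear maps\<close>

text \<open>The arguments of a \<open>k\<close>-linear map are the first \<open>k\<close> terms of a sequence; the first clause
  says that the remaining terms are irrelevant.\<close>

definition alt_forms :: "nat \<Rightarrow> ((nat \<Rightarrow> 'v::real_vector) \<Rightarrow> real) set" where
  "alt_forms k = {f.
     (\<forall>u v. (\<forall>i<k. u i = v i) \<longrightarrow> f u = f v) \<and>
     (\<forall>i<k. \<forall>v. linear (\<lambda>x. f (v(i := x)))) \<and>
     (\<forall>i<k. \<forall>j<k. \<forall>v. i \<noteq> j \<and> v i = v j \<longrightarrow> f v = 0)}"

definition alt_wedge ::
  "nat \<Rightarrow> nat \<Rightarrow> ((nat \<Rightarrow> 'v) \<Rightarrow> real) \<Rightarrow> ((nat \<Rightarrow> 'v) \<Rightarrow> real) \<Rightarrow> (nat \<Rightarrow> 'v) \<Rightarrow> real" where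
  "alt_wedge k l f g v =
     (\<Sum>\<sigma> | \<sigma> permutes {..<k + l}.
        of_int (sign \<sigma>) * f (\<lambda>i. v (\<sigma> i)) * g (\<lambda>i. v (\<sigma> (k + i)))) / (fact k * fact l)"

section \<open>Smooth manifolds\<close>

text \<open>A chart is a domain together with a coordinate map (whose values outside the domain are
  irrelevant). The manifold itself is the whole type \<open>'m\<close>.\<close>

type_synonym ('m, 'd) chart = "'m set \<times> ('m \<Rightarrow> real^'d)"

abbreviation dom_of :: "('m, 'd) chart \<Rightarrow> 'm set" where
  "dom_of c \<equiv> fst c"

definition chart_inv :: "('m, 'd) chart \<Rightarrow> real^'d \<Rightarrow> 'm" where
  "chart_inv c = inv_into (fst c) (snd c)"

definition transition :: "('m, 'd) chart \<Rightarrow> ('m, 'd) chart \<Rightarrow> real^'d \<Rightarrow> real^'d" where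
  "transition c c' = snd c' \<circ> chart_inv c"

definition smooth_atlas :: "('m::topological_space, 'd::finite) chart set \<Rightarrow> bool" where
  "smooth_atlas A \<longleftrightarrow>
     (\<forall>c\<in>A. open (dom_of c) \<and> open (snd c ` dom_of c) \<and>
        homeomorphism (dom_of c) (snd c ` dom_of c) (snd c) (chart_inv c)) \<and>
     (\<Union>c\<in>A. dom_of c) = UNIV \<and>
     (\<forall>c\<in>A. \<forall>c'\<in>A. smooth_on (snd c ` (dom_of c \<inter> dom_of c')) (transition c c'))"

definition jacobian ::
  "('m, 'd::finite) chart \<Rightarrow> ('m, 'd) chart \<Rightarrow> 'm \<Rightarrow> real^'d \<Rightarrow> real^'d" where
  "jacobian c c' p = frechet_derivative (transition c c') (at (snd c p))"

section \<open>Differential forms\<close>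

text \<open>Tensorial objects on the manifold are families of local representatives, one for each chart
  of the given atlas, which are related by the Jacobians of the coordinate changes;
  \<open>\<omega> c p\<close> is the expression of the value of \<open>\<omega>\<close> at the point \<open>p\<close> in the chart \<open>c\<close>.
  A form on an open set \<open>U\<close> is set to zero wherever its representative has no meaning
  (outside \<open>U\<close>, outside the chart domain, and for charts not in the atlas), so that equality of
  forms is equality of functions.\<close>

type_synonym ('m, 'd) form = "('m, 'd) chart \<Rightarrow> 'm \<Rightarrow> (nat \<Rightarrow> real^'d) \<Rightarrow> real"

definition forms ::
  "('m::topological_space, 'd::finite) chart set \<Rightarrow> 'm set \<Rightarrow> nat \<Rightarrow> ('m, 'd) form set" where
  "forms A U k = {\<omega>.
     (\<forall>c p. if c \<in> A \<and> p \<in> dom_of c \<inter> U then \<omega> c p \<in> alt_forms k else \<omega> c p = (\<lambda>v. 0)) \<and>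
     (\<forall>c\<in>A. \<forall>v. smooth_on (snd c ` (dom_of c \<inter> U)) (\<lambda>x. \<omega> c (chart_inv c x) v)) \<and>
     (\<forall>c\<in>A. \<forall>c'\<in>A. \<forall>p \<in> dom_of c \<inter> dom_of c' \<inter> U. \<forall>v.
        \<omega> c p v = \<omega> c' p (\<lambda>i. jacobian c c' p (v i)))}"

definition zero_form :: "('m, 'd) form" where
  "zero_form = (\<lambda>c p v. 0)"

definition form_add :: "('m, 'd) form \<Rightarrow> ('m, 'd) form \<Rightarrow> ('m, 'd) form" where
  "form_add \<omega> \<eta> = (\<lambda>c p v. \<omega> c p v + \<eta> c p v)"

definition form_scale :: "real \<Rightarrow> ('m, 'd) form \<Rightarrow> ('m, 'd) form" where
  "form_scale r \<omega> = (\<lambda>c p v. r * \<omega> c p v)"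

definition wedge :: "nat \<Rightarrow> nat \<Rightarrow> ('m, 'd) form \<Rightarrow> ('m, 'd) form \<Rightarrow> ('m, 'd) form" where
  "wedge k l \<omega> \<eta> = (\<lambda>c p. alt_wedge k l (\<omega> c p) (\<eta> c p))"

text \<open>The exterior derivative of a \<open>k\<close>-form on \<open>U\<close>, evaluated on constant vector fields of the
  chart \<open>c\<close> (whose brackets vanish).\<close>

definition ext_deriv ::
  "('m, 'd::finite) chart set \<Rightarrow> 'm set \<Rightarrow> nat \<Rightarrow> ('m, 'd) form \<Rightarrow> ('m, 'd) form" where
  "ext_deriv A U k \<omega> = (\<lambda>c p v.
     if c \<in> A \<and> p \<in> dom_of c \<inter> U then
       (\<Sum>i\<le>k. (-1) ^ i *
          frechet_derivative
            (\<lambda>x. \<omega> c (chart_inv c x) (\<lambda>j. if j < i then v j else v (Suc j)))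
            (at (snd c p)) (v i))
     else 0)"

primrec wedge_power2 :: "('m, 'd) form \<Rightarrow> nat \<Rightarrow> ('m, 'd) form" where
  "wedge_power2 \<Omega> 0 = (\<lambda>c p v. 1)"
| "wedge_power2 \<Omega> (Suc m) = wedge 2 (2 * m) \<Omega> (wedge_power2 \<Omega> m)"

section \<open>The complexified tangent bundle\<close>

definition Re_vec :: "complex^'d \<Rightarrow> real^'d" where
  "Re_vec Z = (\<chi> i. Re (Z $ i))"

definition Im_vec :: "complex^'d \<Rightarrow> real^'d" where
  "Im_vec Z = (\<chi> i. Im (Z $ i))"

definition cnj_vec :: "complex^'d \<Rightarrow> complex^'d" where
  "cnj_vec Z = (\<chi> i. cnj (Z $ i))"

definition complexify :: "(real^'d \<Rightarrow> real^'d) \<Rightarrow> complex^'d \<Rightarrow> complex^'d" where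
  "complexify L Z = (\<chi> i. Complex (L (Re_vec Z) $ i) (L (Im_vec Z) $ i))"

text \<open>The complex bilinear extension of a real two-form at a point.\<close>

definition complexify2 ::
  "((nat \<Rightarrow> real^'d) \<Rightarrow> real) \<Rightarrow> complex^'d \<Rightarrow> complex^'d \<Rightarrow> complex" where
  "complexify2 f Z W =
     (let b = (\<lambda>u v. f (\<lambda>i. if i = 0 then u else v)) in
      Complex (b (Re_vec Z) (Re_vec W) - b (Im_vec Z) (Im_vec W))
              (b (Re_vec Z) (Im_vec W) + b (Im_vec Z) (Re_vec W)))"

type_synonym ('m, 'd) cvfield = "('m, 'd) chart \<Rightarrow> 'm \<Rightarrow> complex^'d"

definition cvfields ::
  "('m::topological_space, 'd::finite) chart set \<Rightarrow> 'm set \<Rightarrow> ('m, 'd) cvfield set" where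
  "cvfields A U = {Z.
     (\<forall>c\<in>A. smooth_on (snd c ` (dom_of c \<inter> U)) (\<lambda>x. Z c (chart_inv c x))) \<and>
     (\<forall>c\<in>A. \<forall>c'\<in>A. \<forall>p \<in> dom_of c \<inter> dom_of c' \<inter> U.
        Z c' p = complexify (jacobian c c' p) (Z c p))}"

definition cderiv ::
  "('m, 'd::finite) cvfield \<Rightarrow> ('m, 'd) cvfield \<Rightarrow> ('m, 'd) cvfield" where
  "cderiv Z W c p =
     (let D = frechet_derivative (\<lambda>x. W c (chart_inv c x)) (at (snd c p)) in
      D (Re_vec (Z c p)) + \<i> *s D (Im_vec (Z c p)))"

definition lie_bracket ::
  "('m, 'd::finite) cvfield \<Rightarrow> ('m, 'd) cvfield \<Rightarrow> ('m, 'd) cvfield" where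
  "lie_bracket Z W c p = cderiv Z W c p - cderiv W Z c p"

section \<open>CR manifolds\<close>

text \<open>\<open>T c p\<close> is the fibre at \<open>p\<close>, expressed in the chart \<open>c\<close>.\<close>

type_synonym ('m, 'd) cdistribution = "('m, 'd) chart \<Rightarrow> 'm \<Rightarrow> (complex^'d) set"

definition smooth_cdistribution ::
  "nat \<Rightarrow> ('m::topological_space, 'd::finite) chart set \<Rightarrow> ('m, 'd) cdistribution \<Rightarrow> bool" where
  "smooth_cdistribution n A T \<longleftrightarrow>
     (\<forall>c\<in>A. \<forall>p\<in>dom_of c. vec.subspace (T c p) \<and> vec.dim (T c p) = n) \<and>
     (\<forall>c\<in>A. \<forall>c'\<in>A. \<forall>p \<in> dom_of c \<inter> dom_of c'.
        T c' p = complexify (jacobian c c' p) ` T c p) \<and>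
     (\<forall>p. \<exists>U Z. open U \<and> p \<in> U \<and> (\<forall>j<n. Z j \<in> cvfields A U) \<and>
        (\<forall>c\<in>A. \<forall>q \<in> dom_of c \<inter> U. T c q = vec.span {Z j c q | j. j < n}))"

definition sections ::
  "('m::topological_space, 'd::finite) chart set \<Rightarrow> ('m, 'd) cdistribution \<Rightarrow> 'm set
     \<Rightarrow> ('m, 'd) cvfield set" where
  "sections A T U = {Z \<in> cvfields A U. \<forall>c\<in>A. \<forall>p \<in> dom_of c \<inter> U. Z c p \<in> T c p}"

definition real_part_distribution ::
  "('m, 'd) cdistribution \<Rightarrow> ('m, 'd) chart \<Rightarrow> 'm \<Rightarrow> (real^'d) set" where
  "real_part_distribution T c p = {Re_vec (Z + W) | Z W. Z \<in> T c p \<and> W \<in> cnj_vec ` T c p}"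

definition contact_forms ::
  "('m::topological_space, 'd::finite) chart set \<Rightarrow> ('m, 'd) cdistribution \<Rightarrow> 'm set
     \<Rightarrow> ('m, 'd) form set" where
  "contact_forms A T U = {\<theta> \<in> forms A U 1.
     \<forall>c\<in>A. \<forall>p \<in> dom_of c \<inter> U. {v. \<theta> c p (\<lambda>_. v) = 0} = real_part_distribution T c p}"

definition levi_form ::
  "('m, 'd::finite) chart set \<Rightarrow> 'm set \<Rightarrow> ('m, 'd) form \<Rightarrow> ('m, 'd) chart \<Rightarrow> 'm
     \<Rightarrow> complex^'d \<Rightarrow> complex^'d \<Rightarrow> complex" where
  "levi_form A U \<theta> c p Z W = - \<i> * complexify2 (ext_deriv A U 1 \<theta> c p) Z (cnj_vec W)"

definition nondegenerate_hermitian_on ::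
  "(complex^'d) set \<Rightarrow> (complex^'d \<Rightarrow> complex^'d \<Rightarrow> complex) \<Rightarrow> bool" where
  "nondegenerate_hermitian_on S L \<longleftrightarrow>
     (\<forall>Z\<in>S. \<forall>Z'\<in>S. \<forall>W\<in>S. \<forall>a b. L (a *s Z + b *s Z') W = a * L Z W + b * L Z' W) \<and>
     (\<forall>Z\<in>S. \<forall>W\<in>S. L W Z = cnj (L Z W)) \<and>
     (\<forall>Z\<in>S. (\<forall>W\<in>S. L Z W = 0) \<longrightarrow> Z = 0)"

definition cr_manifold ::
  "nat \<Rightarrow> ('m::{t2_space, second_countable_topology}, 'd::finite) chart set
     \<Rightarrow> ('m, 'd) cdistribution \<Rightarrow> bool" where
  "cr_manifold n A T \<longleftrightarrow>
     CARD('d) = 2 * n + 1 \<and>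
     connected (UNIV :: 'm set) \<and>
     smooth_atlas A \<and>
     smooth_cdistribution n A T \<and>
     (\<forall>c\<in>A. \<forall>p\<in>dom_of c. T c p \<inter> cnj_vec ` T c p = {0}) \<and>
     (\<forall>U. open U \<longrightarrow> (\<forall>Z \<in> sections A T U. \<forall>W \<in> sections A T U.
        lie_bracket Z W \<in> sections A T U)) \<and>
     (\<forall>U. open U \<longrightarrow> (\<forall>\<theta> \<in> contact_forms A T U. \<forall>c\<in>A. \<forall>p \<in> dom_of c \<inter> U.
        nondegenerate_hermitian_on (T c p) (levi_form A U \<theta> c p)))"

section \<open>The de Rham and Rumin complexes\<close>

text \<open>Sections over \<open>U\<close> of the sheaf of Rumin forms: the conditions are imposed for every local
  contact form \<open>\<theta>\<close> on an open subset \<open>V\<close> of \<open>U\<close>. Since \<open>\<theta>\<close> is zero outside \<open>V\<close>,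
  \<open>\<theta> \<and> \<omega>\<close> and \<open>\<theta> \<and> d\<omega>\<close> are the wedge products with the restrictions to \<open>V\<close>, extended by
  zero.\<close>

definition rumin_forms ::
  "nat \<Rightarrow> ('m::topological_space, 'd::finite) chart set \<Rightarrow> ('m, 'd) cdistribution \<Rightarrow> 'm set
     \<Rightarrow> nat \<Rightarrow> ('m, 'd) form set" where
  "rumin_forms n A T U k = {\<omega> \<in> forms A U k.
     \<forall>V \<theta>. open V \<and> V \<subseteq> U \<and> \<theta> \<in> contact_forms A T V \<longrightarrow>
       (let d\<theta> = ext_deriv A V 1 \<theta>; d\<omega> = ext_deriv A U k \<omega> in
        if k \<le> n then
          wedge (k + 1) (2 * (n + 1 - k)) (wedge 1 k \<theta> \<omega>) (wedge_power2 d\<theta> (n + 1 - k)) = zero_form \<and>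
          wedge (k + 2) (2 * (n - k)) (wedge 1 (k + 1) \<theta> d\<omega>) (wedge_power2 d\<theta> (n - k)) = zero_form
        else
          wedge 1 k \<theta> \<omega> = zero_form \<and>
          wedge 1 (k + 1) \<theta> d\<omega> = zero_form)}"

record 'v rvspace =
  vs_carrier :: "'v set"
  vs_add :: "'v \<Rightarrow> 'v \<Rightarrow> 'v"
  vs_scale :: "real \<Rightarrow> 'v \<Rightarrow> 'v"

definition vs_isomorphic :: "'v rvspace \<Rightarrow> 'w rvspace \<Rightarrow> bool" where
  "vs_isomorphic V W \<longleftrightarrow> (\<exists>F. bij_betw F (vs_carrier V) (vs_carrier W) \<and>
     (\<forall>x \<in> vs_carrier V. \<forall>y \<in> vs_carrier V. F (vs_add V x y) = vs_add W (F x) (F y)) \<and>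
     (\<forall>r. \<forall>x \<in> vs_carrier V. F (vs_scale V r x) = vs_scale W r (F x)))"

text \<open>Scalar multiplication adds \<open>B\<close> back, so that zero times a coset is the coset \<open>B\<close>.\<close>

definition quotient_space ::
  "('m, 'd) form set \<Rightarrow> ('m, 'd) form set \<Rightarrow> ('m, 'd) form set rvspace" where
  "quotient_space Z B =
     \<lparr> vs_carrier = (\<lambda>\<omega>. form_add \<omega> ` B) ` Z,
       vs_add = (\<lambda>X Y. {form_add \<xi> \<eta> | \<xi> \<eta>. \<xi> \<in> X \<and> \<eta> \<in> Y}),
       vs_scale = (\<lambda>r X. {form_add (form_scale r \<xi>) \<beta> | \<xi> \<beta>. \<xi> \<in> X \<and> \<beta> \<in> B}) \<rparr>"

text \<open>\<open>C j\<close> is the space of degree \<open>j\<close> of a complex of global forms with differential \<open>d\<close>;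
  the space of degree minus one is zero. No convention is needed in the top degree, as
  every form of degree exceeding the dimension vanishes.\<close>

definition cocycles ::
  "('m, 'd::finite) chart set \<Rightarrow> (nat \<Rightarrow> ('m, 'd) form set) \<Rightarrow> nat \<Rightarrow> ('m, 'd) form set" where
  "cocycles A C k = {\<omega> \<in> C k. ext_deriv A UNIV k \<omega> = zero_form}"

definition coboundaries ::
  "('m, 'd::finite) chart set \<Rightarrow> (nat \<Rightarrow> ('m, 'd) form set) \<Rightarrow> nat \<Rightarrow> ('m, 'd) form set" where
  "coboundaries A C k = (case k of 0 \<Rightarrow> {zero_form} | Suc j \<Rightarrow> ext_deriv A UNIV j ` C j)"

definition cohomology ::
  "('m, 'd::finite) chart set \<Rightarrow> (nat \<Rightarrow> ('m, 'd) form set) \<Rightarrow> nat \<Rightarrow> ('m, 'd) form set rvspace" where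
  "cohomology A C k = quotient_space (cocycles A C k) (coboundaries A C k)"

definition de_rham_cohomology ::
  "('m::topological_space, 'd::finite) chart set \<Rightarrow> nat \<Rightarrow> ('m, 'd) form set rvspace" where
  "de_rham_cohomology A k = cohomology A (forms A UNIV) k"

definition rumin_cohomology ::
  "nat \<Rightarrow> ('m::topological_space, 'd::finite) chart set \<Rightarrow> ('m, 'd) cdistribution \<Rightarrow> nat
     \<Rightarrow> ('m, 'd) form set rvspace" where
  "rumin_cohomology n A T k = cohomology A (rumin_forms n A T UNIV) k"

end

theory Submission
  imports Defs
begin

text \<open>
  The Rumin complex is a subcomplex of the de Rham complex, and the inclusion is bijective on
  cohomology as soon as every form \<open>\<eta>\<close> of degree \<open>k\<close> for which \<open>d\<eta>\<close> is a Rumin form can be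
  corrected by an exact form \<open>d\<beta>\<close> to a Rumin form. Only the first of the two conditions
  on \<open>\<eta> - d\<beta>\<close> has to be arranged, since the second one is the first one for \<open>d\<eta>\<close>. Look for \<open>\<beta>\<close> with
  \<open>\<theta> \<and> \<beta> = 0\<close>; then \<open>\<theta> \<and> d\<beta> = d\<theta> \<and> \<beta>\<close>, and the condition becomes a linear equation for the
  value of \<open>\<beta>\<close> at each point, which is solved by the Lefschetz isomorphism
  \<open>\<mu> \<mapsto> d\<theta>\<^sup>j \<and> \<mu>\<close> from degree \<open>n + 1 - j\<close> to degree \<open>n + 1 + j\<close> on forms annihilated
  by \<open>\<theta> \<and> _\<close>. The solution is unique and does not depend on the contact form, so that smooth local
  solutions glue to a global form without a partition of unity.

  Injectivity and surjectivity of the Lefschetz map are both proved by contracting with vectors in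
  the kernel of \<open>\<theta>\<close>; the surjectivity proof is an explicit recursion and yields smooth solutions.
  Nondegeneracy of \<open>d\<theta>\<close> on \<open>H\<close> follows from the Levi form and integrability. Identities of
  alternating forms are proved by induction on the degree, comparing contractions.
\<close>

section \<open>Exterior algebra\<close>

text \<open>In general the condition on \<eta> - d\<beta> is a first-order differential equation for
  \<beta>. The restriction \<theta> \<and> \<beta> = 0 removes every derivative of \<beta> and
  leaves linear algebra at each point. A form of degree m killed by \<theta> \<and> _ is \<theta>
  \<and> \<alpha> with \<alpha> of degree m - 1 on the 2n-dimensional kernel H. The Lefschetz map is
  therefore the symplectic one on (H, d\<theta>), from degree n - j to degree n + j, with degrees
  shifted by one; stated for forms killed by \<theta> it involves no complement of H. The obstacle
  is that contact forms are given only locally and up to a nowhere zero factor f, and d(f\<theta>) =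
  f d\<theta> + df \<and> \<theta>. The second summand dies on forms killed by \<theta>, so there
  powers of d\<theta> change only by powers of f, and these cancel in \<beta>. A solution at each
  point is not enough: it has to depend smoothly on the point. This is why surjectivity is proved
  with explicit vector fields and coefficients instead of being deduced from injectivity by counting
  dimensions.\<close>

definition contract :: "'v \<Rightarrow> ((nat \<Rightarrow> 'v) \<Rightarrow> 'a) \<Rightarrow> (nat \<Rightarrow> 'v) \<Rightarrow> 'a" where
  "contract X f v = f (case_nat X v)"

lemma case_nat_upd_Suc: "(case_nat X v)(Suc i := x) = case_nat X (v(i := x))"
  by (auto simp: fun_eq_iff split: nat.split)

lemma case_nat_upd_0: "(case_nat X v)(0 := x) = case_nat x v"
  by (auto simp: fun_eq_iff split: nat.split)

lemma case_nat_hd_tl [simp]: "case_nat (v 0) (\<lambda>i. v (Suc i)) = v"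
  by (auto simp: fun_eq_iff split: nat.split)

text \<open>Every sequence is its head followed by its tail, so a function of sequences is
  determined by its contractions. This is the step that lowers the degree in the inductions on
  identities of forms.\<close>

lemma contract_ext: "(\<And>X. contract X f = contract X g) \<Longrightarrow> f = g"
  by (metis (no_types) contract_def case_nat_hd_tl ext)

lemma alt_forms_cong: "f \<in> alt_forms k \<Longrightarrow> (\<And>i. i < k \<Longrightarrow> u i = v i) \<Longrightarrow> f u = f v"
  unfolding alt_forms_def by blast

lemma alt_forms_linear: "f \<in> alt_forms k \<Longrightarrow> i < k \<Longrightarrow> linear (\<lambda>x. f (v(i := x)))"
  unfolding alt_forms_def by blast

lemma alt_forms_eq0: "f \<in> alt_forms k \<Longrightarrow> i < k \<Longrightarrow> j < k \<Longrightarrow> i \<noteq> j \<Longrightarrow> v i = v j \<Longrightarrow> f v = 0"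
  unfolding alt_forms_def by blast

lemma alt_forms_0_iff: "f \<in> alt_forms 0 \<longleftrightarrow> (\<exists>c. f = (\<lambda>v. c))"
  unfolding alt_forms_def by (auto simp: fun_eq_iff)

lemma alt_forms_const [simp]: "(\<lambda>v. c) \<in> alt_forms 0"
  unfolding alt_forms_0_iff by blast

lemma alt_forms_0E:
  assumes "f \<in> alt_forms 0" obtains c where "f = (\<lambda>v. c)"
  using assms unfolding alt_forms_0_iff by blast

lemma alt_forms_1_iff:
  "f \<in> alt_forms (Suc 0) \<longleftrightarrow> (\<exists>\<phi>. linear \<phi> \<and> f = (\<lambda>v. \<phi> (v 0)))"
proof
  assume f: "f \<in> alt_forms (Suc 0)"
  have "linear (\<lambda>x. f ((\<lambda>_. 0)(0 := x)))"
    using alt_forms_linear[OF f] by blast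
  moreover have "f v = f ((\<lambda>_. 0)(0 := v 0))" for v
    by (rule alt_forms_cong[OF f]) auto
  ultimately show "\<exists>\<phi>. linear \<phi> \<and> f = (\<lambda>v. \<phi> (v 0))"
    by (intro exI[of _ "\<lambda>x. f ((\<lambda>_. 0)(0 := x))"]) (auto simp: fun_eq_iff)
qed (auto simp: alt_forms_def)

lemma alt_forms_zero [simp]: "(\<lambda>v. 0) \<in> alt_forms k"
  unfolding alt_forms_def by (auto intro: linear_zero)

lemma alt_forms_add:
  assumes f: "f \<in> alt_forms k" and g: "g \<in> alt_forms k"
  shows "(\<lambda>v. f v + g v) \<in> alt_forms k"
  unfolding alt_forms_def mem_Collect_eq
proof (intro conjI allI impI)
  show "f u + g u = f v + g v" if "\<forall>i<k. u i = v i" for u v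
    using alt_forms_cong[OF f, of u v] alt_forms_cong[OF g, of u v] that by simp
  show "linear (\<lambda>x. f (v(i := x)) + g (v(i := x)))" if "i < k" for i v
    by (intro linear_compose_add alt_forms_linear[OF f] alt_forms_linear[OF g] that)
  show "f v + g v = 0" if "i < k" "j < k" "i \<noteq> j \<and> v i = v j" for i j v
    using alt_forms_eq0[OF f, of i j v] alt_forms_eq0[OF g, of i j v] that by simp
qed

lemma alt_forms_scale:
  assumes f: "f \<in> alt_forms k"
  shows "(\<lambda>v. c * f v) \<in> alt_forms k"
  unfolding alt_forms_def mem_Collect_eq
proof (intro conjI allI impI)
  show "c * f u = c * f v" if "\<forall>i<k. u i = v i" for u v
    using alt_forms_cong[OF f, of u v] that by simp
  show "linear (\<lambda>x. c * f (v(i := x)))" if "i < k" for i v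
    using linear_compose_scale_right[OF alt_forms_linear[OF f that, of v], of c] by simp
  show "c * f v = 0" if "i < k" "j < k" "i \<noteq> j \<and> v i = v j" for i j v
    using alt_forms_eq0[OF f, of i j v] that by simp
qed

lemma alt_forms_minus: "f \<in> alt_forms k \<Longrightarrow> (\<lambda>v. - f v) \<in> alt_forms k"
  using alt_forms_scale[of f k "-1"] by simp

lemma alt_forms_diff:
  "f \<in> alt_forms k \<Longrightarrow> g \<in> alt_forms k \<Longrightarrow> (\<lambda>v. f v - g v) \<in> alt_forms k"
  using alt_forms_add[of f k "\<lambda>v. - g v"] alt_forms_minus[of g k] by simp

lemma alt_forms_sum:
  "(\<And>i. i \<in> I \<Longrightarrow> f i \<in> alt_forms k) \<Longrightarrow> (\<lambda>v. \<Sum>i\<in>I. f i v) \<in> alt_forms k"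
  by (induction I rule: infinite_finite_induct) (auto intro: alt_forms_add)

text \<open>Polarisation: expand the value, which is zero, with \<open>a + b\<close> in both
  slots.\<close>

lemma alt_forms_swap:
  assumes f: "f \<in> alt_forms k" and ij: "i < k" "j < k" "i \<noteq> j"
  shows "f (\<lambda>m. v (Transposition.transpose i j m)) = - f v"
proof -
  define g where "g a b = f (v(i := a, j := b))" for a b
  have l1: "linear (\<lambda>b. g a b)" for a
    unfolding g_def using alt_forms_linear[OF f ij(2), of "v(i := a)"] by simp
  have l2: "linear (\<lambda>a. g a b)" for b
    unfolding g_def using alt_forms_linear[OF f ij(1), of "v(j := b)"] ij(3)
    by (simp add: fun_upd_twist)
  have z: "g a a = 0" for a
    unfolding g_def by (rule alt_forms_eq0[OF f ij]) (use ij in auto)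
  have "g (a + b) (a + b) = g a a + g a b + g b a + g b b" for a b
    using linear_add[OF l1] linear_add[OF l2] by simp
  hence "g (v i) (v j) + g (v j) (v i) = 0" using z by simp
  moreover have "v(i := v i, j := v j) = v" by auto
  moreover have "v(i := v j, j := v i) = (\<lambda>m. v (Transposition.transpose i j m))"
    using ij by (auto simp: fun_eq_iff Transposition.transpose_def)
  ultimately show ?thesis unfolding g_def by (metis add.commute eq_neg_iff_add_eq_0)
qed

lemma alt_forms_swap_head:
  assumes f: "f \<in> alt_forms (Suc (Suc k))"
  shows "f (case_nat a (case_nat b v)) = - f (case_nat b (case_nat a v))"
proof -
  have "(\<lambda>m. case_nat b (case_nat a v) (Transposition.transpose 0 (Suc 0) m)) = case_nat a (case_nat b v)"
    by (auto simp: fun_eq_iff Transposition.transpose_def split: nat.split)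
  with alt_forms_swap[OF f, of 0 "Suc 0" "case_nat b (case_nat a v)"] show ?thesis by simp
qed

text \<open>Only k + 1 entries count, so f is evaluated at u k, u 0, ..., u (k - 1): the last vector
  has moved past k others. This produces the sign in the product rule for contractions, when the
  vector lands in the second factor.\<close>

lemma alt_forms_rotate:
  fixes f :: "(nat \<Rightarrow> 'v::real_vector) \<Rightarrow> real"
  shows "f \<in> alt_forms (Suc k) \<Longrightarrow> f (case_nat (u k) u) = (-1) ^ k * f u"
proof (induction k arbitrary: f u)
  case 0
  have "f (case_nat (u 0) u) = f u" by (rule alt_forms_cong[OF 0]) auto
  then show ?case by simp
next
  case (Suc k)
  let ?u = "\<lambda>i. u (Suc i)"
  have c: "contract (u 0) f \<in> alt_forms (Suc k)"
    unfolding alt_forms_def mem_Collect_eq contract_def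
  proof (intro conjI allI impI)
    fix v w :: "nat \<Rightarrow> 'v" assume "\<forall>i<Suc k. v i = w i"
    then show "f (case_nat (u 0) v) = f (case_nat (u 0) w)"
      by (intro alt_forms_cong[OF Suc.prems]) (auto split: nat.split)
  next
    fix i and v :: "nat \<Rightarrow> 'v" assume "i < Suc k"
    then show "linear (\<lambda>x. f (case_nat (u 0) (v(i := x))))"
      using alt_forms_linear[OF Suc.prems, of "Suc i" "case_nat (u 0) v"]
      by (simp add: case_nat_upd_Suc)
  next
    fix i j and v :: "nat \<Rightarrow> 'v" assume "i < Suc k" "j < Suc k" "i \<noteq> j \<and> v i = v j"
    then show "f (case_nat (u 0) v) = 0"
      by (intro alt_forms_eq0[OF Suc.prems, of "Suc i" "Suc j"]) auto
  qed
  have "f (case_nat (u (Suc k)) u) = f (case_nat (u (Suc k)) (case_nat (u 0) ?u))"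
    by simp
  also have "\<dots> = - contract (u 0) f (case_nat (?u k) ?u)"
    unfolding contract_def by (rule alt_forms_swap_head[OF Suc.prems])
  also have "\<dots> = - ((-1) ^ k * contract (u 0) f ?u)" by (simp only: Suc.IH[OF c, of ?u])
  finally show ?case by (simp add: contract_def)
qed

lemma contract_alt_forms:
  fixes f :: "(nat \<Rightarrow> 'v::real_vector) \<Rightarrow> real"
  assumes f: "f \<in> alt_forms (Suc k)"
  shows "contract X f \<in> alt_forms k"
  unfolding alt_forms_def mem_Collect_eq contract_def
proof (intro conjI allI impI)
  fix v w :: "nat \<Rightarrow> 'v" assume "\<forall>i<k. v i = w i"
  then show "f (case_nat X v) = f (case_nat X w)"
    by (intro alt_forms_cong[OF f]) (auto split: nat.split)
next
  fix i and v :: "nat \<Rightarrow> 'v" assume "i < k"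
  then show "linear (\<lambda>x. f (case_nat X (v(i := x))))"
    using alt_forms_linear[OF f, of "Suc i" "case_nat X v"]
    by (simp add: case_nat_upd_Suc)
next
  fix i j and v :: "nat \<Rightarrow> 'v" assume "i < k" "j < k" "i \<noteq> j \<and> v i = v j"
  then show "f (case_nat X v) = 0"
    by (intro alt_forms_eq0[OF f, of "Suc i" "Suc j"]) auto
qed

lemma contract_linear:
  assumes f: "f \<in> alt_forms (Suc k)"
  shows "linear (\<lambda>X. contract X f v)"
  using alt_forms_linear[OF f, of 0 "case_nat 0 v"] by (simp add: contract_def case_nat_upd_0)

lemma contract_contract:
  assumes f: "f \<in> alt_forms (Suc (Suc k))"
  shows "contract X (contract X f) = (\<lambda>v. 0)"
  unfolding contract_def fun_eq_iff
  by (auto intro: alt_forms_eq0[OF f, of 0 "Suc 0"])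

text \<open>The inductive route to alternation. Once all contractions are alternating, only the
  first slot and its interaction with the second remain to be checked, and polarisation then gives
  the swap of the first two slots. The last hypothesis is restricted to \<open>k = Suc j\<close>
  because a one-form has no second slot.\<close>

lemma alt_formsI_contract:
  fixes f :: "(nat \<Rightarrow> 'v::real_vector) \<Rightarrow> real"
  assumes c: "\<And>X. contract X f \<in> alt_forms k"
    and l: "\<And>v. linear (\<lambda>X. contract X f v)"
    and z: "\<And>X j. k = Suc j \<Longrightarrow> contract X (contract X f) = (\<lambda>v. 0)"
  shows "f \<in> alt_forms (Suc k)"
proof -
  have fv: "f v = contract (v 0) f (\<lambda>i. v (Suc i))" for v by (simp add: contract_def)
  have sw: "f (case_nat a (case_nat b v)) = - f (case_nat b (case_nat a v))" if k: "k = Suc j" for a b v j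
  proof -
    define g where "g a b = f (case_nat a (case_nat b v))" for a b
    have l1: "linear (\<lambda>a. g a b)" for b using l[of "case_nat b v"] by (simp add: g_def contract_def)
    have l2: "linear (\<lambda>b. g a b)" for a
      using contract_linear[of "contract a f" j v] c[of a] k by (simp add: g_def contract_def)
    have "g a a = 0" for a using fun_cong[OF z[OF k, of a], of v] by (simp add: g_def contract_def)
    moreover have "g (a + b) (a + b) = g a a + g a b + g b a + g b b"
      using linear_add[OF l1] linear_add[OF l2] by simp
    ultimately show ?thesis by (simp add: g_def)
  qed
  have zero: "f v = 0" if j: "0 < j" "j < Suc k" "v 0 = v j" for j v
  proof -
    obtain k' where k': "k = Suc k'" using j(1,2) by (cases k) auto
    define w where "w i = v (Suc (Suc i))" for i
    have v: "v = case_nat (v 0) (case_nat (v 1) w)"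
      unfolding w_def by (auto simp: fun_eq_iff split: nat.split)
    show ?thesis
    proof (cases "j = 1")
      case True
      then show ?thesis using fun_cong[OF z[OF k', of "v 0"], of w] v j
        by (simp add: contract_def)
    next
      case False
      \<comment> \<open>After exchanging the first two slots, both equal entries lie in the tail, at
        positions 0 and j - 1, where alternation is already known.\<close>
      have "contract (v 1) f (case_nat (v 0) w) = 0"
        by (rule alt_forms_eq0[OF c, of 0 "j - 1"])
          (use j False in \<open>auto simp: w_def split: nat.split intro!: arg_cong[where f = v]\<close>)
      then show ?thesis using sw[OF k', of "v 0" "v 1" w] v by (simp add: contract_def)
    qed
  qed
  show ?thesis
    unfolding alt_forms_def mem_Collect_eq
  proof (intro conjI allI impI)
    fix u v :: "nat \<Rightarrow> 'v" assume "\<forall>i<Suc k. u i = v i"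
    then show "f u = f v" unfolding fv[of u] fv[of v]
      by (simp, intro alt_forms_cong[OF c]) auto
  next
    fix i and v :: "nat \<Rightarrow> 'v" assume "i < Suc k"
    then show "linear (\<lambda>x. f (v(i := x)))"
    proof (cases i)
      case 0
      then show ?thesis using l[of "\<lambda>i. v (Suc i)"] by (subst fv) simp
    next
      case (Suc m)
      have "(\<lambda>i. (v(Suc m := x)) (Suc i)) = (\<lambda>i. v (Suc i))(m := x)" for x by auto
      then show ?thesis using alt_forms_linear[OF c[of "v 0"], of m] \<open>i < Suc k\<close> Suc
        by (subst fv) simp
    qed
  next
    fix i j and v :: "nat \<Rightarrow> 'v" assume a: "i < Suc k" "j < Suc k" "i \<noteq> j \<and> v i = v j"
    consider "i = 0" | "j = 0" | "i \<noteq> 0" "j \<noteq> 0" by blast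
    then show "f v = 0"
    proof cases
      case 1
      then show ?thesis using a by (intro zero[of j]) auto
    next
      case 2
      then show ?thesis using a by (intro zero[of i]) auto
    next
      case 3
      then show ?thesis using a
        by (subst fv, intro alt_forms_eq0[OF c, of "i - 1" "j - 1"]) auto
    qed
  qed
qed

lemma contract_zero [simp]: "contract X (\<lambda>v. 0) = (\<lambda>v. 0)"
  by (simp add: contract_def fun_eq_iff)

lemma contract_add: "contract X (\<lambda>v. f v + g v) = (\<lambda>v. contract X f v + contract X g v)"
  by (simp add: contract_def fun_eq_iff)

lemma contract_diff: "contract X (\<lambda>v. f v - g v) = (\<lambda>v. contract X f v - contract X g v)"
  by (simp add: contract_def fun_eq_iff)

lemma contract_scale: "contract X (\<lambda>v. c * f v) = (\<lambda>v. c * contract X f v)"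
  by (simp add: contract_def fun_eq_iff)

lemma contract_sum: "contract X (\<lambda>v. \<Sum>i\<in>I. f i v) = (\<lambda>v. \<Sum>i\<in>I. contract X (f i) v)"
  by (simp add: contract_def fun_eq_iff)

subsection \<open>The wedge product\<close>

text \<open>Permutations are sorted by the position b that they send to 0. The known decomposition
  puts the transposition on the left, so the sum is inverted before and after its use.\<close>

lemma sum_permutes_insert_0:
  "(\<Sum>\<sigma> | \<sigma> permutes {..<Suc n}. F \<sigma>) =
   (\<Sum>b<Suc n. \<Sum>q | q permutes {1..<Suc n}. F (q \<circ> Transposition.transpose 0 b))"
  for F :: "_ \<Rightarrow> real"
proof -
  have ins: "{..<Suc n} = insert 0 {1..<Suc n}" by auto
  have "(\<Sum>\<sigma> | \<sigma> permutes {..<Suc n}. F \<sigma>) = (\<Sum>\<sigma> | \<sigma> permutes {..<Suc n}. F (inv \<sigma>))"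
    by (rule sum_permutations_inverse)
  also have "\<dots> = (\<Sum>b<Suc n. \<Sum>q | q permutes {1..<Suc n}. F (inv (Transposition.transpose 0 b \<circ> q)))"
    unfolding ins by (rule sum_over_permutations_insert) auto
  also have "\<dots> = (\<Sum>b<Suc n. \<Sum>q | q permutes {1..<Suc n}. F (inv q \<circ> Transposition.transpose 0 b))"
    by (intro sum.cong refl arg_cong[where f = F])
      (simp add: o_inv_distrib permutes_bij)
  also have "\<dots> = (\<Sum>b<Suc n. \<Sum>q | q permutes {1..<Suc n}. F (q \<circ> Transposition.transpose 0 b))"
    by (intro sum.cong refl sum_permutations_inverse[of "\<lambda>q. F (q \<circ> _)", symmetric])
  finally show ?thesis .
qed

definition shift_perm :: "(nat \<Rightarrow> nat) \<Rightarrow> nat \<Rightarrow> nat" where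
  "shift_perm \<tau> = (\<lambda>i. case i of 0 \<Rightarrow> 0 | Suc j \<Rightarrow> Suc (\<tau> j))"

lemma shift_perm_permutes:
  assumes "\<tau> permutes {..<n}" shows "shift_perm \<tau> permutes {1..<Suc n}"
proof -
  have "inj (shift_perm \<tau>)"
  proof (rule injI)
    fix i j assume "shift_perm \<tau> i = shift_perm \<tau> j"
    then show "i = j" using injD[OF permutes_inj[OF assms], of "i - 1" "j - 1"]
      by (cases i; cases j) (simp_all add: shift_perm_def)
  qed
  moreover have "shift_perm \<tau> i = i" if "i \<notin> {1..<Suc n}" for i
    using that permutes_not_in[OF assms, of "i - 1"] by (cases i) (simp_all add: shift_perm_def)
  moreover have "shift_perm \<tau> ` {1..<Suc n} = {1..<Suc n}"
  proof -
    have S: "{1..<Suc n} = Suc ` {..<n}" by (simp only: lessThan_atLeast0 image_Suc_atLeastLessThan One_nat_def)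
    have "shift_perm \<tau> ` Suc ` {..<n} = Suc ` \<tau> ` {..<n}"
      by (simp add: shift_perm_def image_image)
    then show ?thesis unfolding S permutes_image[OF assms] .
  qed
  ultimately show ?thesis
    using bij_imp_permutes[of "shift_perm \<tau>" "{1..<Suc n}"]
    by (simp add: bij_betw_def inj_on_subset[OF _ subset_UNIV] del: atLeastLessThan_iff)
qed

lemma sign_shift_perm:
  assumes "\<tau> permutes {..<n}" shows "sign (shift_perm \<tau>) = sign \<tau>"
proof -
  have "shift_perm \<tau> = map_permutation {..<n} Suc \<tau>"
  proof
    fix i show "shift_perm \<tau> i = map_permutation {..<n} Suc \<tau> i"
    proof (cases i)
      case (Suc j)
      have "inv_into {..<n} Suc (Suc j) = j" if "j < n"
        using that by (intro inv_into_f_f) auto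
      then show ?thesis using Suc permutes_not_in[OF assms, of j]
        by (auto simp: shift_perm_def map_permutation_def restrict_id_def)
    qed (auto simp: shift_perm_def map_permutation_def restrict_id_def)
  qed
  then show ?thesis using sign_map_permutation[of Suc "{..<n}" \<tau>] assms by simp
qed

lemma sum_shift_perm:
  "(\<Sum>q | q permutes {1..<Suc n}. F q) = (\<Sum>\<tau> | \<tau> permutes {..<n}. F (shift_perm \<tau>))"
  for F :: "_ \<Rightarrow> real"
proof (rule sum.reindex_bij_witness[of _ shift_perm "\<lambda>q i. q (Suc i) - 1"])
  fix q assume "q \<in> {q. q permutes {1..<Suc n}}"
  hence q: "q permutes {1..<Suc n}" by simp
  have pos: "q (Suc i) \<noteq> 0" for i
    using permutes_not_in[OF q, of 0] permutes_inj[OF q] by (metis atLeastLessThan_iff injD nat.distinct(1) not_one_le_zero)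
  have q0: "q 0 = 0" using permutes_not_in[OF q, of 0] by simp
  show "shift_perm (\<lambda>i. q (Suc i) - 1) = q"
    using pos q0 by (auto simp: shift_perm_def fun_eq_iff split: nat.split)
  have "(\<lambda>i. q (Suc i) - 1) permutes {..<n}"
  proof (rule bij_imp_permutes)
    have "inj_on (\<lambda>i. q (Suc i) - 1) {..<n}"
      using permutes_inj[OF q] pos by (intro inj_onI) (metis One_nat_def Suc_pred bot_nat_0.not_eq_extremum injD nat.inject)
    moreover have "(\<lambda>i. q (Suc i) - 1) ` {..<n} \<subseteq> {..<n}"
    proof
      fix x assume "x \<in> (\<lambda>i. q (Suc i) - 1) ` {..<n}"
      then obtain i where "i < n" "x = q (Suc i) - 1" by auto
      moreover have "q (Suc i) \<in> {1..<Suc n}" using \<open>i < n\<close> permutes_in_image[OF q] by simp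
      ultimately show "x \<in> {..<n}" by auto
    qed
    ultimately show "bij_betw (\<lambda>i. q (Suc i) - 1) {..<n} {..<n}"
      by (simp add: bij_betw_def endo_inj_surj)
    show "q (Suc x) - 1 = x" if "x \<notin> {..<n}" for x
      using permutes_not_in[OF q, of "Suc x"] that by simp
  qed
  then show "(\<lambda>i. q (Suc i) - 1) \<in> {\<tau>. \<tau> permutes {..<n}}" by simp
  show "F (shift_perm (\<lambda>i. q (Suc i) - 1)) = F q"
    using \<open>shift_perm (\<lambda>i. q (Suc i) - 1) = q\<close> by simp
next
  fix \<tau> assume "\<tau> \<in> {\<tau>. \<tau> permutes {..<n}}"
  then show "shift_perm \<tau> \<in> {q. q permutes {1..<Suc n}}"
    using shift_perm_permutes by blast
  show "(\<lambda>i. shift_perm \<tau> (Suc i) - 1) = \<tau>" by (simp add: shift_perm_def)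
qed

lemma sign_compose_transpose:
  assumes "q permutes S" "finite S"
  shows "sign (q \<circ> Transposition.transpose a b) = (if a = b then sign q else - sign q)"
proof -
  have "permutation q" using assms unfolding permutation_permutes by blast
  from sign_compose[OF this permutation_swap_id, of a b] show ?thesis by (auto simp: sign_swap_id)
qed

text \<open>The summand of \<open>alt_wedge\<close> before division by the factorials; the recursion
  for these sums has integer coefficients.\<close>

definition wedge_num where
  "wedge_num k f g v \<sigma> = of_int (sign \<sigma>) * f (\<lambda>i. v (\<sigma> i)) * g (\<lambda>i. v (\<sigma> (k + i)))" for f g :: "(nat \<Rightarrow> 'v) \<Rightarrow> real"

text \<open>Here b is the slot that receives X. Each of the k slots of f gives the same
  contribution, since the sign of moving X to the front of f cancels the sign of the transposition.
  Each of the l slots of g gives the same contribution up to the common sign (-1)^k.\<close>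

lemma contract_wedge_sum:
  fixes f g :: "(nat \<Rightarrow> 'v::real_vector) \<Rightarrow> real"
  assumes f: "f \<in> alt_forms k" and g: "g \<in> alt_forms l" and n: "k + l = Suc n"
  shows "(\<Sum>\<sigma> | \<sigma> permutes {..<k + l}. wedge_num k f g (case_nat X u) \<sigma>) =
     k * (\<Sum>\<sigma> | \<sigma> permutes {..<n}. wedge_num (k - 1) (contract X f) g u \<sigma>) +
     (-1) ^ k * l * (\<Sum>\<sigma> | \<sigma> permutes {..<n}. wedge_num k f (contract X g) u \<sigma>)"
proof -
  let ?F = "wedge_num k f g (case_nat X u)"
  let ?A = "\<Sum>\<sigma> | \<sigma> permutes {..<n}. wedge_num (k - 1) (contract X f) g u \<sigma>"
  let ?B = "\<Sum>\<sigma> | \<sigma> permutes {..<n}. wedge_num k f (contract X g) u \<sigma>"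
  define G where "G b = (\<Sum>q | q permutes {1..<Suc n}. ?F (q \<circ> Transposition.transpose 0 b))" for b
  have G1: "G b = ?A" if b: "b < k" for b
  proof -
    have "?F (shift_perm \<tau> \<circ> Transposition.transpose 0 b) = wedge_num (k - 1) (contract X f) g u \<tau>"
      if \<tau>: "\<tau> permutes {..<n}" for \<tau>
    proof -
      define w where "w = (\<lambda>i. case_nat X u (shift_perm \<tau> i))"
      have F: "?F (shift_perm \<tau> \<circ> Transposition.transpose 0 b) = of_int (sign (shift_perm \<tau> \<circ> Transposition.transpose 0 b)) *
          f (\<lambda>i. w (Transposition.transpose 0 b i)) * g (\<lambda>i. w (Transposition.transpose 0 b (k + i)))"
        by (simp add: wedge_num_def w_def)
      have w: "w = case_nat X (\<lambda>i. u (\<tau> i))"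
        by (auto simp: w_def shift_perm_def fun_eq_iff split: nat.split)
      have "f (\<lambda>i. w (Transposition.transpose 0 b i)) = (if b = 0 then 1 else -1) * f w"
        using alt_forms_swap[OF f, of 0 b w] b by auto
      moreover have "g (\<lambda>i. w (Transposition.transpose 0 b (k + i))) = g (\<lambda>i. u (\<tau> (k - 1 + i)))"
      proof (rule alt_forms_cong[OF g])
        fix i
        obtain k' where "k = Suc k'" using b by (cases k) auto
        then show "w (Transposition.transpose 0 b (k + i)) = u (\<tau> (k - 1 + i))"
          using b by (simp add: w Transposition.transpose_def)
      qed
      moreover have "sign (shift_perm \<tau> \<circ> Transposition.transpose 0 b) = (if b = 0 then 1 else -1) * sign \<tau>"
        using sign_compose_transpose[OF shift_perm_permutes[OF \<tau>], of 0 b] sign_shift_perm[OF \<tau>] by auto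
      ultimately show ?thesis
        unfolding F by (simp add: wedge_num_def contract_def w)
    qed
    then show ?thesis unfolding G_def sum_shift_perm by (intro sum.cong) auto
  qed
  have G2: "G b = (-1) ^ k * ?B" if b: "k \<le> b" "b < Suc n" for b
  proof (cases k)
    case 0
    have "?F (shift_perm \<tau> \<circ> Transposition.transpose 0 b) = wedge_num k f (contract X g) u \<tau>"
      if \<tau>: "\<tau> permutes {..<n}" for \<tau>
    proof -
      define w where "w = (\<lambda>i. case_nat X u (shift_perm \<tau> i))"
      have F: "?F (shift_perm \<tau> \<circ> Transposition.transpose 0 b) = of_int (sign (shift_perm \<tau> \<circ> Transposition.transpose 0 b)) *
          f (\<lambda>i. w (Transposition.transpose 0 b i)) * g (\<lambda>i. w (Transposition.transpose 0 b (k + i)))"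
        by (simp add: wedge_num_def w_def)
      have w: "w = case_nat X (\<lambda>i. u (\<tau> i))"
        by (auto simp: w_def shift_perm_def fun_eq_iff split: nat.split)
      have "g (\<lambda>i. w (Transposition.transpose 0 b i)) = (if b = 0 then 1 else -1) * g w"
        using alt_forms_swap[OF g, of 0 b w] b 0 n by auto
      moreover have "f x = f y" for x y
        using f 0 by (auto elim: alt_forms_0E)
      hence "f (\<lambda>i. w (Transposition.transpose 0 b i)) = f (\<lambda>i. u (\<tau> i))" .
      moreover have "sign (shift_perm \<tau> \<circ> Transposition.transpose 0 b) = (if b = 0 then 1 else -1) * sign \<tau>"
        using sign_compose_transpose[OF shift_perm_permutes[OF \<tau>], of 0 b] sign_shift_perm[OF \<tau>] by auto
      ultimately show ?thesis
        unfolding F using 0 by (simp add: wedge_num_def contract_def w)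
    qed
    then show ?thesis unfolding G_def sum_shift_perm using 0 by simp
  next
    case (Suc k')
    \<comment> \<open>Without the extra transposition of k and b, the first slot of f would hold an
      entry depending on b. With it, f receives the rotation u (\<tau> (k - 1)), u (\<tau> 0), ...,
      u (\<tau> (k - 2)) for every b, and g receives X in its slot b - k.\<close>
    have "G b = (\<Sum>q | q permutes {1..<Suc n}. ?F ((q \<circ> Transposition.transpose k b) \<circ> Transposition.transpose 0 b))"
      unfolding G_def
      by (rule sum_permutations_compose_right) (use b Suc n in \<open>auto intro!: permutes_swap_id\<close>)
    also have "\<dots> = (\<Sum>\<tau> | \<tau> permutes {..<n}. (-1) ^ k * wedge_num k f (contract X g) u \<tau>)"
      unfolding sum_shift_perm
    proof (intro sum.cong refl)
      fix \<tau> assume "\<tau> \<in> {\<tau>. \<tau> permutes {..<n}}"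
      hence \<tau>: "\<tau> permutes {..<n}" by simp
      define w where "w = (\<lambda>i. case_nat X u (shift_perm \<tau> i))"
      have F: "?F (shift_perm \<tau> \<circ> Transposition.transpose k b \<circ> Transposition.transpose 0 b) = of_int (sign (shift_perm \<tau> \<circ> Transposition.transpose k b \<circ> Transposition.transpose 0 b)) *
          f (\<lambda>i. w (Transposition.transpose k b (Transposition.transpose 0 b i))) * g (\<lambda>i. w (Transposition.transpose k b (Transposition.transpose 0 b (k + i))))"
        by (simp add: wedge_num_def w_def)
      have w: "w = case_nat X (\<lambda>i. u (\<tau> i))"
        by (auto simp: w_def shift_perm_def fun_eq_iff split: nat.split)
      let ?u = "\<lambda>i. u (\<tau> i)"
      have "f (\<lambda>i. w (Transposition.transpose k b (Transposition.transpose 0 b i))) = f (case_nat (?u k') ?u)"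
        by (rule alt_forms_cong[OF f]) (use Suc b in \<open>auto simp: w Transposition.transpose_def split: nat.split\<close>)
      also have "\<dots> = (-1) ^ k' * f ?u" using alt_forms_rotate f Suc by metis
      finally have 1: "f (\<lambda>i. w (Transposition.transpose k b (Transposition.transpose 0 b i))) = (-1) ^ k' * f ?u" .
      let ?v = "case_nat X (\<lambda>i. u (\<tau> (k + i)))"
      have "g (\<lambda>i. w (Transposition.transpose k b (Transposition.transpose 0 b (k + i)))) = g (\<lambda>i. ?v (Transposition.transpose 0 (b - k) i))"
        by (rule alt_forms_cong[OF g]) (use Suc b in \<open>auto simp: w Transposition.transpose_def split: nat.split
            intro!: arg_cong[where f = "\<lambda>i. u (\<tau> i)"]\<close>)
      also have "\<dots> = (if b = k then 1 else - 1) * g ?v"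
        using alt_forms_swap[OF g, of 0 "b - k" ?v] b Suc n by auto
      finally have 2: "g (\<lambda>i. w (Transposition.transpose k b (Transposition.transpose 0 b (k + i)))) = (if b = k then 1 else - 1) * g ?v" .
      have p: "shift_perm \<tau> \<circ> Transposition.transpose k b permutes {1..<Suc n}"
        using shift_perm_permutes[OF \<tau>] b Suc n by (intro permutes_compose permutes_swap_id) auto
      have 3: "sign (shift_perm \<tau> \<circ> Transposition.transpose k b \<circ> Transposition.transpose 0 b) = (if b = k then -1 else 1) * sign \<tau>"
        using sign_compose_transpose[OF p, of 0 b] b Suc
          sign_compose_transpose[OF shift_perm_permutes[OF \<tau>], of k b] sign_shift_perm[OF \<tau>]
        by auto
      show "?F ((shift_perm \<tau> \<circ> Transposition.transpose k b) \<circ> Transposition.transpose 0 b) = (-1) ^ k * wedge_num k f (contract X g) u \<tau>"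
        unfolding F 1 2 3 using Suc by (simp add: wedge_num_def contract_def)
    qed
    finally show ?thesis by (simp add: sum_distrib_left)
  qed
  have "(\<Sum>\<sigma> | \<sigma> permutes {..<k + l}. ?F \<sigma>) = (\<Sum>b<Suc n. G b)"
    unfolding n G_def by (rule sum_permutes_insert_0)
  also have "\<dots> = (\<Sum>b<k. G b) + (\<Sum>b\<in>{k..<k + l}. G b)"
    using n by (simp only: n[symmetric] lessThan_atLeast0 sum.atLeastLessThan_concat zero_le le_add1)
  also have "\<dots> = (\<Sum>b<k. ?A) + (\<Sum>b\<in>{k..<k + l}. (-1) ^ k * ?B)"
    using G1 G2 n by (intro arg_cong2[where f = "(+)"] sum.cong) auto
  finally show ?thesis by simp
qed

text \<open>Interior products are antiderivations. The factors k and l counted in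
  \<open>contract_wedge_sum\<close> turn k! and l! into (k - 1)! and (l - 1)!.\<close>

lemma contract_wedge:
  fixes f g :: "(nat \<Rightarrow> 'v::real_vector) \<Rightarrow> real"
  assumes f: "f \<in> alt_forms k" and g: "g \<in> alt_forms l" and pos: "0 < k + l"
  shows "contract X (alt_wedge k l f g) =
     (\<lambda>u. (if k = 0 then 0 else alt_wedge (k - 1) l (contract X f) g u) +
      (-1) ^ k * (if l = 0 then 0 else alt_wedge k (l - 1) f (contract X g) u))"
proof
  fix u
  obtain n where n: "k + l = Suc n" using pos by (cases "k + l") auto
  have "k - 1 + l = n" if "k \<noteq> 0" using that n by simp
  moreover have "k + (l - 1) = n" if "l \<noteq> 0" using that n by simp
  moreover have "fact k = (real k * fact (k - 1))" if "k \<noteq> 0" using that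
    by (simp add: fact_reduce)
  moreover have "fact l = (real l * fact (l - 1))" if "l \<noteq> 0" using that
    by (simp add: fact_reduce)
  ultimately show "contract X (alt_wedge k l f g) u =
    (if k = 0 then 0 else alt_wedge (k - 1) l (contract X f) g u) +
      (-1) ^ k * (if l = 0 then 0 else alt_wedge k (l - 1) f (contract X g) u)"
    using contract_wedge_sum[OF f g n, of X u]
    by (auto simp: contract_def[of X "alt_wedge k l f g"] alt_wedge_def[of _ _ _ _ "_::nat \<Rightarrow> 'v"] wedge_num_def add_divide_distrib)
qed

text \<open>Zero in degree \<open>0\<close>, so that, with truncated subtraction of degrees, the product rule
  \<open>iprod_wedge\<close> needs no case distinction.\<close>

definition iprod :: "nat \<Rightarrow> 'v \<Rightarrow> ((nat \<Rightarrow> 'v) \<Rightarrow> real) \<Rightarrow> (nat \<Rightarrow> 'v) \<Rightarrow> real" where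
  "iprod k X f = (if k = 0 then (\<lambda>v. 0) else contract X f)"

lemma iprod_0 [simp]: "iprod 0 X f = (\<lambda>v. 0)"
  and iprod_Suc [simp]: "iprod (Suc k) X f = contract X f"
  by (simp_all add: iprod_def)

lemma iprod_alt_forms: "f \<in> alt_forms k \<Longrightarrow> iprod k X f \<in> alt_forms (k - 1)"
  by (cases k) (auto intro: contract_alt_forms)

lemma iprod_ext: "(\<And>X. iprod (Suc k) X f = iprod (Suc k) X g) \<Longrightarrow> f = g"
  by (rule contract_ext) simp

lemma iprod_linear:
  assumes f: "f \<in> alt_forms k"
  shows "linear (\<lambda>X. iprod k X f v)"
  using contract_linear[of f "k - 1" v] f by (cases k) (auto intro: linear_zero)

lemma degree_cases: obtains "k = 0" | "k = Suc 0" | j where "k = Suc (Suc j)"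
  by (cases k rule: nat.exhaust; metis not0_implies_Suc)

lemma iprod_iprod:
  assumes "f \<in> alt_forms k" shows "iprod (k - 1) X (iprod k X f) = (\<lambda>v. 0)"
proof (cases k rule: degree_cases)
  case (3 j)
  then show ?thesis using contract_contract[of f j X] assms by simp
qed simp_all

lemma iprod_swap:
  assumes "f \<in> alt_forms k"
  shows "iprod (k - 1) X (iprod k Y f) = (\<lambda>v. - iprod (k - 1) Y (iprod k X f) v)"
proof (cases k rule: degree_cases)
  case (3 j)
  then have "f \<in> alt_forms (Suc (Suc j))" using assms by simp
  from alt_forms_swap_head[OF this, of Y X] show ?thesis
    unfolding 3 by (simp add: contract_def fun_eq_iff)
qed simp_all

lemma iprod_zero [simp]: "iprod k X (\<lambda>v. 0) = (\<lambda>v. 0)"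
  by (simp add: iprod_def)

lemma iprod_scale: "iprod k X (\<lambda>v. c * f v) = (\<lambda>v. c * iprod k X f v)"
  by (simp add: iprod_def contract_scale)

lemma iprod_vector_add:
  "f \<in> alt_forms k \<Longrightarrow> iprod k (X + Y) f = (\<lambda>v. iprod k X f v + iprod k Y f v)"
  using linear_add[OF iprod_linear[of f k]] by (simp add: fun_eq_iff)

lemma iprod_vector_scale:
  "f \<in> alt_forms k \<Longrightarrow> iprod k (c *\<^sub>R X) f = (\<lambda>v. c * iprod k X f v)"
  using linear_scale[OF iprod_linear[of f k]] by (simp add: fun_eq_iff)

lemma iprod_vector_sum:
  assumes "f \<in> alt_forms k"
  shows "iprod k (\<Sum>i\<in>I. X i) f = (\<lambda>v. \<Sum>i\<in>I. iprod k (X i) f v)"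
  using linear_sum[OF iprod_linear[OF assms], where g = X and S = I] by (simp add: fun_eq_iff)

section \<open>Algebraic laws of the wedge product\<close>

lemma alt_wedge_zero_left [simp]: "alt_wedge k l (\<lambda>v. 0) g = (\<lambda>v. 0)"
  and alt_wedge_zero_right [simp]: "alt_wedge k l f (\<lambda>v. 0) = (\<lambda>v. 0)"
  by (simp_all add: alt_wedge_def fun_eq_iff)

lemma alt_wedge_add_left:
  "alt_wedge k l (\<lambda>v. f v + f' v) g = (\<lambda>v. alt_wedge k l f g v + alt_wedge k l f' g v)"
  by (simp add: alt_wedge_def fun_eq_iff algebra_simps sum.distrib add_divide_distrib)

lemma alt_wedge_add_right:
  "alt_wedge k l f (\<lambda>v. g v + g' v) = (\<lambda>v. alt_wedge k l f g v + alt_wedge k l f g' v)"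
  by (simp add: alt_wedge_def fun_eq_iff algebra_simps sum.distrib add_divide_distrib)

lemma alt_wedge_scale_left:
  "alt_wedge k l (\<lambda>v. c * f v) g = (\<lambda>v. c * alt_wedge k l f g v)"
  by (simp add: alt_wedge_def fun_eq_iff sum_distrib_left mult_ac)

lemma alt_wedge_scale_right:
  "alt_wedge k l f (\<lambda>v. c * g v) = (\<lambda>v. c * alt_wedge k l f g v)"
  by (simp add: alt_wedge_def fun_eq_iff sum_distrib_left mult_ac)

lemma alt_wedge_minus_left: "alt_wedge k l (\<lambda>v. - f v) g = (\<lambda>v. - alt_wedge k l f g v)"
  using alt_wedge_scale_left[of k l "-1" f g] by simp

lemma alt_wedge_minus_right: "alt_wedge k l f (\<lambda>v. - g v) = (\<lambda>v. - alt_wedge k l f g v)"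
  using alt_wedge_scale_right[of k l f "-1" g] by simp

lemma alt_wedge_diff_right:
  "alt_wedge k l f (\<lambda>v. g v - g' v) = (\<lambda>v. alt_wedge k l f g v - alt_wedge k l f g' v)"
  using alt_wedge_add_right[of k l f g "\<lambda>v. - g' v"] by (simp add: alt_wedge_minus_right)

lemma alt_wedge_sum_left:
  "alt_wedge k l (\<lambda>v. \<Sum>i\<in>I. f i v) g = (\<lambda>v. \<Sum>i\<in>I. alt_wedge k l (f i) g v)"
  by (induction I rule: infinite_finite_induct) (simp_all add: alt_wedge_add_left)

lemma alt_wedge_sum_right:
  "alt_wedge k l f (\<lambda>v. \<Sum>i\<in>I. g i v) = (\<lambda>v. \<Sum>i\<in>I. alt_wedge k l f (g i) v)"
  by (induction I rule: infinite_finite_induct) (simp_all add: alt_wedge_add_right)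

lemma alt_wedge_0_0: "alt_wedge 0 0 f g = (\<lambda>v. f v * g v)"
proof
  have "{\<sigma>. \<sigma> permutes {..<0 + 0::nat}} = {id}" by (auto simp only: lessThan_0 add_0 permutes_empty)
  then show "alt_wedge 0 0 f g v = f v * g v" for v
    unfolding alt_wedge_def by simp
qed

lemma iprod_wedge:
  fixes f g :: "(nat \<Rightarrow> 'v::real_vector) \<Rightarrow> real"
  assumes f: "f \<in> alt_forms k" and g: "g \<in> alt_forms l"
  shows "iprod (k + l) X (alt_wedge k l f g) =
     (\<lambda>u. alt_wedge (k - 1) l (iprod k X f) g u + (-1) ^ k * alt_wedge k (l - 1) f (iprod l X g) u)"
  using contract_wedge[OF f g, of X] by (auto simp: iprod_def)

lemma alt_wedge_alt_forms:
  fixes f g :: "(nat \<Rightarrow> 'v::real_vector) \<Rightarrow> real"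
  assumes "f \<in> alt_forms k" and "g \<in> alt_forms l"
  shows "alt_wedge k l f g \<in> alt_forms (k + l)"
  using assms
proof (induction "k + l" arbitrary: k l f g)
  case 0
  then obtain c d where "f = (\<lambda>v. c)" "g = (\<lambda>v. d)" "k = 0" "l = 0"
    by (auto elim!: alt_forms_0E)
  then show ?case by (simp add: alt_wedge_0_0)
next
  case (Suc n)
  note f = Suc.prems(1) and g = Suc.prems(2)
  let ?W = "alt_wedge k l f g"
  have con: "contract X ?W = (\<lambda>u. alt_wedge (k - 1) l (iprod k X f) g u
      + (-1) ^ k * alt_wedge k (l - 1) f (iprod l X g) u)" for X
    using iprod_wedge[OF f g, of X] Suc(2) by (metis iprod_Suc)
  have A: "alt_wedge (k - 1) l (iprod k X f) g \<in> alt_forms n" for X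
  proof (cases k)
    case (Suc k')
    then show ?thesis using Suc.hyps(1)[of "k - 1" l "iprod k X f" g] iprod_alt_forms[OF f, of X] g Suc.hyps(2)
      by simp
  qed simp
  have B: "alt_wedge k (l - 1) f (iprod l X g) \<in> alt_forms n" for X
  proof (cases l)
    case (Suc k')
    then show ?thesis using Suc.hyps(1)[of k "l - 1" f "iprod l X g"] iprod_alt_forms[OF g, of X] f Suc.hyps(2)
      by simp
  qed simp
  show ?case unfolding Suc(2)[symmetric]
  proof (rule alt_formsI_contract)
    show "contract X ?W \<in> alt_forms n" for X
      unfolding con by (intro alt_forms_add alt_forms_scale A B)
    show "linear (\<lambda>X. contract X ?W v)" for v
    proof -
      have "linear (\<lambda>X. alt_wedge (k - 1) l (iprod k X f) g v)"
        by (rule linearI) (simp_all add: iprod_vector_add[OF f] iprod_vector_scale[OF f]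
             alt_wedge_add_left alt_wedge_scale_left)
      moreover have "linear (\<lambda>X. (-1) ^ k * alt_wedge k (l - 1) f (iprod l X g) v)"
        by (rule linearI) (simp_all add: iprod_vector_add[OF g] iprod_vector_scale[OF g]
             alt_wedge_add_right alt_wedge_scale_right algebra_simps)
      ultimately show ?thesis unfolding con by (rule linear_compose_add)
    qed
    \<comment> \<open>Contracting twice with X leaves only the two mixed terms in \<iota>_X f \<and>
      \<iota>_X g, and they have opposite signs.\<close>
    show "contract X (contract X ?W) = (\<lambda>v. 0)" if n: "n = Suc j" for X j
    proof -
      have 1: "contract X (alt_wedge (k - 1) l (iprod k X f) g) =
         (\<lambda>u. - ((-1) ^ k * alt_wedge (k - 1) (l - 1) (iprod k X f) (iprod l X g) u))"
      proof (cases k)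
        case (Suc k')
        have "k - 1 + l = Suc j" using n Suc Suc.hyps(2) by simp
        then show ?thesis
          using iprod_wedge[OF iprod_alt_forms[OF f, of X] g, of X] iprod_iprod[OF f, of X] Suc
          by (simp del: diff_Suc_1)
      qed simp
      have 2: "contract X (alt_wedge k (l - 1) f (iprod l X g)) =
         (\<lambda>u. alt_wedge (k - 1) (l - 1) (iprod k X f) (iprod l X g) u)"
      proof (cases l)
        case (Suc k')
        have "k + (l - 1) = Suc j" using n Suc Suc.hyps(2) by simp
        then show ?thesis
          using iprod_wedge[OF f iprod_alt_forms[OF g, of X], of X] iprod_iprod[OF g, of X] Suc
          by (simp del: diff_Suc_1)
      qed simp
      show ?thesis unfolding con contract_add contract_scale 1 2 by simp
    qed
  qed
qed

lemma alt_wedge_assoc: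
  fixes f g h :: "(nat \<Rightarrow> 'v::real_vector) \<Rightarrow> real"
  assumes "f \<in> alt_forms k" "g \<in> alt_forms l" "h \<in> alt_forms m"
  shows "alt_wedge (k + l) m (alt_wedge k l f g) h = alt_wedge k (l + m) f (alt_wedge l m g h)"
  using assms
proof (induction "k + l + m" arbitrary: k l m f g h)
  case 0
  then obtain a b c where "f = (\<lambda>v. a)" "g = (\<lambda>v. b)" "h = (\<lambda>v. c)" "k = 0" "l = 0" "m = 0"
    by (auto elim!: alt_forms_0E)
  then show ?case by (simp add: alt_wedge_0_0 mult_ac)
next
  case (Suc n)
  note f = Suc.prems(1) and g = Suc.prems(2) and h = Suc.prems(3)
  show ?case
  proof (rule iprod_ext[of n])
    fix X
    have 1: "alt_wedge (k + l - 1) m (alt_wedge (k - 1) l (iprod k X f) g) h =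
        alt_wedge (k - 1) (l + m) (iprod k X f) (alt_wedge l m g h)"
    proof (cases k)
      case (Suc k')
      then show ?thesis
        using Suc.hyps(1)[of "k - 1" l m "iprod k X f" g h] iprod_alt_forms[OF f, of X] g h Suc.hyps(2) by simp
    qed simp
    have 2: "alt_wedge (k + l - 1) m (alt_wedge k (l - 1) f (iprod l X g)) h =
        alt_wedge k (l + m - 1) f (alt_wedge (l - 1) m (iprod l X g) h)"
    proof (cases l)
      case (Suc k')
      then show ?thesis
        using Suc.hyps(1)[of k "l - 1" m f "iprod l X g" h] iprod_alt_forms[OF g, of X] f h Suc.hyps(2) by simp
    qed simp
    have 3: "alt_wedge (k + l) (m - 1) (alt_wedge k l f g) (iprod m X h) =
        alt_wedge k (l + m - 1) f (alt_wedge l (m - 1) g (iprod m X h))"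
    proof (cases m)
      case (Suc k')
      then show ?thesis
        using Suc.hyps(1)[of k l "m - 1" f g "iprod m X h"] iprod_alt_forms[OF h, of X] f g Suc.hyps(2) by simp
    qed simp
    have "iprod (k + l + m) X (alt_wedge (k + l) m (alt_wedge k l f g) h) =
        iprod (k + (l + m)) X (alt_wedge k (l + m) f (alt_wedge l m g h))"
      unfolding iprod_wedge[OF alt_wedge_alt_forms[OF f g] h] iprod_wedge[OF f alt_wedge_alt_forms[OF g h]]
        iprod_wedge[OF f g] iprod_wedge[OF g h]
        alt_wedge_add_left alt_wedge_add_right alt_wedge_scale_left alt_wedge_scale_right 1 2 3
      by (simp add: fun_eq_iff algebra_simps power_add)
    then show "iprod (Suc n) X (alt_wedge (k + l) m (alt_wedge k l f g) h) =
        iprod (Suc n) X (alt_wedge k (l + m) f (alt_wedge l m g h))"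
      unfolding Suc.hyps(2) by (simp only: add.assoc)
  qed
qed

lemma alt_wedge_commute:
  fixes f g :: "(nat \<Rightarrow> 'v::real_vector) \<Rightarrow> real"
  assumes "f \<in> alt_forms k" "g \<in> alt_forms l"
  shows "alt_wedge k l f g = (\<lambda>v. (-1) ^ (k * l) * alt_wedge l k g f v)"
  using assms
proof (induction "k + l" arbitrary: k l f g)
  case 0
  then obtain a b where "f = (\<lambda>v. a)" "g = (\<lambda>v. b)" "k = 0" "l = 0"
    by (auto elim!: alt_forms_0E)
  then show ?case by (simp add: alt_wedge_0_0 mult_ac)
next
  case (Suc n)
  note f = Suc.prems(1) and g = Suc.prems(2)
  show ?case
  proof (rule iprod_ext[of n])
    fix X
    \<comment> \<open>The exponent k * l + l has the parity of (k - 1) * l but contains no truncated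
      subtraction, so the formula also covers k = 0, where both sides vanish.\<close>
    have 1: "alt_wedge (k - 1) l (iprod k X f) g = (\<lambda>v. (-1) ^ (k * l + l) * alt_wedge l (k - 1) g (iprod k X f) v)"
    proof (cases k)
      case (Suc k')
      have "(-1) ^ (k * l + l) = ((-1) ^ ((k - 1) * l) :: real)"
        unfolding Suc by (simp add: power_add flip: power_mult_distrib)
      then show ?thesis
        using Suc.hyps(1)[of "k - 1" l "iprod k X f" g] iprod_alt_forms[OF f, of X] g Suc.hyps(2) Suc
        by simp
    qed simp
    have 2: "alt_wedge k (l - 1) f (iprod l X g) = (\<lambda>v. (-1) ^ (k * l + k) * alt_wedge (l - 1) k (iprod l X g) f v)"
    proof (cases l)
      case (Suc k')
      have "(-1) ^ (k * l + k) = ((-1) ^ (k * (l - 1)) :: real)"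
        unfolding Suc by (simp add: power_add flip: power_mult_distrib)
      then show ?thesis
        using Suc.hyps(1)[of k "l - 1" f "iprod l X g"] iprod_alt_forms[OF g, of X] f Suc.hyps(2) Suc
        by simp
    qed simp
    have "iprod (k + l) X (alt_wedge k l f g) = (\<lambda>v. (-1) ^ (k * l) * iprod (l + k) X (alt_wedge l k g f) v)"
      unfolding iprod_wedge[OF f g] iprod_wedge[OF g f] 1 2
      by (simp add: fun_eq_iff algebra_simps power_add flip: power_mult_distrib)
    then show "iprod (Suc n) X (alt_wedge k l f g) = iprod (Suc n) X (\<lambda>v. (-1) ^ (k * l) * alt_wedge l k g f v)"
      unfolding Suc.hyps(2) iprod_scale by (simp only: add.commute)
  qed
qed

text \<open>Moves a factor past its neighbour inside a product nested to the right. It is mostly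
  applied with a two-form as one of the factors, where the sign is +1.\<close>

lemma alt_wedge_exchange:
  fixes f g h :: "(nat \<Rightarrow> 'v::real_vector) \<Rightarrow> real"
  assumes f: "f \<in> alt_forms k" and g: "g \<in> alt_forms l" and h: "h \<in> alt_forms m"
  shows "alt_wedge k (l + m) f (alt_wedge l m g h) =
    (\<lambda>v. (-1) ^ (k * l) * alt_wedge l (k + m) g (alt_wedge k m f h) v)"
proof -
  have "alt_wedge k (l + m) f (alt_wedge l m g h) = alt_wedge (k + l) m (alt_wedge k l f g) h"
    by (rule alt_wedge_assoc[OF f g h, symmetric])
  also have "\<dots> = (\<lambda>v. (-1) ^ (k * l) * alt_wedge (l + k) m (alt_wedge l k g f) h v)"
    by (subst alt_wedge_commute[OF f g]) (simp add: alt_wedge_scale_left add.commute)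
  also have "\<dots> = (\<lambda>v. (-1) ^ (k * l) * alt_wedge l (k + m) g (alt_wedge k m f h) v)"
    unfolding alt_wedge_assoc[OF g f h] ..
  finally show ?thesis .
qed

lemma alt_wedge_const_left:
  fixes g :: "(nat \<Rightarrow> 'v::real_vector) \<Rightarrow> real"
  assumes "g \<in> alt_forms l"
  shows "alt_wedge 0 l (\<lambda>v. c) g = (\<lambda>v. c * g v)"
  using assms
proof (induction l arbitrary: g)
  case (Suc l)
  show ?case
  proof (rule iprod_ext[of l])
    fix X
    show "iprod (Suc l) X (alt_wedge 0 (Suc l) (\<lambda>v. c) g) = iprod (Suc l) X (\<lambda>v. c * g v)"
      using iprod_wedge[OF alt_forms_const[of c] Suc.prems, of X] Suc.IH[OF contract_alt_forms[OF Suc.prems, of X]]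
      by (simp add: contract_scale)
  qed
qed (simp add: alt_wedge_0_0)

lemma alt_wedge_const_right:
  fixes g :: "(nat \<Rightarrow> 'v::real_vector) \<Rightarrow> real"
  assumes "g \<in> alt_forms l"
  shows "alt_wedge l 0 g (\<lambda>v. c) = (\<lambda>v. c * g v)"
  using alt_wedge_commute[OF assms alt_forms_const[of c]] alt_wedge_const_left[OF assms] by simp

lemma alt_wedge_pullback:
  "alt_wedge k l (\<lambda>v. f (\<lambda>i. L (v i))) (\<lambda>v. g (\<lambda>i. L (v i))) = (\<lambda>v. alt_wedge k l f g (\<lambda>i. L (v i)))"
  by (simp add: alt_wedge_def fun_eq_iff)

lemma alt_forms_pullback:
  assumes f: "f \<in> alt_forms k" and L: "linear L"
  shows "(\<lambda>v. f (\<lambda>i. L (v i))) \<in> alt_forms k"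
  unfolding alt_forms_def mem_Collect_eq
proof (intro conjI allI impI)
  show "f (\<lambda>i. L (u i)) = f (\<lambda>i. L (v i))" if "\<forall>i<k. u i = v i" for u v
    using alt_forms_cong[OF f, of "\<lambda>i. L (u i)" "\<lambda>i. L (v i)"] that by simp
  show "linear (\<lambda>x. f (\<lambda>j. L ((v(i := x)) j)))" if "i < k" for i v
  proof -
    have "(\<lambda>j. L ((v(i := x)) j)) = (\<lambda>j. L (v j))(i := L x)" for x by auto
    then show ?thesis
      using linear_compose[OF L alt_forms_linear[OF f that, of "\<lambda>j. L (v j)"]] by (simp add: o_def)
  qed
  show "f (\<lambda>i. L (v i)) = 0" if "i < k" "j < k" "i \<noteq> j \<and> v i = v j" for i j v
    using alt_forms_eq0[OF f, of i j "\<lambda>i. L (v i)"] that by simp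
qed

definition covec :: "('v \<Rightarrow> real) \<Rightarrow> (nat \<Rightarrow> 'v) \<Rightarrow> real" where
  "covec \<phi> v = \<phi> (v 0)"

lemma covec_alt_forms: "linear \<phi> \<Longrightarrow> covec \<phi> \<in> alt_forms (Suc 0)"
  unfolding alt_forms_1_iff by (auto simp: covec_def fun_eq_iff)

lemma contract_1_form:
  assumes "\<theta> \<in> alt_forms (Suc 0)"
  shows "contract X \<theta> = (\<lambda>v. \<theta> (\<lambda>_. X))"
  unfolding contract_def by (intro ext alt_forms_cong[OF assms]) simp

lemma iprod_wedge_1:
  fixes \<theta> g :: "(nat \<Rightarrow> 'v::real_vector) \<Rightarrow> real"
  assumes th: "\<theta> \<in> alt_forms (Suc 0)" and g: "g \<in> alt_forms k"
  shows "contract X (alt_wedge (Suc 0) k \<theta> g) =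
    (\<lambda>v. \<theta> (\<lambda>_. X) * g v - alt_wedge (Suc 0) (k - 1) \<theta> (iprod k X g) v)"
  using iprod_wedge[OF th g, of X] by (simp add: contract_1_form[OF th] alt_wedge_const_left[OF g])

lemma alt_wedge_1_1_self:
  fixes \<theta> :: "(nat \<Rightarrow> 'v::real_vector) \<Rightarrow> real"
  assumes th: "\<theta> \<in> alt_forms (Suc 0)"
  shows "alt_wedge (Suc 0) (Suc 0) \<theta> \<theta> = (\<lambda>v. 0)"
  using alt_wedge_commute[OF th th] by (simp add: fun_eq_iff)

subsection \<open>Coordinates\<close>

definition coord :: "'d \<Rightarrow> (nat \<Rightarrow> real^'d) \<Rightarrow> real" where
  "coord b v = v 0 $ b"

lemma linear_vec_nth: "linear (\<lambda>x::real^'d. x $ b)"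
  by (rule linearI) simp_all

lemma coord_alt_forms [simp]: "coord b \<in> alt_forms (Suc 0)"
  using covec_alt_forms[OF linear_vec_nth, of b] by (simp add: covec_def[abs_def] coord_def[abs_def])

lemma iprod_axis_sum:
  fixes f :: "(nat \<Rightarrow> real^'d) \<Rightarrow> real"
  assumes "f \<in> alt_forms k"
  shows "(\<lambda>v. \<Sum>b\<in>UNIV. X $ b * iprod k (axis b 1) f v) = iprod k X f"
proof -
  have "X = (\<Sum>b\<in>UNIV. (X $ b) *\<^sub>R axis b 1)"
    by (simp add: vec_eq_iff axis_def if_distrib cong: if_cong)
  then have "iprod k X f = iprod k (\<Sum>b\<in>UNIV. (X $ b) *\<^sub>R axis b 1) f" by simp
  also have "\<dots> = (\<lambda>v. \<Sum>b\<in>UNIV. X $ b * iprod k (axis b 1) f v)"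
    by (simp add: iprod_vector_sum[OF assms] iprod_vector_scale[OF assms])
  finally show ?thesis by simp
qed

text \<open>The analogue of Euler's formula for homogeneous polynomials: the operator, the sum over
  b of dx_b \<and> \<iota>_b, counts the degree. Contracting it with X gives \<iota>_X f plus the
  same operator applied to \<iota>_X f, hence 1 + k in degree k + 1.\<close>

lemma euler_identity:
  fixes f :: "(nat \<Rightarrow> real^'d) \<Rightarrow> real"
  assumes "f \<in> alt_forms k"
  shows "(\<lambda>v. \<Sum>b\<in>UNIV. alt_wedge (Suc 0) (k - 1) (coord b) (iprod k (axis b 1) f) v) = (\<lambda>v. k * f v)"
  using assms
proof (induction k arbitrary: f)
  case (Suc k)
  note f = Suc.prems
  show ?case
  proof (rule iprod_ext[of k])
    fix X
    have cf: "contract Y f \<in> alt_forms k" for Y by (rule contract_alt_forms[OF f])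
    have 1: "contract X (alt_wedge (Suc 0) k (coord b) (contract (axis b 1) f)) =
       (\<lambda>v. X $ b * contract (axis b 1) f v + alt_wedge (Suc 0) (k - 1) (coord b) (iprod k (axis b 1) (contract X f)) v)" for b
      using iprod_swap[OF f, of X "axis b 1"]
      by (simp add: iprod_wedge_1[OF coord_alt_forms cf] coord_def alt_wedge_minus_right)
    have 2: "(\<lambda>v. \<Sum>b\<in>UNIV. X $ b * contract (axis b 1) f v) = contract X f"
      using iprod_axis_sum[OF f, of X] by simp
    have 3: "(\<lambda>v. \<Sum>b\<in>UNIV. alt_wedge (Suc 0) (k - 1) (coord b) (iprod k (axis b 1) (contract X f)) v)
         = (\<lambda>v. k * contract X f v)"
      by (rule Suc.IH[OF cf])
    show "iprod (Suc k) X (\<lambda>v. \<Sum>b\<in>UNIV. alt_wedge (Suc 0) (Suc k - 1) (coord b) (iprod (Suc k) (axis b 1) f) v)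
        = iprod (Suc k) X (\<lambda>v. real (Suc k) * f v)"
      using fun_cong[OF 2] fun_cong[OF 3]
      unfolding iprod_scale
      by (simp add: contract_sum 1 sum.distrib distrib_right fun_eq_iff)
  qed
qed simp

text \<open>The operators dx_b \<and> _ and \<iota>_b anticommute to the identity for each b, so
  reversing their order changes the degree k into d - k, where d is the dimension. Below the top
  degree the factor is nonzero, so \<rho> can be recovered from the products dx_b \<and>
  \<rho>.\<close>

lemma wedge_coord_iprod_sum:
  fixes \<rho> :: "(nat \<Rightarrow> real^'d) \<Rightarrow> real"
  assumes r: "\<rho> \<in> alt_forms k"
  shows "(\<lambda>v. \<Sum>b\<in>UNIV. contract (axis b 1) (alt_wedge (Suc 0) k (coord b) \<rho>) v) =
    (\<lambda>v. (real CARD('d) - real k) * \<rho> v)"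
  using fun_cong[OF euler_identity[OF r]]
  by (simp add: iprod_wedge_1[OF coord_alt_forms r] coord_def axis_def sum_subtractf algebra_simps)

lemma alt_form_eq0_if_wedge_coord:
  fixes \<rho> :: "(nat \<Rightarrow> real^'d) \<Rightarrow> real"
  assumes r: "\<rho> \<in> alt_forms k" and k: "k < CARD('d)"
    and z: "\<And>b. alt_wedge (Suc 0) k (coord b) \<rho> = (\<lambda>v. 0)"
  shows "\<rho> = (\<lambda>v. 0)"
  using fun_cong[OF wedge_coord_iprod_sum[OF r]] k by (simp add: z fun_eq_iff)

lemma alt_form_eq0_on_basis:
  fixes f :: "(nat \<Rightarrow> real^'d) \<Rightarrow> real"
  assumes "f \<in> alt_forms k" and "\<And>I :: nat \<Rightarrow> 'd. f (\<lambda>i. axis (I i) 1) = 0"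
  shows "f = (\<lambda>v. 0)"
  using assms
proof (induction k arbitrary: f)
  case 0
  then show ?case by (auto elim!: alt_forms_0E)
next
  case (Suc k)
  have 1: "contract (axis b 1) f = (\<lambda>v. 0)" for b
  proof (rule Suc.IH[OF contract_alt_forms[OF Suc.prems(1)]])
    fix I :: "nat \<Rightarrow> 'd"
    have "case_nat (axis b 1) (\<lambda>i. axis (I i) 1) = (\<lambda>i. axis (case_nat b I i) (1::real))"
      by (auto simp: fun_eq_iff split: nat.split)
    then show "contract (axis b 1) f (\<lambda>i. axis (I i) 1) = 0"
      using Suc.prems(2)[of "case_nat b I"] by (simp add: contract_def)
  qed
  show ?case
  proof (rule iprod_ext[of k])
    show "iprod (Suc k) X f = iprod (Suc k) X (\<lambda>v. 0)" for X
      using iprod_axis_sum[OF Suc.prems(1), of X, symmetric] 1 by simp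
  qed
qed

lemma alt_form_eq0_above_dim:
  fixes f :: "(nat \<Rightarrow> real^'d) \<Rightarrow> real"
  assumes f: "f \<in> alt_forms k" and k: "CARD('d) < k"
  shows "f = (\<lambda>v. 0)"
proof (rule alt_form_eq0_on_basis[OF f])
  fix I :: "nat \<Rightarrow> 'd"
  have "\<not> inj_on I {..<k}"
  proof
    assume "inj_on I {..<k}"
    then have "card {..<k} \<le> CARD('d)" by (metis card_inj_on_le finite_class.finite_UNIV subset_UNIV)
    then show False using k by simp
  qed
  then obtain i j where "i < k" "j < k" "i \<noteq> j" "I i = I j" by (auto simp: inj_on_def)
  then show "f (\<lambda>i. axis (I i) 1) = 0" by (intro alt_forms_eq0[OF f, of i j]) auto
qed

lemma alt_forms_permute:
  assumes f: "f \<in> alt_forms k" and s: "\<sigma> permutes {..<k}"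
  shows "f (\<lambda>i. v (\<sigma> i)) = of_int (sign \<sigma>) * f v"
  using finite_lessThan s
proof (induction arbitrary: v rule: permutes_rev_induct)
  case id
  then show ?case by simp
next
  case (swap a b p)
  have "f (\<lambda>i. v ((p \<circ> Transposition.transpose a b) i)) = - f (\<lambda>i. v (p i))" if "a \<noteq> b"
    using alt_forms_swap[OF f, of a b "\<lambda>i. v (p i)"] swap that by simp
  then show ?case using swap.IH[of v] sign_compose_transpose[OF swap.hyps(4) finite_lessThan, of a b]
    by (cases "a = b") (simp_all only: if_True if_False simp_thms of_int_minus minus_mult_minus mult_minus_left, simp_all)
qed

text \<open>Forms of top degree are detected by one value, namely at any ordering of the standard
  basis. Proportionality to a volume form thus becomes a quotient of two scalar functions.\<close>

lemma alt_form_top_eq0: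
  fixes f :: "(nat \<Rightarrow> real^'d) \<Rightarrow> real"
  assumes f: "f \<in> alt_forms CARD('d)" and B: "bij_betw B {..<CARD('d)} (UNIV :: 'd set)"
    and z: "f (\<lambda>i. axis (B i) 1) = 0"
  shows "f = (\<lambda>v. 0)"
proof (rule alt_form_eq0_on_basis[OF f])
  fix I :: "nat \<Rightarrow> 'd"
  let ?d = "CARD('d)"
  show "f (\<lambda>i. axis (I i) 1) = 0"
  proof (cases "inj_on I {..<?d}")
    case False
    then obtain i j where "i < ?d" "j < ?d" "i \<noteq> j" "I i = I j" by (auto simp: inj_on_def)
    then show ?thesis by (intro alt_forms_eq0[OF f, of i j]) auto
  next
    case True
    define \<sigma> where "\<sigma> i = (if i < ?d then inv_into {..<?d} B (I i) else i)" for i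
    have img: "I ` {..<?d} = UNIV"
      using True by (intro card_subset_eq) (auto simp: card_image)
    have "bij_betw (inv_into {..<?d} B \<circ> I) {..<?d} {..<?d}"
      using True img by (intro bij_betw_trans[OF _ bij_betw_inv_into[OF B]]) (auto simp: bij_betw_def)
    then have "bij_betw \<sigma> {..<?d} {..<?d}"
      by (rule bij_betw_cong[THEN iffD1, rotated]) (auto simp: \<sigma>_def)
    then have "\<sigma> permutes {..<?d}" by (rule bij_imp_permutes) (simp add: \<sigma>_def)
    from alt_forms_permute[OF f this, of "\<lambda>i. axis (B i) 1"] z
    have "f (\<lambda>i. axis (B (\<sigma> i)) 1) = 0" by simp
    moreover have "f (\<lambda>i. axis (B (\<sigma> i)) 1) = f (\<lambda>i. axis (I i) 1)"
      using B by (intro alt_forms_cong[OF f]) (auto simp: \<sigma>_def f_inv_into_f bij_betw_def)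
    ultimately show ?thesis by simp
  qed
qed

section \<open>Pointwise Lefschetz theory\<close>

text \<open>The Lefschetz operator \<Omega>^j \<and> f on f of degree m, iterated from the left. The
  definition of Rumin forms multiplies by a power on the right; \<open>wedge_alt_power2\<close>
  identifies the two.\<close>

primrec lef :: "nat \<Rightarrow> nat \<Rightarrow> ((nat \<Rightarrow> 'v) \<Rightarrow> real) \<Rightarrow> ((nat \<Rightarrow> 'v) \<Rightarrow> real) \<Rightarrow> (nat \<Rightarrow> 'v) \<Rightarrow> real" where
  "lef 0 m \<Omega> f = f"
| "lef (Suc j) m \<Omega> f = alt_wedge 2 (m + 2 * j) \<Omega> (lef j m \<Omega> f)"

lemma lef_alt_forms:
  fixes f \<Omega> :: "(nat \<Rightarrow> 'v::real_vector) \<Rightarrow> real"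
  assumes "\<Omega> \<in> alt_forms 2" "f \<in> alt_forms m"
  shows "lef j m \<Omega> f \<in> alt_forms (m + 2 * j)"
proof (induction j)
  case (Suc j)
  then show ?case using alt_wedge_alt_forms[OF assms(1), of "lef j m \<Omega> f" "m + 2 * j"] by (simp add: add_ac)
qed (use assms in simp)

lemma lef_zero [simp]: "lef j m \<Omega> (\<lambda>v. 0) = (\<lambda>v. 0)"
  by (induction j) simp_all

lemma lef_scale: "lef j m \<Omega> (\<lambda>v. c * f v) = (\<lambda>v. c * lef j m \<Omega> f v)"
  by (induction j) (simp_all add: alt_wedge_scale_right)

lemma lef_diff: "lef j m \<Omega> (\<lambda>v. f v - g v) = (\<lambda>v. lef j m \<Omega> f v - lef j m \<Omega> g v)"
  by (induction j) (simp_all add: alt_wedge_diff_right)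

lemma lef_sum: "lef j m \<Omega> (\<lambda>v. \<Sum>i\<in>I. f i v) = (\<lambda>v. \<Sum>i\<in>I. lef j m \<Omega> (f i) v)"
  by (induction j) (simp_all add: alt_wedge_sum_right)

lemma lef_add: "lef j m \<Omega> (\<lambda>v. f v + g v) = (\<lambda>v. lef j m \<Omega> f v + lef j m \<Omega> g v)"
  by (induction j) (simp_all add: alt_wedge_add_right)

lemma lef_lef: "lef (i + j) m \<Omega> f = lef i (m + 2 * j) \<Omega> (lef j m \<Omega> f)"
  by (induction i) (simp_all add: algebra_simps)

lemma lef_Suc': "lef (Suc j) m \<Omega> f = lef j (m + 2) \<Omega> (alt_wedge 2 m \<Omega> f)"
  using lef_lef[of j 1 m \<Omega> f] by simp

lemma lef_pullback:
  "lef j m (\<lambda>v. \<Omega> (\<lambda>i. L (v i))) (\<lambda>v. f (\<lambda>i. L (v i))) = (\<lambda>v. lef j m \<Omega> f (\<lambda>i. L (v i)))"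
  by (induction j) (simp_all add: alt_wedge_pullback)

lemma lef_wedge_1:
  fixes f \<Omega> :: "(nat \<Rightarrow> 'v::real_vector) \<Rightarrow> real"
  assumes om: "\<Omega> \<in> alt_forms 2" and f: "f \<in> alt_forms m" and th: "\<theta> \<in> alt_forms (Suc 0)"
  shows "alt_wedge (Suc 0) (m + 2 * j) \<theta> (lef j m \<Omega> f) = lef j (Suc m) \<Omega> (alt_wedge (Suc 0) m \<theta> f)"
proof (induction j)
  case (Suc j)
  show ?case
    using alt_wedge_exchange[OF th om lef_alt_forms[OF om f, of j]] Suc by simp
qed simp

text \<open>The product rule for \<iota>_X on \<Omega>^(j+1) \<and> f. There are no signs because
  \<Omega> is even and commutes with \<iota>_X \<Omega>. For m = 0 the first summand vanishes by
  convention, so its truncated degree does no harm.\<close>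

lemma contract_lef:
  fixes f \<Omega> :: "(nat \<Rightarrow> 'v::real_vector) \<Rightarrow> real"
  assumes om: "\<Omega> \<in> alt_forms 2" and f: "f \<in> alt_forms m"
  shows "contract X (lef (Suc j) m \<Omega> f) = (\<lambda>v. lef (Suc j) (m - 1) \<Omega> (iprod m X f) v +
     Suc j * alt_wedge (Suc 0) (m + 2 * j) (contract X \<Omega>) (lef j m \<Omega> f) v)"
proof (induction j)
  case 0
  show ?case using iprod_wedge[OF om f, of X] by (simp add: numeral_2_eq_2 add.commute)
next
  case (Suc j)
  let ?L = "lef (Suc j) m \<Omega> f"
  have cX: "contract X \<Omega> \<in> alt_forms (Suc 0)"
    using contract_alt_forms[of \<Omega> "Suc 0"] om by (simp add: numeral_2_eq_2)
  have L: "?L \<in> alt_forms (m + 2 * Suc j)" by (rule lef_alt_forms[OF om f])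
  have "contract X (lef (Suc (Suc j)) m \<Omega> f) =
    (\<lambda>v. alt_wedge (Suc 0) (m + 2 * Suc j) (contract X \<Omega>) ?L v
      + alt_wedge 2 (Suc (m + 2 * j)) \<Omega> (contract X ?L) v)"
    using iprod_wedge[OF om L, of X] by (simp add: numeral_2_eq_2)
  also have "alt_wedge 2 (Suc (m + 2 * j)) \<Omega> (contract X ?L) =
    (\<lambda>v. alt_wedge 2 (Suc (m + 2 * j)) \<Omega> (lef (Suc j) (m - 1) \<Omega> (iprod m X f)) v +
      Suc j * alt_wedge 2 (Suc (m + 2 * j)) \<Omega> (alt_wedge (Suc 0) (m + 2 * j) (contract X \<Omega>) (lef j m \<Omega> f)) v)"
    unfolding Suc.IH alt_wedge_add_right alt_wedge_scale_right ..
  also have "alt_wedge 2 (Suc (m + 2 * j)) \<Omega> (lef (Suc j) (m - 1) \<Omega> (iprod m X f)) =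
      lef (Suc (Suc j)) (m - 1) \<Omega> (iprod m X f)"
    by (cases m) simp_all
  also have "alt_wedge 2 (Suc (m + 2 * j)) \<Omega> (alt_wedge (Suc 0) (m + 2 * j) (contract X \<Omega>) (lef j m \<Omega> f)) =
      alt_wedge (Suc 0) (m + 2 * Suc j) (contract X \<Omega>) ?L"
    using alt_wedge_exchange[OF om cX lef_alt_forms[OF om f, of j]] by simp
  finally show ?case by (simp add: fun_eq_iff algebra_simps)
qed

primrec alt_power2 :: "((nat \<Rightarrow> 'v) \<Rightarrow> real) \<Rightarrow> nat \<Rightarrow> (nat \<Rightarrow> 'v) \<Rightarrow> real" where
  "alt_power2 \<Omega> 0 = (\<lambda>v. 1)"
| "alt_power2 \<Omega> (Suc m) = alt_wedge 2 (2 * m) \<Omega> (alt_power2 \<Omega> m)"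

lemma alt_power2_alt_forms:
  fixes \<Omega> :: "(nat \<Rightarrow> 'v::real_vector) \<Rightarrow> real"
  assumes "\<Omega> \<in> alt_forms 2" shows "alt_power2 \<Omega> j \<in> alt_forms (2 * j)"
  using alt_wedge_alt_forms[OF assms] by (induction j) simp_all

lemma wedge_alt_power2:
  fixes f \<Omega> :: "(nat \<Rightarrow> 'v::real_vector) \<Rightarrow> real"
  assumes om: "\<Omega> \<in> alt_forms 2" and f: "f \<in> alt_forms m"
  shows "alt_wedge m (2 * j) f (alt_power2 \<Omega> j) = lef j m \<Omega> f"
proof (induction j)
  case 0
  show ?case by (simp add: alt_wedge_const_right[OF f])
next
  case (Suc j)
  then show ?case using alt_wedge_exchange[OF f om alt_power2_alt_forms[OF om, of j]] by simp
qed

text \<open>The linear algebra of a single tangent space, with \<open>\<Omega>\<close> in the role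
  of d\<theta>. Nondegeneracy is asked on the kernel of \<open>\<theta>\<close> only, as a two-form
  on a space of odd dimension always has a kernel.\<close>

locale contact_point =
  fixes \<theta> \<Omega> :: "(nat \<Rightarrow> real^'d) \<Rightarrow> real" and n :: nat
  assumes th: "\<theta> \<in> alt_forms (Suc 0)" and om: "\<Omega> \<in> alt_forms 2"
    and card: "CARD('d) = 2 * n + 1"
    and nz: "\<exists>R. \<theta> (\<lambda>_. R) \<noteq> 0"
    and nondeg: "\<And>X. \<theta> (\<lambda>_. X) = 0 \<Longrightarrow> (\<And>Y. \<theta> (\<lambda>_. Y) = 0 \<Longrightarrow> contract X \<Omega> (\<lambda>_. Y) = 0) \<Longrightarrow> X = 0"
begin

lemma contract_om: "contract X \<Omega> \<in> alt_forms (Suc 0)"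
  using contract_alt_forms[of \<Omega> "Suc 0"] om by (simp add: numeral_2_eq_2)

lemma om_self: "contract X \<Omega> (\<lambda>_. X) = 0"
  unfolding contract_def
  by (rule alt_forms_eq0[OF om, of 0 1]) auto

lemma linear_th: "linear (\<lambda>X. \<theta> (\<lambda>_. X))"
  using contract_linear[OF th] unfolding contract_1_form[OF th] .

lemma linear_om: "linear (\<lambda>X. contract X \<Omega> v)"
  using contract_linear[of \<Omega> "Suc 0"] om by (simp add: numeral_2_eq_2)

text \<open>The linear map X \<mapsto> \<iota>_X \<Omega> + \<theta>(X) \<theta> is injective, hence
  onto: the value at X of an image that vanishes is \<theta>(X)^2, so X lies in the kernel of
  \<theta>, where \<Omega> is nondegenerate.\<close>

lemma covector_representation:
  assumes ph: "\<phi> \<in> alt_forms (Suc 0)"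
  obtains X where "\<phi> = (\<lambda>v. contract X \<Omega> v + \<theta> (\<lambda>_. X) * \<theta> v)"
proof -
  define B where "B X = (\<chi> b. contract X \<Omega> (\<lambda>_. axis b 1) + \<theta> (\<lambda>_. X) * \<theta> (\<lambda>_. axis b 1))" for X
  have lin: "linear B"
    by (rule linearI) (simp_all add: B_def vec_eq_iff linear_add[OF linear_om] linear_add[OF linear_th]
        linear_scale[OF linear_om] linear_scale[OF linear_th] algebra_simps)
  have key: "f = (\<lambda>v. 0)" if f: "f \<in> alt_forms (Suc 0)" and z: "\<And>b. f (\<lambda>_. axis b 1) = 0" for f :: "(nat \<Rightarrow> real^'d) \<Rightarrow> real"
  proof (rule alt_form_eq0_on_basis[OF f])
    show "f (\<lambda>i. axis (I i) 1) = 0" for I :: "nat \<Rightarrow> 'd"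
      using z[of "I 0"] alt_forms_cong[OF f, of "\<lambda>i. axis (I i) 1" "\<lambda>_. axis (I 0) 1"] by simp
  qed
  have mem: "(\<lambda>v. contract X \<Omega> v + \<theta> (\<lambda>_. X) * \<theta> v) \<in> alt_forms (Suc 0)" for X
    by (intro alt_forms_add alt_forms_scale contract_om th)
  have "inj B"
    unfolding linear_injective_0[OF lin]
  proof (intro allI impI)
    fix X assume "B X = 0"
    then have 0: "(\<lambda>v. contract X \<Omega> v + \<theta> (\<lambda>_. X) * \<theta> v) = (\<lambda>v. 0)"
      by (intro key[OF mem]) (simp add: B_def vec_eq_iff)
    from fun_cong[OF 0, of "\<lambda>_. X"] have t: "\<theta> (\<lambda>_. X) = 0" by (simp add: om_self)
    then show "X = 0" using fun_cong[OF 0] by (intro nondeg) auto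
  qed
  then have "surj B" using linear_injective_imp_surjective[OF lin] by blast
  then obtain X where X: "B X = (\<chi> b. \<phi> (\<lambda>_. axis b 1))" by (metis surjD)
  have "(\<lambda>v. \<phi> v - (contract X \<Omega> v + \<theta> (\<lambda>_. X) * \<theta> v)) = (\<lambda>v. 0)"
    using X by (intro key alt_forms_diff ph mem) (simp add: B_def vec_eq_iff)
  then have "\<phi> = (\<lambda>v. contract X \<Omega> v + \<theta> (\<lambda>_. X) * \<theta> v)" by (simp add: fun_eq_iff)
  then show ?thesis using that by blast
qed

text \<open>The Reeb vector is the one that represents \<theta> itself. Evaluating the
  representation at R gives \<theta>(R) = \<theta>(R)^2, and \<theta>(R) = 0 would force R = 0 and
  then \<theta> = 0.\<close>

lemma reeb:
  obtains R where "\<theta> (\<lambda>_. R) = 1" "contract R \<Omega> = (\<lambda>v. 0)"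
proof -
  obtain R where R: "\<theta> = (\<lambda>v. contract R \<Omega> v + \<theta> (\<lambda>_. R) * \<theta> v)"
    by (rule covector_representation[OF th])
  have "\<theta> (\<lambda>_. R) = \<theta> (\<lambda>_. R) * \<theta> (\<lambda>_. R)"
    using fun_cong[OF R, of "\<lambda>_. R"] by (simp add: om_self)
  moreover have "\<theta> (\<lambda>_. R) \<noteq> 0"
  proof
    assume t: "\<theta> (\<lambda>_. R) = 0"
    then have 1: "contract R \<Omega> = \<theta>" using R by simp
    have "R = 0" using t by (intro nondeg) (simp_all add: 1)
    then have "\<theta> = (\<lambda>v. 0)" using 1 linear_0[OF linear_om] by auto
    then show False using nz by simp
  qed
  ultimately have 1: "\<theta> (\<lambda>_. R) = 1" by simp
  moreover have "contract R \<Omega> = (\<lambda>v. 0)"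
    using fun_cong[OF R] unfolding 1 by (simp add: fun_eq_iff)
  ultimately show ?thesis using that by blast
qed

text \<open>If \<open>\<theta> \<and> \<Omega>\<^sup>j\<^sup>+\<^sup>1 = 0\<close>, then contraction shows that the form \<open>\<theta> \<and> \<Omega>\<^sup>j\<close>, whose degree is below the
  dimension, is annihilated by all covectors, so it vanishes too.\<close>

lemma volume_nonzero:
  assumes "j \<le> n"
  shows "lef j (Suc 0) \<Omega> \<theta> \<noteq> (\<lambda>v. 0)"
  using assms
proof (induction j)
  case 0
  then show ?case using nz by auto
next
  case (Suc j)
  let ?r = "lef j (Suc 0) \<Omega> \<theta>"
  have r: "?r \<in> alt_forms (Suc 0 + 2 * j)" by (rule lef_alt_forms[OF om th])
  obtain R where R: "\<theta> (\<lambda>_. R) = 1" "contract R \<Omega> = (\<lambda>v. 0)" by (rule reeb)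
  show ?case
  proof
    assume z: "lef (Suc j) (Suc 0) \<Omega> \<theta> = (\<lambda>v. 0)"
    have 1: "alt_wedge (Suc 0) (Suc 0 + 2 * j) (contract X \<Omega>) ?r = (\<lambda>v. 0)" if X: "\<theta> (\<lambda>_. X) = 0" for X
      using contract_lef[OF om th, of X j] unfolding z
      by (simp add: contract_1_form[OF th] X fun_eq_iff del: lef.simps)
    have 2: "alt_wedge (Suc 0) (Suc 0 + 2 * j) (contract X \<Omega>) ?r = (\<lambda>v. 0)" for X
    proof -
      \<comment> \<open>The projection along the Reeb vector lies in the kernel of
        \<open>\<theta>\<close> and has the same contraction with \<open>\<Omega>\<close> as
        X.\<close>
      let ?Y = "X - \<theta> (\<lambda>_. X) *\<^sub>R R"
      have "\<theta> (\<lambda>_. ?Y) = 0" by (simp add: linear_diff[OF linear_th] linear_scale[OF linear_th] R)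
      moreover have "contract ?Y \<Omega> = contract X \<Omega>"
        by (simp add: fun_eq_iff linear_diff[OF linear_om] linear_scale[OF linear_om] R)
      ultimately show ?thesis using 1[of ?Y] by simp
    qed
    have 3: "alt_wedge (Suc 0) (Suc 0 + 2 * j) \<theta> ?r = (\<lambda>v. 0)"
      unfolding lef_wedge_1[OF om th th] by (simp add: alt_wedge_1_1_self[OF th])
    have "?r = (\<lambda>v. 0)"
    proof (rule alt_form_eq0_if_wedge_coord[OF r])
      show "Suc 0 + 2 * j < CARD('d)" using Suc.prems card by simp
      fix b
      obtain X where X: "coord b = (\<lambda>v. contract X \<Omega> v + \<theta> (\<lambda>_. X) * \<theta> v)"
        by (rule covector_representation[OF coord_alt_forms])
      show "alt_wedge (Suc 0) (Suc 0 + 2 * j) (coord b) ?r = (\<lambda>v. 0)"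
        unfolding X alt_wedge_add_left alt_wedge_scale_left 2 3 by simp
    qed
    then show False using Suc.IH Suc.prems by simp
  qed
qed

lemma eq0_if_contractions:
  assumes f: "f \<in> alt_forms (Suc k)"
    and 0: "\<And>X. \<theta> (\<lambda>_. X) = 0 \<Longrightarrow> contract X f = (\<lambda>v. 0)"
    and R: "\<theta> (\<lambda>_. R) = 1" "contract R f = (\<lambda>v. 0)"
  shows "f = (\<lambda>v. 0)"
proof (rule contract_ext)
  fix X
  let ?Y = "X - \<theta> (\<lambda>_. X) *\<^sub>R R"
  have "\<theta> (\<lambda>_. ?Y) = 0" by (simp add: linear_diff[OF linear_th] linear_scale[OF linear_th] R)
  from 0[OF this] show "contract X f = contract X (\<lambda>v. 0)"
    by (simp add: fun_eq_iff linear_diff[OF contract_linear[OF f]] linear_scale[OF contract_linear[OF f]] R)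
qed

text \<open>If \<open>\<Omega>\<^sup>j \<and> \<mu> = 0\<close>, then contracting \<open>\<Omega>\<^sup>j\<^sup>+\<^sup>1 \<and> \<mu> = 0\<close> with \<open>X\<close> in the kernel of \<open>\<theta>\<close> gives
  \<open>\<Omega>\<^sup>j\<^sup>+\<^sup>1 \<and> \<iota>\<^sub>X \<mu> = 0\<close>, where \<open>\<iota>\<^sub>X \<mu>\<close> has smaller degree.\<close>

lemma lef_injective:
  assumes "m + j = n + 1" "\<mu> \<in> alt_forms m" "alt_wedge (Suc 0) m \<theta> \<mu> = (\<lambda>v. 0)"
    and "lef j m \<Omega> \<mu> = (\<lambda>v. 0)"
  shows "\<mu> = (\<lambda>v. 0)"
  using assms
proof (induction m arbitrary: j \<mu>)
  case 0
  then obtain c where c: "\<mu> = (\<lambda>v. c)" by (auto elim: alt_forms_0E)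
  obtain R where R: "\<theta> (\<lambda>_. R) = 1" by (rule reeb)
  show ?case using iprod_wedge_1[OF th 0(2), of R] unfolding 0(3) by (simp add: c R fun_eq_iff)
next
  case (Suc m)
  note mu = Suc.prems(2)
  obtain R where R: "\<theta> (\<lambda>_. R) = 1" "contract R \<Omega> = (\<lambda>v. 0)" by (rule reeb)
  have c: "contract X \<mu> \<in> alt_forms m" for X by (rule contract_alt_forms[OF mu])
  \<comment> \<open>Contract \<theta> \<and> \<mu> = 0 with X. For X in the kernel this says that
    \<iota>_X \<mu> is again killed by \<theta>; for the Reeb vector it gives \<mu> = \<theta>
    \<and> \<iota>_R \<mu>.\<close>
  have th_con: "\<theta> (\<lambda>_. X) * \<mu> v = alt_wedge (Suc 0) m \<theta> (contract X \<mu>) v" for X v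
    using fun_cong[OF iprod_wedge_1[OF th mu, of X], of v] Suc.prems(3) by simp
  have z: "contract X \<mu> = (\<lambda>v. 0)" if X: "\<theta> (\<lambda>_. X) = 0" for X
  proof (rule Suc.IH[of "Suc j"])
    show "m + Suc j = n + 1" using Suc.prems(1) by simp
    show "contract X \<mu> \<in> alt_forms m" by (rule c)
    show "alt_wedge (Suc 0) m \<theta> (contract X \<mu>) = (\<lambda>v. 0)"
      using th_con[of X] X by (simp add: fun_eq_iff)
    have "lef (Suc j) (Suc m) \<Omega> \<mu> = (\<lambda>v. 0)" using Suc.prems(4) by simp
    note 0 = contract_lef[OF om mu, of X j, unfolded this Suc.prems(4)]
    show "lef (Suc j) m \<Omega> (contract X \<mu>) = (\<lambda>v. 0)"
      using 0 by (simp add: fun_eq_iff del: lef.simps)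
  qed
  show ?case
  \<comment> \<open>What remains is \<iota>_R \<mu>. If it has positive degree, its contractions
    with R and with the kernel of \<theta> vanish. If it is a scalar a, then \<mu> = a \<theta> and
    the nonvanishing of \<theta> \<and> \<Omega>^n forces a = 0.\<close>
  proof (cases m)
    case 0
    obtain a where a: "contract R \<mu> = (\<lambda>v. a)" using c[of R] 0 by (auto elim: alt_forms_0E)
    have m: "\<mu> = (\<lambda>v. a * \<theta> v)"
      using th_con[of R] R(1) 0 alt_wedge_const_right[OF th, of a] by (simp add: fun_eq_iff a)
    have "j = n" using Suc.prems(1) 0 by simp
    then have "(\<lambda>v. a * lef n (Suc 0) \<Omega> \<theta> v) = (\<lambda>v. 0)"
      using Suc.prems(4) 0 by (simp add: m lef_scale)
    then have "a = 0" using volume_nonzero[of n] by (auto simp: fun_eq_iff)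
    then show ?thesis by (simp add: m)
  next
    case (Suc m')
    have cR: "contract R \<mu> = (\<lambda>v. 0)"
    proof (rule eq0_if_contractions[OF _ _ R(1)])
      show "contract R \<mu> \<in> alt_forms (Suc m')" using c Suc by simp
      have mu': "\<mu> \<in> alt_forms (Suc (Suc m'))" using mu Suc by simp
      show "contract R (contract R \<mu>) = (\<lambda>v. 0)" by (rule contract_contract[OF mu'])
      show "contract X (contract R \<mu>) = (\<lambda>v. 0)" if "\<theta> (\<lambda>_. X) = 0" for X
        using iprod_swap[OF mu', of X R] z[OF that] by simp
    qed
    show ?thesis using th_con[of R] R(1) by (simp add: cR fun_eq_iff)
  qed
qed

end

section \<open>Smooth functions\<close>

lemma fderiv_eqI: "(f has_derivative f') (at x) \<Longrightarrow> frechet_derivative f (at x) = f'"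
  using frechet_derivative_at by metis

lemma fderiv_cong_open:
  assumes "open S" "x \<in> S" "\<And>y. y \<in> S \<Longrightarrow> f y = g y" "f differentiable (at x)"
  shows "frechet_derivative f (at x) = frechet_derivative g (at x)"
  using assms by (intro frechet_derivative_transform_within_open[of f x S g]) auto

lemma differentiable_cong_open:
  assumes "open S" "x \<in> S" "\<And>y. y \<in> S \<Longrightarrow> f y = g y" "f differentiable (at x)"
  shows "g differentiable (at x)"
  using assms has_derivative_transform_within_open unfolding differentiable_def by metis

lemma Ck_on_cong:
  assumes "open S" "\<And>x. x \<in> S \<Longrightarrow> f x = g x" "Ck_on k S f"
  shows "Ck_on k S g"
  using assms(2,3)
proof (induction k arbitrary: f g)
  case 0
  then show ?case using continuous_on_cong[of S S f g] by simp
next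
  case (Suc k)
  then have d: "\<And>x. x \<in> S \<Longrightarrow> f differentiable (at x)" by simp
  show ?case unfolding Ck_on.simps
  proof (intro conjI ballI allI)
    show "g differentiable at x" if "x \<in> S" for x
      using differentiable_cong_open[OF assms(1) that Suc.prems(1) d[OF that]] .
    show "Ck_on k S (\<lambda>x. frechet_derivative g (at x) v)" for v
    proof (rule Suc.IH)
      show "frechet_derivative f (at x) v = frechet_derivative g (at x) v" if "x \<in> S" for x
        using fderiv_cong_open[OF assms(1) that Suc.prems(1) d[OF that]] by simp
    qed (use Suc.prems in simp)
  qed
qed

lemma Ck_on_SucD: "Ck_on (Suc k) S f \<Longrightarrow> Ck_on k S f"
proof (induction k arbitrary: f)
  case 0
  then show ?case
    by (auto intro!: continuous_at_imp_continuous_on differentiable_imp_continuous_within)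
next
  case (Suc k)
  have "Ck_on k S (\<lambda>x. frechet_derivative f (at x) v)" for v
    using Suc.prems by (intro Suc.IH) (simp only: Ck_on.simps(2)[of "Suc k"])
  then show ?case using Suc.prems by auto
qed

lemma Ck_on_subset: "Ck_on k S f \<Longrightarrow> T \<subseteq> S \<Longrightarrow> Ck_on k T f"
  by (induction k arbitrary: f) (auto intro: continuous_on_subset)

lemma Ck_on_const [simp]: "Ck_on k S (\<lambda>x. c)"
  by (induction k arbitrary: c) simp_all

lemma Ck_on_add:
  assumes S: "open S"
  shows "Ck_on k S f \<Longrightarrow> Ck_on k S g \<Longrightarrow> Ck_on k S (\<lambda>x. f x + g x)"
proof (induction k arbitrary: f g)
  case (Suc k)
  show ?case unfolding Ck_on.simps
  proof (intro conjI ballI allI)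
    show "(\<lambda>x. f x + g x) differentiable at x" if "x \<in> S" for x
      using Suc.prems that by auto
    show "Ck_on k S (\<lambda>x. frechet_derivative (\<lambda>x. f x + g x) (at x) v)" for v
    proof (rule Ck_on_cong[OF S])
      show "Ck_on k S (\<lambda>x. frechet_derivative f (at x) v + frechet_derivative g (at x) v)"
        using Suc by simp
      show "frechet_derivative f (at x) v + frechet_derivative g (at x) v =
         frechet_derivative (\<lambda>x. f x + g x) (at x) v" if "x \<in> S" for x
        using Suc.prems that
        by (subst fderiv_eqI[OF has_derivative_add]) (auto simp flip: frechet_derivative_works)
    qed
  qed
qed (auto intro: continuous_intros)

lemma Ck_on_scaleR:
  fixes g :: "_ \<Rightarrow> real"
  assumes S: "open S"
  shows "Ck_on k S g \<Longrightarrow> Ck_on k S f \<Longrightarrow> Ck_on k S (\<lambda>x. g x *\<^sub>R f x)"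
proof (induction k arbitrary: f g)
  case (Suc k)
  have d: "g differentiable at x" "f differentiable at x" if "x \<in> S" for x
    using Suc.prems that by auto
  show ?case unfolding Ck_on.simps
  proof (intro conjI ballI allI)
    show "(\<lambda>x. g x *\<^sub>R f x) differentiable at x" if "x \<in> S" for x
      using d[OF that] by auto
    show "Ck_on k S (\<lambda>x. frechet_derivative (\<lambda>x. g x *\<^sub>R f x) (at x) v)" for v
    proof (rule Ck_on_cong[OF S])
      show "Ck_on k S (\<lambda>x. g x *\<^sub>R frechet_derivative f (at x) v + frechet_derivative g (at x) v *\<^sub>R f x)"
        using Suc.prems by (intro Ck_on_add[OF S] Suc.IH) (auto dest: Ck_on_SucD simp del: Ck_on.simps, auto)
      show "g x *\<^sub>R frechet_derivative f (at x) v + frechet_derivative g (at x) v *\<^sub>R f x =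
         frechet_derivative (\<lambda>x. g x *\<^sub>R f x) (at x) v" if "x \<in> S" for x
        using d[OF that]
        by (subst fderiv_eqI[OF has_derivative_scaleR]) (auto simp flip: frechet_derivative_works)
    qed
  qed
qed (auto intro: continuous_intros)

lemma Ck_on_bounded_linear:
  assumes S: "open S" and L: "bounded_linear L"
  shows "Ck_on k S f \<Longrightarrow> Ck_on k S (\<lambda>x. L (f x))"
proof (induction k arbitrary: f)
  case 0
  then show ?case using bounded_linear.continuous_on[OF L] by auto
next
  case (Suc k)
  have D: "((\<lambda>x. L (f x)) has_derivative (\<lambda>h. L (frechet_derivative f (at x) h))) (at x)" if "x \<in> S" for x
    using Suc.prems that by (intro bounded_linear.has_derivative[OF L]) (simp flip: frechet_derivative_works)
  show ?case unfolding Ck_on.simps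
  proof (intro conjI ballI allI)
    show "(\<lambda>x. L (f x)) differentiable at x" if "x \<in> S" for x
      using D[OF that] unfolding differentiable_def by blast
    show "Ck_on k S (\<lambda>x. frechet_derivative (\<lambda>x. L (f x)) (at x) v)" for v
      by (rule Ck_on_cong[OF S, of "\<lambda>x. L (frechet_derivative f (at x) v)"])
        (use Suc in \<open>auto simp: fderiv_eqI[OF D]\<close>)
  qed
qed

lemma smooth_on_cong:
  assumes "open S" "\<And>x. x \<in> S \<Longrightarrow> f x = g x" "smooth_on S f"
  shows "smooth_on S g"
  using assms Ck_on_cong unfolding smooth_on_def by metis

lemma smooth_on_subset: "smooth_on S f \<Longrightarrow> T \<subseteq> S \<Longrightarrow> smooth_on T f"
  unfolding smooth_on_def by (blast intro: Ck_on_subset)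

lemma smooth_on_differentiable: "smooth_on S f \<Longrightarrow> x \<in> S \<Longrightarrow> f differentiable (at x)"
  unfolding smooth_on_def by (metis Ck_on.simps(2))

lemma smooth_on_has_derivative:
  "smooth_on S f \<Longrightarrow> x \<in> S \<Longrightarrow> (f has_derivative frechet_derivative f (at x)) (at x)"
  using smooth_on_differentiable frechet_derivative_works by blast

lemma smooth_on_fderiv: "smooth_on S f \<Longrightarrow> smooth_on S (\<lambda>x. frechet_derivative f (at x) v)"
  unfolding smooth_on_def by (metis Ck_on.simps(2))

lemma smooth_on_continuous: "smooth_on S f \<Longrightarrow> continuous_on S f"
  unfolding smooth_on_def by (metis Ck_on.simps(1))

lemma smooth_on_const [simp]: "smooth_on S (\<lambda>x. c)"
  by (simp add: smooth_on_def)

lemma smooth_on_add: "open S \<Longrightarrow> smooth_on S f \<Longrightarrow> smooth_on S g \<Longrightarrow> smooth_on S (\<lambda>x. f x + g x)"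
  by (simp add: smooth_on_def Ck_on_add)

lemma smooth_on_scaleR:
  "open S \<Longrightarrow> smooth_on S g \<Longrightarrow> smooth_on S f \<Longrightarrow> smooth_on S (\<lambda>x. g x *\<^sub>R f x)"
  by (simp add: smooth_on_def Ck_on_scaleR)

lemma smooth_on_mult:
  fixes f g :: "_ \<Rightarrow> real"
  shows "open S \<Longrightarrow> smooth_on S f \<Longrightarrow> smooth_on S g \<Longrightarrow> smooth_on S (\<lambda>x. f x * g x)"
  using smooth_on_scaleR[of S f g] by simp

lemma smooth_on_bounded_linear:
  "open S \<Longrightarrow> bounded_linear L \<Longrightarrow> smooth_on S f \<Longrightarrow> smooth_on S (\<lambda>x. L (f x))"
  by (simp add: smooth_on_def Ck_on_bounded_linear)

lemma smooth_on_minus: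
  "open S \<Longrightarrow> smooth_on S f \<Longrightarrow> smooth_on S (\<lambda>x. - f x)"
  by (rule smooth_on_bounded_linear[OF _ bounded_linear_minus[OF bounded_linear_ident]])

lemma smooth_on_diff: "open S \<Longrightarrow> smooth_on S f \<Longrightarrow> smooth_on S g \<Longrightarrow> smooth_on S (\<lambda>x. f x - g x)"
  using smooth_on_add[of S f "\<lambda>x. - g x"] smooth_on_minus[of S g] by simp

lemma smooth_on_sum:
  "open S \<Longrightarrow> (\<And>i. i \<in> I \<Longrightarrow> smooth_on S (f i)) \<Longrightarrow> smooth_on S (\<lambda>x. \<Sum>i\<in>I. f i x)"
  by (induction I rule: infinite_finite_induct) (auto intro: smooth_on_add)

lemma smooth_on_prod:
  fixes f :: "_ \<Rightarrow> _ \<Rightarrow> real"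
  shows "open S \<Longrightarrow> (\<And>i. i \<in> I \<Longrightarrow> smooth_on S (f i)) \<Longrightarrow> smooth_on S (\<lambda>x. \<Prod>i\<in>I. f i x)"
  by (induction I rule: infinite_finite_induct) (auto intro: smooth_on_mult)

lemma smooth_on_power:
  fixes f :: "_ \<Rightarrow> real"
  shows "open S \<Longrightarrow> smooth_on S f \<Longrightarrow> smooth_on S (\<lambda>x. f x ^ m)"
  by (induction m) (auto intro: smooth_on_mult)

text \<open>The derivative of 1/f is a product involving 1/f itself, so the order of
  differentiability is raised one step at a time, each step using the previous one for 1/f and full
  smoothness for f.\<close>

lemma smooth_on_inverse:
  fixes f :: "_ \<Rightarrow> real"
  assumes S: "open S" and f: "smooth_on S f" and nz: "\<And>x. x \<in> S \<Longrightarrow> f x \<noteq> 0"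
  shows "smooth_on S (\<lambda>x. inverse (f x))"
  unfolding smooth_on_def
proof
  have D: "((\<lambda>x. inverse (f x)) has_derivative (\<lambda>h. - (inverse (f x) * frechet_derivative f (at x) h * inverse (f x)))) (at x)"
    if "x \<in> S" for x
    using Deriv.has_derivative_inverse[OF nz[OF that] smooth_on_has_derivative[OF f that]] .
  show "Ck_on k S (\<lambda>x. inverse (f x))" for k
  proof (induction k)
    case 0
    show ?case using smooth_on_continuous[OF f] nz by (auto intro!: continuous_intros)
  next
    case (Suc k)
    have "Ck_on k S (\<lambda>x. frechet_derivative f (at x) v)" for v
      using smooth_on_fderiv[OF f] by (simp add: smooth_on_def)
    then have 1: "Ck_on k S (\<lambda>x. - 1 *\<^sub>R (inverse (f x) *\<^sub>R (frechet_derivative f (at x) v *\<^sub>R inverse (f x))))" for v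
      by (intro Ck_on_scaleR[OF S] Suc Ck_on_const)
    show ?case unfolding Ck_on.simps
    proof (intro conjI ballI allI)
      show "(\<lambda>x. inverse (f x)) differentiable at x" if "x \<in> S" for x
        using D[OF that] unfolding differentiable_def by blast
      show "Ck_on k S (\<lambda>x. frechet_derivative (\<lambda>x. inverse (f x)) (at x) v)" for v
        by (rule Ck_on_cong[OF S _ 1[of v]]) (simp add: fderiv_eqI[OF D])
    qed
  qed
qed

lemma smooth_on_divide:
  fixes f g :: "_ \<Rightarrow> real"
  assumes "open S" "smooth_on S f" "smooth_on S g" "\<And>x. x \<in> S \<Longrightarrow> g x \<noteq> 0"
  shows "smooth_on S (\<lambda>x. f x / g x)"
  unfolding divide_inverse using assms by (intro smooth_on_mult smooth_on_inverse)

text \<open>By the chain rule a directional derivative of f \<circ> g is a sum of coefficients from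
  the derivative of g times (partial derivative of f) \<circ> g. The induction is over all f with g
  fixed, so that it applies to the partial derivatives.\<close>

lemma smooth_on_compose:
  fixes f :: "'b::euclidean_space \<Rightarrow> 'c::real_normed_vector"
  assumes S: "open S" and g: "smooth_on S g" and f: "smooth_on T f" and ST: "g ` S \<subseteq> T"
  shows "smooth_on S (\<lambda>x. f (g x))"
  unfolding smooth_on_def
proof
  show "Ck_on k S (\<lambda>x. f (g x))" for k
    using f
  proof (induction k arbitrary: f)
    case 0
    show ?case
      using continuous_on_compose2[OF smooth_on_continuous[OF 0] smooth_on_continuous[OF g] ST] by simp
  next
    case (Suc k)
    have D: "((\<lambda>x. f (g x)) has_derivative (\<lambda>h. frechet_derivative f (at (g x)) (frechet_derivative g (at x) h))) (at x)"
      if "x \<in> S" for x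
      using that ST by (intro has_derivative_compose[OF smooth_on_has_derivative[OF g] smooth_on_has_derivative[OF Suc.prems]]) auto
    show ?case unfolding Ck_on.simps
    proof (intro conjI ballI allI)
      show "(\<lambda>x. f (g x)) differentiable at x" if "x \<in> S" for x
        using D[OF that] unfolding differentiable_def by blast
      fix v
      show "Ck_on k S (\<lambda>x. frechet_derivative (\<lambda>x. f (g x)) (at x) v)"
      proof (rule Ck_on_cong[OF S])
        have "Ck_on k S (\<lambda>x. (frechet_derivative g (at x) v \<bullet> b) *\<^sub>R frechet_derivative f (at (g x)) b)" for b
        proof (rule Ck_on_scaleR[OF S])
          show "Ck_on k S (\<lambda>x. frechet_derivative f (at (g x)) b)"
            by (rule Suc.IH[OF smooth_on_fderiv[OF Suc.prems]])
          show "Ck_on k S (\<lambda>x. frechet_derivative g (at x) v \<bullet> b)"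
            using smooth_on_fderiv[OF g, of v] unfolding smooth_on_def
            by (intro Ck_on_bounded_linear[OF S bounded_linear_inner_left]) auto
        qed
        then show "Ck_on k S (\<lambda>x. \<Sum>b\<in>Basis. (frechet_derivative g (at x) v \<bullet> b) *\<^sub>R frechet_derivative f (at (g x)) b)"
          by (induction rule: finite_induct[OF finite_Basis]) (auto intro: Ck_on_add[OF S])
        fix x assume x: "x \<in> S"
        have "linear (frechet_derivative f (at (g x)))"
          using smooth_on_differentiable[OF Suc.prems] x ST by (intro linear_frechet_derivative) auto
        then have "(\<Sum>b\<in>Basis. (frechet_derivative g (at x) v \<bullet> b) *\<^sub>R frechet_derivative f (at (g x)) b)
            = frechet_derivative f (at (g x)) (\<Sum>b\<in>Basis. (frechet_derivative g (at x) v \<bullet> b) *\<^sub>R b)"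
          by (simp add: linear_sum linear_scale)
        then show "(\<Sum>b\<in>Basis. (frechet_derivative g (at x) v \<bullet> b) *\<^sub>R frechet_derivative f (at (g x)) b) =
            frechet_derivative (\<lambda>x. f (g x)) (at x) v"
          by (simp add: euclidean_representation fderiv_eqI[OF D[OF x]])
      qed
    qed
  qed
qed

lemma smooth_on_vec_nth:
  fixes f :: "_ \<Rightarrow> real^'d"
  shows "open S \<Longrightarrow> smooth_on S f \<Longrightarrow> smooth_on S (\<lambda>x. f x $ b)"
  by (rule smooth_on_bounded_linear[OF _ bounded_linear_vec_nth])

subsection \<open>Symmetry of second derivatives\<close>

text \<open>The mean value theorem is applied in direction u to the difference of f over two
  parallel sides of a parallelogram, and then in direction v to the derivative of f along u.\<close>

lemma second_difference_mean_value:
  fixes f :: "'a::real_normed_vector \<Rightarrow> real"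
  assumes f: "\<And>y. y \<in> ball x r \<Longrightarrow> f differentiable (at y)"
    and fu: "\<And>y. y \<in> ball x r \<Longrightarrow> (\<lambda>z. frechet_derivative f (at z) u) differentiable (at y)"
    and h: "0 < h" "h * (norm u + norm v) < r"
  shows "\<exists>y\<in>ball x r. f (x + h *\<^sub>R u + h *\<^sub>R v) - f (x + h *\<^sub>R u) - f (x + h *\<^sub>R v) + f x =
    h * h * frechet_derivative (\<lambda>z. frechet_derivative f (at z) u) (at y) v"
proof -
  have inb: "x + s *\<^sub>R u + t *\<^sub>R v \<in> ball x r" if "0 \<le> s" "s \<le> h" "0 \<le> t" "t \<le> h" for s t
  proof -
    have "norm (s *\<^sub>R u + t *\<^sub>R v) \<le> s * norm u + t * norm v"
      using norm_triangle_ineq[of "s *\<^sub>R u" "t *\<^sub>R v"] that by simp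
    also have "\<dots> \<le> h * norm u + h * norm v"
      using that by (intro add_mono mult_right_mono) auto
    also have "\<dots> < r" using h by (simp add: algebra_simps)
    finally have "norm (s *\<^sub>R u + t *\<^sub>R v) < r" .
    moreover have "dist x (x + s *\<^sub>R u + t *\<^sub>R v) = norm (s *\<^sub>R u + t *\<^sub>R v)"
      by (metis add.assoc add_diff_cancel_left' dist_commute dist_norm)
    ultimately show ?thesis by simp
  qed
  have chain: "((\<lambda>s. g (p + s *\<^sub>R w)) has_real_derivative frechet_derivative g (at (p + s *\<^sub>R w)) w) (at s)"
    if "g differentiable (at (p + s *\<^sub>R w))" for g :: "'a \<Rightarrow> real" and p w s
  proof -
    have "((\<lambda>s. p + s *\<^sub>R w) has_derivative (\<lambda>k. k *\<^sub>R w)) (at s)"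
      by (auto intro!: derivative_eq_intros)
    from has_derivative_compose[OF this] that
    have "((\<lambda>s. g (p + s *\<^sub>R w)) has_derivative (\<lambda>k. frechet_derivative g (at (p + s *\<^sub>R w)) (k *\<^sub>R w))) (at s)"
      by (simp add: frechet_derivative_works)
    moreover have "(\<lambda>k. frechet_derivative g (at (p + s *\<^sub>R w)) (k *\<^sub>R w)) = (*) (frechet_derivative g (at (p + s *\<^sub>R w)) w)"
      using linear_frechet_derivative[OF that] by (auto simp: linear_scale mult.commute)
    ultimately show ?thesis by (simp add: has_field_derivative_def)
  qed
  define g where "g s = f (x + h *\<^sub>R v + s *\<^sub>R u) - f (x + s *\<^sub>R u)" for s
  have "\<exists>s. 0 < s \<and> s < h \<and> g h - g 0 = (h - 0) *
    (frechet_derivative f (at (x + h *\<^sub>R v + s *\<^sub>R u)) u - frechet_derivative f (at (x + s *\<^sub>R u)) u)"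
  proof (rule MVT2[OF h(1)])
    fix s assume s: "0 \<le> s" "s \<le> h"
    have "x + h *\<^sub>R v + s *\<^sub>R u \<in> ball x r" "x + s *\<^sub>R u \<in> ball x r"
      using inb[of s h] inb[of s 0] s h by (simp_all add: add_ac)
    then show "(g has_real_derivative frechet_derivative f (at (x + h *\<^sub>R v + s *\<^sub>R u)) u -
        frechet_derivative f (at (x + s *\<^sub>R u)) u) (at s)"
      unfolding g_def by (intro DERIV_diff chain f)
  qed
  then obtain s where s: "0 < s" "s < h" and gs: "g h - g 0 = h *
    (frechet_derivative f (at (x + h *\<^sub>R v + s *\<^sub>R u)) u - frechet_derivative f (at (x + s *\<^sub>R u)) u)" by auto
  have "\<exists>t. 0 < t \<and> t < h \<and> frechet_derivative f (at (x + s *\<^sub>R u + h *\<^sub>R v)) u - frechet_derivative f (at (x + s *\<^sub>R u + 0 *\<^sub>R v)) u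
     = (h - 0) * frechet_derivative (\<lambda>z. frechet_derivative f (at z) u) (at (x + s *\<^sub>R u + t *\<^sub>R v)) v"
    using s by (intro MVT2[OF h(1)] chain fu inb) auto
  then obtain t where t: "0 < t" "t < h" and
    gt: "frechet_derivative f (at (x + s *\<^sub>R u + h *\<^sub>R v)) u - frechet_derivative f (at (x + s *\<^sub>R u)) u
     = h * frechet_derivative (\<lambda>z. frechet_derivative f (at z) u) (at (x + s *\<^sub>R u + t *\<^sub>R v)) v" by auto
  have "f (x + h *\<^sub>R u + h *\<^sub>R v) - f (x + h *\<^sub>R u) - f (x + h *\<^sub>R v) + f x = g h - g 0"
    by (simp add: g_def add_ac)
  also have "\<dots> = h * h * frechet_derivative (\<lambda>z. frechet_derivative f (at z) u) (at (x + s *\<^sub>R u + t *\<^sub>R v)) v"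
    unfolding gs using gt by (simp add: add_ac)
  finally show ?thesis using inb[of s t] s t by (intro bexI[of _ "x + s *\<^sub>R u + t *\<^sub>R v"]) auto
qed

text \<open>The second difference is symmetric in u and v, so both mixed derivatives take equal
  values at points arbitrarily close to x; continuity gives equality at x.\<close>

lemma second_derivative_symmetric:
  fixes f :: "'a::euclidean_space \<Rightarrow> real"
  assumes S: "open S" and x: "x \<in> S" and f: "smooth_on S f"
  shows "frechet_derivative (\<lambda>y. frechet_derivative f (at y) u) (at x) v =
    frechet_derivative (\<lambda>y. frechet_derivative f (at y) v) (at x) u"
proof (rule ccontr)
  define A where "A u v y = frechet_derivative (\<lambda>y. frechet_derivative f (at y) u) (at y) v" for u v y
  have "continuous_on S (A u v)" for u v
    unfolding A_def by (intro smooth_on_continuous smooth_on_fderiv f)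
  then have c: "continuous (at x) (A u v)" for u v
    using S x by (simp add: continuous_on_eq_continuous_at)
  assume "\<not> ?thesis"
  then have ne: "A u v x \<noteq> A v u x" by (simp add: A_def)
  define e where "e = \<bar>A u v x - A v u x\<bar> / 2"
  have e: "e > 0" using ne by (simp add: e_def)
  obtain r1 where r1: "r1 > 0" "\<And>y. dist y x < r1 \<Longrightarrow> dist (A u v y) (A u v x) < e"
    using c[of u v] e unfolding continuous_at_eps_delta by blast
  obtain r2 where r2: "r2 > 0" "\<And>y. dist y x < r2 \<Longrightarrow> dist (A v u y) (A v u x) < e"
    using c[of v u] e unfolding continuous_at_eps_delta by blast
  obtain r3 where r3: "r3 > 0" "ball x r3 \<subseteq> S" using S x open_contains_ball by blast
  define r where "r = min r1 (min r2 r3)"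
  have r: "r > 0" using r1 r2 r3 by (simp add: r_def)
  \<comment> \<open>The summand 1 keeps N positive when u = v = 0; the factor 1/2 in h makes the
    bound by r strict.\<close>
  define N where "N = norm u + norm v + 1"
  define h where "h = r / N / 2"
  have pos: "N > 0" by (simp add: N_def add_nonneg_pos)
  have h: "h > 0" using r pos by (simp add: h_def)
  have hr: "h * (norm u + norm v) < r"
  proof -
    have "h * (norm u + norm v) \<le> h * N" using h by (intro mult_left_mono) (auto simp: N_def)
    also have "\<dots> = r / 2" using pos by (simp add: h_def)
    finally show ?thesis using r by simp
  qed
  have inS: "y \<in> S" if "y \<in> ball x r" for y using that r3 by (auto simp: r_def)
  have d1: "f differentiable (at y)" if "y \<in> ball x r" for y
    using smooth_on_differentiable[OF f inS[OF that]] .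
  have d2: "(\<lambda>z. frechet_derivative f (at z) w) differentiable (at y)" if "y \<in> ball x r" for y w
    using smooth_on_differentiable[OF smooth_on_fderiv[OF f] inS[OF that]] .
  obtain y where y: "y \<in> ball x r" "f (x + h *\<^sub>R u + h *\<^sub>R v) - f (x + h *\<^sub>R u) - f (x + h *\<^sub>R v) + f x = h * h * A u v y"
    using second_difference_mean_value[OF d1 d2 h hr] unfolding A_def by blast
  obtain z where z: "z \<in> ball x r" "f (x + h *\<^sub>R v + h *\<^sub>R u) - f (x + h *\<^sub>R v) - f (x + h *\<^sub>R u) + f x = h * h * A v u z"
    using second_difference_mean_value[of x r f v h u, OF d1 d2 h] hr unfolding A_def by (auto simp: add.commute)
  have "h * h * A u v y = h * h * A v u z"
    unfolding y(2)[symmetric] z(2)[symmetric] by (simp add: add_ac)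
  then have "A u v y = A v u z" using h by simp
  moreover have "\<bar>A u v y - A u v x\<bar> < e" using r1(2)[of y] y(1) by (simp add: r_def dist_commute dist_real_def)
  moreover have "\<bar>A v u z - A v u x\<bar> < e" using r2(2)[of z] z(1) by (simp add: r_def dist_commute dist_real_def)
  ultimately show False unfolding e_def by (smt (verit) field_sum_of_halves)
qed

section \<open>Differential forms on open subsets of Euclidean space\<close>

text \<open>Smooth k-forms on \<open>S\<close>. Smoothness is tested on constant arguments, to which
  multilinearity reduces variable ones; nothing is required outside \<open>S\<close>.\<close>

definition sform :: "(real^'d) set \<Rightarrow> nat \<Rightarrow> (real^'d \<Rightarrow> (nat \<Rightarrow> real^'d) \<Rightarrow> real) \<Rightarrow> bool" where
  "sform S k F \<longleftrightarrow> (\<forall>x\<in>S. F x \<in> alt_forms k) \<and> (\<forall>v. smooth_on S (\<lambda>x. F x v))"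

definition extd :: "nat \<Rightarrow> (real^'d \<Rightarrow> (nat \<Rightarrow> real^'d) \<Rightarrow> real) \<Rightarrow> real^'d \<Rightarrow> (nat \<Rightarrow> real^'d) \<Rightarrow> real" where
  "extd k F x v = (\<Sum>i\<le>k. (-1) ^ i *
     frechet_derivative (\<lambda>y. F y (\<lambda>j. if j < i then v j else v (Suc j))) (at x) (v i))"

text \<open>The derivative of the coefficients along X, which is the Lie derivative along the
  constant vector field X.\<close>

definition dird :: "real^'d \<Rightarrow> (real^'d \<Rightarrow> (nat \<Rightarrow> real^'d) \<Rightarrow> real) \<Rightarrow> real^'d \<Rightarrow> (nat \<Rightarrow> real^'d) \<Rightarrow> real" where
  "dird X F x v = frechet_derivative (\<lambda>y. F y v) (at x) X"

lemma sformI: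
  "(\<And>x. x \<in> S \<Longrightarrow> F x \<in> alt_forms k) \<Longrightarrow> (\<And>v. smooth_on S (\<lambda>x. F x v)) \<Longrightarrow> sform S k F"
  by (simp add: sform_def)

lemma sformD:
  assumes "sform S k F"
  shows "x \<in> S \<Longrightarrow> F x \<in> alt_forms k" and "smooth_on S (\<lambda>x. F x v)"
  using assms by (auto simp: sform_def)

lemma sform_subset: "sform S k F \<Longrightarrow> T \<subseteq> S \<Longrightarrow> sform T k F"
  by (auto simp: sform_def intro: smooth_on_subset)

lemma sform_has_derivative:
  "sform S k F \<Longrightarrow> x \<in> S \<Longrightarrow> ((\<lambda>y. F y v) has_derivative (\<lambda>X. dird X F x v)) (at x)"
  unfolding dird_def by (rule smooth_on_has_derivative[OF sformD(2)])

lemma sform_cong: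
  assumes "open S" "\<And>x. x \<in> S \<Longrightarrow> F x = G x" "sform S k F"
  shows "sform S k G"
  using assms smooth_on_cong[OF assms(1)] unfolding sform_def by metis

lemma extd_cong:
  assumes "open S" "x \<in> S" "\<And>x. x \<in> S \<Longrightarrow> F x = G x" "sform S k F"
  shows "extd k F x = extd k G x"
  unfolding extd_def
  by (intro ext sum.cong refl arg_cong2[where f = "(*)"] fun_cong[OF fderiv_cong_open[OF assms(1,2)]])
    (use assms in \<open>auto intro: smooth_on_differentiable[OF sformD(2)]\<close>)

lemma sform_zero [simp]: "sform S k (\<lambda>x v. 0)"
  by (simp add: sform_def)

lemma sform_const: "f \<in> alt_forms k \<Longrightarrow> sform S k (\<lambda>x. f)"
  by (simp add: sform_def)

lemma sform_add:
  "open S \<Longrightarrow> sform S k F \<Longrightarrow> sform S k G \<Longrightarrow> sform S k (\<lambda>x v. F x v + G x v)"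
  by (auto simp: sform_def intro: alt_forms_add smooth_on_add)

lemma sform_smooth_scale:
  "open S \<Longrightarrow> smooth_on S c \<Longrightarrow> sform S k F \<Longrightarrow> sform S k (\<lambda>x v. c x * F x v)"
  by (auto simp: sform_def intro: alt_forms_scale smooth_on_mult)

lemma sform_scale: "open S \<Longrightarrow> sform S k F \<Longrightarrow> sform S k (\<lambda>x v. c * F x v)"
  by (rule sform_smooth_scale) simp_all

lemma sform_sum:
  "open S \<Longrightarrow> (\<And>i. i \<in> I \<Longrightarrow> sform S k (F i)) \<Longrightarrow> sform S k (\<lambda>x v. \<Sum>i\<in>I. F i x v)"
  by (auto simp: sform_def intro: alt_forms_sum smooth_on_sum)

lemma sform_iprod: "sform S k F \<Longrightarrow> sform S (k - 1) (\<lambda>x. iprod k X (F x))"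
  by (cases k) (auto simp: sform_def contract_alt_forms, simp add: contract_def)

lemma sform_wedge:
  assumes S: "open S" and F: "sform S k F" and G: "sform S l G"
  shows "sform S (k + l) (\<lambda>x. alt_wedge k l (F x) (G x))"
proof (rule sformI)
  show "alt_wedge k l (F x) (G x) \<in> alt_forms (k + l)" if "x \<in> S" for x
    using alt_wedge_alt_forms[OF sformD(1)[OF F that] sformD(1)[OF G that]] .
  show "smooth_on S (\<lambda>x. alt_wedge k l (F x) (G x) v)" for v
    unfolding alt_wedge_def divide_inverse
    by (intro smooth_on_mult smooth_on_sum S smooth_on_const sformD[OF F] sformD[OF G])
qed

lemma sform_lef:
  assumes "open S" and "sform S 2 \<Omega>" and "sform S m F"
  shows "sform S (m + 2 * j) (\<lambda>x. lef j m (\<Omega> x) (F x))"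
proof (induction j)
  case (Suc j)
  then show ?case using sform_wedge[OF assms(1,2)] by (simp add: add_ac)
qed (use assms in simp)

lemma iprod_field_expand:
  assumes "f \<in> alt_forms k"
  shows "iprod k X f v = (\<Sum>b\<in>UNIV. X $ b * iprod k (axis b 1) f v)"
  using fun_cong[OF iprod_axis_sum[OF assms, of X]] by simp

text \<open>A variable field is expanded in the coordinate fields, so that only contractions with
  constant vectors have to be differentiated.\<close>

lemma sform_iprod_field:
  assumes S: "open S" and F: "sform S k F" and X: "\<And>b. smooth_on S (\<lambda>x. X x $ b)"
  shows "sform S (k - 1) (\<lambda>x. iprod k (X x) (F x))"
proof (rule sform_cong[OF S])
  show "sform S (k - 1) (\<lambda>x v. \<Sum>b\<in>UNIV. X x $ b * iprod k (axis b 1) (F x) v)"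
    by (intro sform_sum sform_smooth_scale S X sform_iprod F)
  show "(\<lambda>v. \<Sum>b\<in>UNIV. X x $ b * iprod k (axis b 1) (F x) v) = iprod k (X x) (F x)" if "x \<in> S" for x
    by (rule ext) (rule iprod_field_expand[OF sformD(1)[OF F that], symmetric])
qed

lemma extd_sform_add:
  assumes F: "sform S k F" and G: "sform S k G" and x: "x \<in> S"
  shows "extd k (\<lambda>x v. F x v + G x v) x = (\<lambda>v. extd k F x v + extd k G x v)"
  unfolding extd_def
  by (simp add: fun_eq_iff distrib_left sum.distrib
      fderiv_eqI[OF has_derivative_add[OF sform_has_derivative[OF F x] sform_has_derivative[OF G x]]]
      fderiv_eqI[OF sform_has_derivative[OF F x]] fderiv_eqI[OF sform_has_derivative[OF G x]])

lemma extd_sform_scale: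
  assumes F: "sform S k F" and x: "x \<in> S"
  shows "extd k (\<lambda>x v. c * F x v) x = (\<lambda>v. c * extd k F x v)"
  unfolding extd_def
  by (simp add: fun_eq_iff sum_distrib_left mult_ac
      fderiv_eqI[OF has_derivative_mult_right[OF sform_has_derivative[OF F x]]]
      fderiv_eqI[OF sform_has_derivative[OF F x]])

lemma extd_zero [simp]: "extd k (\<lambda>x v. 0) = (\<lambda>x v. 0)"
  by (simp add: extd_def fun_eq_iff)

lemma extd_const [simp]: "extd k (\<lambda>x. f) = (\<lambda>x v. 0)"
  by (simp add: extd_def fun_eq_iff)

lemma extd_sform_diff:
  assumes F: "sform S k F" and G: "sform S k G" and x: "x \<in> S" and S: "open S"
  shows "extd k (\<lambda>x v. F x v - G x v) x = (\<lambda>v. extd k F x v - extd k G x v)"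
  using extd_sform_add[OF F sform_scale[OF S G, of "-1"] x] extd_sform_scale[OF G x, of "-1"] by simp

lemma extd_sform_sum:
  assumes S: "open S" and F: "\<And>i. i \<in> I \<Longrightarrow> sform S k (F i)" and x: "x \<in> S"
  shows "extd k (\<lambda>x v. \<Sum>i\<in>I. F i x v) x = (\<lambda>v. \<Sum>i\<in>I. extd k (F i) x v)"
  using F
proof (induction I rule: infinite_finite_induct)
  case (insert i I)
  then show ?case using extd_sform_add[OF insert.prems[of i] sform_sum[OF S, of I k F] x] by simp
qed simp_all

section \<open>Cartan calculus with constant fields: d maps forms to forms, d d = 0, and the Leibniz
  rule\<close>

lemma contract_extd:
  "contract X (extd k F x) = (\<lambda>v. dird X F x v - extd (k - 1) (\<lambda>y. iprod k X (F y)) x v)"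
proof
  fix v
  have e: "(\<lambda>j. if j < Suc i then case_nat X v j else case_nat X v (Suc j)) =
      case_nat X (\<lambda>j. if j < i then v j else v (Suc j))" for i
    by (auto simp: fun_eq_iff split: nat.split)
  show "contract X (extd k F x) v = dird X F x v - extd (k - 1) (\<lambda>y. iprod k X (F y)) x v"
  proof (cases k)
    case 0
    then show ?thesis by (simp add: contract_def extd_def dird_def)
  next
    case (Suc k')
    have "contract X (extd k F x) v = dird X F x v + (\<Sum>i\<le>k'. - ((-1) ^ i *
       frechet_derivative (\<lambda>y. F y (case_nat X (\<lambda>j. if j < i then v j else v (Suc j)))) (at x) (v i)))"
      unfolding contract_def extd_def Suc sum.atMost_Suc_shift e by (simp add: dird_def)
    then show ?thesis by (simp add: Suc sum_negf extd_def contract_def)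
  qed
qed

lemma linear_dird: "sform S k F \<Longrightarrow> x \<in> S \<Longrightarrow> linear (\<lambda>X. dird X F x v)"
  using sform_has_derivative has_derivative_linear by blast

text \<open>The defining identities of alternating forms hold on a neighbourhood of x and so pass to
  the derivative at x.\<close>

lemma dird_alt_forms:
  assumes S: "open S" and F: "sform S k F" and x: "x \<in> S"
  shows "dird X F x \<in> alt_forms k"
  unfolding alt_forms_def mem_Collect_eq
proof (intro conjI allI impI)
  have loc: "dird X F x u = dird X F x v" if "\<And>y. y \<in> S \<Longrightarrow> F y u = F y v" for u v
    unfolding dird_def
    using fderiv_cong_open[OF S x that smooth_on_differentiable[OF sformD(2)[OF F] x]] by metis
  show "dird X F x u = dird X F x v" if "\<forall>i<k. u i = v i" for u v
    by (rule loc) (use that in \<open>auto intro: alt_forms_cong[OF sformD(1)[OF F]]\<close>)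
  show "dird X F x v = 0" if "i < k" "j < k" "i \<noteq> j \<and> v i = v j" for i j v
  proof -
    have "F y v = 0" if "y \<in> S" for y
      using alt_forms_eq0[OF sformD(1)[OF F that]] \<open>i < k\<close> \<open>j < k\<close> \<open>i \<noteq> j \<and> v i = v j\<close> by blast
    then have "frechet_derivative (\<lambda>y. 0::real) (at x) X = frechet_derivative (\<lambda>y. F y v) (at x) X"
      by (intro fun_cong[OF fderiv_cong_open[OF S x]]) auto
    then show ?thesis by (simp add: dird_def)
  qed
  show "linear (\<lambda>u. dird X F x (v(i := u)))" if i: "i < k" for i v
  proof (rule linearI)
    fix a b
    have "frechet_derivative (\<lambda>y. F y (v(i := a + b))) (at x) = frechet_derivative (\<lambda>y. F y (v(i := a)) + F y (v(i := b))) (at x)"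
      using linear_add[OF alt_forms_linear[OF sformD(1)[OF F] i]]
      by (intro fderiv_cong_open[OF S x] smooth_on_differentiable[OF sformD(2)[OF F] x]) auto
    then show "dird X F x (v(i := a + b)) = dird X F x (v(i := a)) + dird X F x (v(i := b))"
      by (simp add: dird_def[of _ _ _ "v(i := a + b)"]
        fderiv_eqI[OF has_derivative_add[OF sform_has_derivative[OF F x] sform_has_derivative[OF F x]]])
  next
    fix c a
    have "frechet_derivative (\<lambda>y. F y (v(i := c *\<^sub>R a))) (at x) = frechet_derivative (\<lambda>y. c * F y (v(i := a))) (at x)"
      using linear_scale[OF alt_forms_linear[OF sformD(1)[OF F] i]]
      by (intro fderiv_cong_open[OF S x] smooth_on_differentiable[OF sformD(2)[OF F] x]) auto
    then show "dird X F x (v(i := c *\<^sub>R a)) = c *\<^sub>R dird X F x (v(i := a))"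
      by (simp add: dird_def[of _ _ _ "v(i := c *\<^sub>R a)"]
        fderiv_eqI[OF has_derivative_mult_right[OF sform_has_derivative[OF F x]]])
  qed
qed

lemma sform_dird:
  assumes "open S" and F: "sform S k F" shows "sform S k (dird X F)"
  using dird_alt_forms[OF assms] smooth_on_fderiv[OF sformD(2)[OF F]]
  by (intro sformI) (auto simp: dird_def)

lemma iprod_dird: "iprod k X (dird Y F x) = dird Y (\<lambda>y. iprod k X (F y)) x"
  by (cases k) (auto simp: contract_def dird_def)

text \<open>The formula \<open>contract_extd\<close> is Cartan's L_X = \<iota>_X d + d \<iota>_X. It
  expresses the contractions of dF by forms already under control, which is what
  \<open>alt_formsI_contract\<close> asks for.\<close>

lemma extd_alt_forms:
  assumes S: "open S" and "sform S k F" and x: "x \<in> S"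
  shows "extd k F x \<in> alt_forms (Suc k)"
  using assms(2)
proof (induction k arbitrary: F)
  case 0
  show ?case
  proof (rule alt_formsI_contract)
    show "contract X (extd 0 F x) \<in> alt_forms 0" for X
      unfolding contract_extd using dird_alt_forms[OF S 0 x] by simp
    show "linear (\<lambda>X. contract X (extd 0 F x) v)" for v
      unfolding contract_extd using linear_dird[OF 0 x] by simp
  qed simp
next
  case (Suc k)
  note F = Suc.prems
  have cF: "sform S k (\<lambda>y. contract X (F y))" for X
    using sform_iprod[OF F, of X] by simp
  show ?case
  proof (rule alt_formsI_contract)
    show "contract X (extd (Suc k) F x) \<in> alt_forms (Suc k)" for X
      unfolding contract_extd using dird_alt_forms[OF S F x] Suc.IH[OF cF]
      by (auto intro!: alt_forms_diff)
    show "linear (\<lambda>X. contract X (extd (Suc k) F x) v)" for v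
      unfolding contract_extd diff_Suc_1 iprod_Suc
    proof (rule linear_compose_sub[OF linear_dird[OF F x]], rule linearI)
      fix X Y
      have "extd k (\<lambda>y. contract (X + Y) (F y)) x = extd k (\<lambda>y v. contract X (F y) v + contract Y (F y) v) x"
        using iprod_vector_add[OF sformD(1)[OF F], of _ X Y] by (intro extd_cong[OF S x _ cF]) auto
      then show "extd k (\<lambda>y. contract (X + Y) (F y)) x v = extd k (\<lambda>y. contract X (F y)) x v + extd k (\<lambda>y. contract Y (F y)) x v"
        by (simp add: extd_sform_add[OF cF cF x])
    next
      fix c X
      have "extd k (\<lambda>y. contract (c *\<^sub>R X) (F y)) x = extd k (\<lambda>y v. c * contract X (F y) v) x"
        using iprod_vector_scale[OF sformD(1)[OF F], of _ c X] by (intro extd_cong[OF S x _ cF]) auto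
      then show "extd k (\<lambda>y. contract (c *\<^sub>R X) (F y)) x v = c *\<^sub>R extd k (\<lambda>y. contract X (F y)) x v"
        by (simp add: extd_sform_scale[OF cF x])
    qed
    \<comment> \<open>Cartan's formula twice: \<iota>_X \<iota>_X dF = \<iota>_X L_X F - \<iota>_X d
      \<iota>_X F = \<iota>_X L_X F - L_X \<iota>_X F + d \<iota>_X \<iota>_X F, and L_X commutes
      with \<iota>_X because X is constant.\<close>
    show "contract X (contract X (extd (Suc k) F x)) = (\<lambda>v. 0)" for X
    proof -
      have "sform S (k - 1) (\<lambda>y. iprod k X (contract X (F y)))" by (rule sform_iprod[OF cF])
      then have "extd (k - 1) (\<lambda>y. iprod k X (contract X (F y))) x = extd (k - 1) (\<lambda>y v. 0) x"
        using iprod_iprod[OF sformD(1)[OF F], of _ X] by (intro extd_cong[OF S x]) auto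
      then show ?thesis
        unfolding contract_extd[of X "Suc k"] contract_diff diff_Suc_1 iprod_Suc
        using iprod_dird[of "Suc k" X X F x] by (simp add: contract_extd)
    qed
  qed
qed

lemma sform_extd:
  assumes S: "open S" and F: "sform S k F"
  shows "sform S (Suc k) (extd k F)"
  unfolding sform_def extd_def[abs_def]
proof (intro conjI ballI allI smooth_on_sum smooth_on_mult S smooth_on_const smooth_on_fderiv sformD(2)[OF F])
  show "(\<lambda>v. \<Sum>i\<le>k. (- 1) ^ i * frechet_derivative (\<lambda>y. F y (\<lambda>j. if j < i then v j else v (Suc j))) (at x) (v i)) \<in> alt_forms (Suc k)"
    if "x \<in> S" for x
    using extd_alt_forms[OF S F that] by (simp add: extd_def[abs_def])
qed

text \<open>L_X commutes with d. This is where the symmetry of second derivatives enters.\<close>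

lemma dird_extd:
  fixes F :: "real^'d \<Rightarrow> (nat \<Rightarrow> real^'d) \<Rightarrow> real"
  assumes S: "open S" and F: "sform S k F" and x: "x \<in> S"
  shows "dird X (extd k F) x = extd k (dird X F) x"
proof
  fix v :: "nat \<Rightarrow> real^'d"
  let ?w = "\<lambda>i j. if j < i then v j else v (Suc j)"
  have D: "((\<lambda>y. extd k F y v) has_derivative (\<lambda>h. \<Sum>i\<le>k. (-1) ^ i *
      frechet_derivative (\<lambda>y. frechet_derivative (\<lambda>y. F y (?w i)) (at y) (v i)) (at x) h)) (at x)"
    unfolding extd_def
    by (intro has_derivative_sum has_derivative_mult_right smooth_on_has_derivative[OF _ x] smooth_on_fderiv sformD(2)[OF F])
  show "dird X (extd k F) x v = extd k (dird X F) x v"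
    unfolding dird_def[of X "extd k F"] fderiv_eqI[OF D] unfolding extd_def dird_def
    by (intro sum.cong refl arg_cong2[where f = "(*)"] second_derivative_symmetric[OF S x] sformD(2)[OF F])
qed

text \<open>\<iota>_X d d F = L_X dF - d \<iota>_X dF = d L_X F - d (L_X F - d \<iota>_X F) = d d
  \<iota>_X F, which vanishes by induction on the degree.\<close>

lemma extd_extd:
  assumes S: "open S" and "sform S k F" and x: "x \<in> S"
  shows "extd (Suc k) (extd k F) x = (\<lambda>v. 0)"
  using assms(2,3)
proof (induction k arbitrary: F x)
  case 0
  note F = 0(1) and x = 0(2)
  show ?case
  proof (rule contract_ext)
    show "contract X (extd (Suc 0) (extd 0 F) x) = contract X (\<lambda>v. 0)" for X
      unfolding contract_extd[of X "Suc 0"] dird_extd[OF S F x]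
      by (simp add: contract_extd)
  qed
next
  case (Suc k)
  note F = Suc.prems(1) and x = Suc.prems(2)
  have cF: "sform S k (\<lambda>y. contract X (F y))" for X
    using sform_iprod[OF F, of X] by simp
  show ?case
  proof (rule contract_ext)
    fix X
    have "extd (Suc k) (\<lambda>y. contract X (extd (Suc k) F y)) x = extd (Suc k) (dird X F) x"
      unfolding contract_extd
      using extd_sform_diff[OF sform_dird[OF S F] sform_extd[OF S cF] x S, of X X] Suc.IH[OF cF x, of X] by simp
    then show "contract X (extd (Suc (Suc k)) (extd (Suc k) F) x) = contract X (\<lambda>v. 0)"
      unfolding contract_extd[of X "Suc (Suc k)"] dird_extd[OF S F x]
      by simp
  qed
qed

lemma dird_wedge:
  assumes F: "sform S k F" and G: "sform S l G" and x: "x \<in> S"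
  shows "dird X (\<lambda>y. alt_wedge k l (F y) (G y)) x =
    (\<lambda>v. alt_wedge k l (dird X F x) (G x) v + alt_wedge k l (F x) (dird X G x) v)"
proof
  fix v
  have D: "((\<lambda>y. alt_wedge k l (F y) (G y) v) has_derivative (\<lambda>h. (\<Sum>\<sigma> | \<sigma> permutes {..<k + l}.
      of_int (sign \<sigma>) * F x (\<lambda>i. v (\<sigma> i)) * dird h G x (\<lambda>i. v (\<sigma> (k + i))) +
      of_int (sign \<sigma>) * dird h F x (\<lambda>i. v (\<sigma> i)) * G x (\<lambda>i. v (\<sigma> (k + i)))) * inverse (fact k * fact l))) (at x)"
    unfolding alt_wedge_def divide_inverse
    by (intro has_derivative_mult_left has_derivative_sum has_derivative_mult has_derivative_mult_right
        sform_has_derivative[OF F x] sform_has_derivative[OF G x])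
  show "dird X (\<lambda>y. alt_wedge k l (F y) (G y)) x v =
    alt_wedge k l (dird X F x) (G x) v + alt_wedge k l (F x) (dird X G x) v"
    unfolding dird_def[of X "\<lambda>y. alt_wedge k l (F y) (G y)"] fderiv_eqI[OF D]
    by (simp add: alt_wedge_def divide_inverse sum.distrib distrib_right add.commute)
qed

text \<open>After contraction with X, Cartan's formula splits the claim into the Leibniz rule for
  L_X, which is \<open>dird_wedge\<close>, and the rule itself for the pairs (\<iota>_X F, G) and
  (F, \<iota>_X G) of smaller total degree.\<close>

lemma extd_wedge:
  assumes S: "open S" and "sform S k F" and "sform S l G" and x: "x \<in> S"
  shows "extd (k + l) (\<lambda>y. alt_wedge k l (F y) (G y)) x =
    (\<lambda>v. alt_wedge (Suc k) l (extd k F x) (G x) v + (-1) ^ k * alt_wedge k (Suc l) (F x) (extd l G x) v)"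
  using assms(2-4)
proof (induction "k + l" arbitrary: k l F G rule: less_induct)
  case less
  note F = less.prems(1) and G = less.prems(2) and x = less.prems(3)
  note Fx = sformD(1)[OF F] and Gx = sformD(1)[OF G]
  note dF = extd_alt_forms[OF S F x] and dG = extd_alt_forms[OF S G x]
  let ?W = "\<lambda>y. alt_wedge k l (F y) (G y)"
  show ?case
  proof (rule contract_ext)
    fix X
    let ?iF = "\<lambda>y. iprod k X (F y)" and ?iG = "\<lambda>y. iprod l X (G y)"
    have s1: "sform S (k + l - 1) (\<lambda>y. alt_wedge (k - 1) l (?iF y) (G y))"
      using sform_wedge[OF S sform_iprod[OF F, of X] G] by (cases k) auto
    have s2: "sform S (k + l - 1) (\<lambda>y. alt_wedge k (l - 1) (F y) (?iG y))"
      using sform_wedge[OF S F sform_iprod[OF G, of X]] by (cases l) auto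
    have 1: "extd (k + l - 1) (\<lambda>y. alt_wedge (k - 1) l (?iF y) (G y)) x =
      (\<lambda>v. alt_wedge k l (extd (k - 1) ?iF x) (G x) v - (-1) ^ k * alt_wedge (k - 1) (Suc l) (?iF x) (extd l G x) v)"
    proof (cases k)
      case (Suc k')
      then show ?thesis using less.hyps[of "k - 1" l ?iF G] sform_iprod[OF F, of X] G x by simp
    qed simp
    have 2: "extd (k + l - 1) (\<lambda>y. alt_wedge k (l - 1) (F y) (?iG y)) x =
      (\<lambda>v. alt_wedge (Suc k) (l - 1) (extd k F x) (?iG x) v + (-1) ^ k * alt_wedge k l (F x) (extd (l - 1) ?iG x) v)"
    proof (cases l)
      case (Suc k')
      then show ?thesis using less.hyps[of k "l - 1" F ?iG] sform_iprod[OF G, of X] F x by simp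
    qed simp
    have W: "iprod (k + l) X (?W y) = (\<lambda>v. alt_wedge (k - 1) l (?iF y) (G y) v + (-1) ^ k * alt_wedge k (l - 1) (F y) (?iG y) v)"
      if "y \<in> S" for y by (rule iprod_wedge[OF Fx[OF that] Gx[OF that]])
    have "extd (k + l - 1) (\<lambda>y. iprod (k + l) X (?W y)) x =
        extd (k + l - 1) (\<lambda>y v. alt_wedge (k - 1) l (?iF y) (G y) v + (-1) ^ k * alt_wedge k (l - 1) (F y) (?iG y) v) x"
      by (rule extd_cong[OF S x W sform_iprod[OF sform_wedge[OF S F G]]])
    also have "\<dots> = (\<lambda>v. extd (k + l - 1) (\<lambda>y. alt_wedge (k - 1) l (?iF y) (G y)) x v +
        (-1) ^ k * extd (k + l - 1) (\<lambda>y. alt_wedge k (l - 1) (F y) (?iG y)) x v)"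
      unfolding extd_sform_add[OF s1 sform_scale[OF S s2] x] extd_sform_scale[OF s2 x] ..
    finally have L: "contract X (extd (k + l) ?W x) = (\<lambda>v. alt_wedge k l (dird X F x) (G x) v + alt_wedge k l (F x) (dird X G x) v
       - (alt_wedge k l (extd (k - 1) ?iF x) (G x) v - (-1) ^ k * alt_wedge (k - 1) (Suc l) (?iF x) (extd l G x) v
        + (-1) ^ k * (alt_wedge (Suc k) (l - 1) (extd k F x) (?iG x) v + (-1) ^ k * alt_wedge k l (F x) (extd (l - 1) ?iG x) v)))"
      unfolding contract_extd dird_wedge[OF F G x] 1 2 by simp
    have R1: "contract X (alt_wedge (Suc k) l (extd k F x) (G x)) = (\<lambda>v. alt_wedge k l (dird X F x) (G x) v -
        alt_wedge k l (extd (k - 1) ?iF x) (G x) v - (-1) ^ k * alt_wedge (Suc k) (l - 1) (extd k F x) (?iG x) v)"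
      using iprod_wedge[OF dF Gx[OF x], of X]
        alt_wedge_add_left[of k l "dird X F x" "\<lambda>v. - extd (k - 1) ?iF x v" "G x"]
      by (simp add: contract_extd alt_wedge_minus_left)
    have R2: "contract X (alt_wedge k (Suc l) (F x) (extd l G x)) = (\<lambda>v. alt_wedge (k - 1) (Suc l) (?iF x) (extd l G x) v +
        (-1) ^ k * (alt_wedge k l (F x) (dird X G x) v - alt_wedge k l (F x) (extd (l - 1) ?iG x) v))"
      using iprod_wedge[OF Fx[OF x] dG, of X]
      by (simp add: contract_extd alt_wedge_diff_right)
    show "contract X (extd (k + l) ?W x) = contract X (\<lambda>v. alt_wedge (Suc k) l (extd k F x) (G x) v +
        (-1) ^ k * alt_wedge k (Suc l) (F x) (extd l G x) v)"
      unfolding L contract_add contract_scale R1 R2 by (simp add: fun_eq_iff algebra_simps flip: mult.assoc power_add)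
  qed
qed

subsection \<open>Pullback\<close>

definition pullback :: "(real^'d \<Rightarrow> real^'d) \<Rightarrow> (real^'d \<Rightarrow> (nat \<Rightarrow> real^'d) \<Rightarrow> real) \<Rightarrow> real^'d \<Rightarrow> (nat \<Rightarrow> real^'d) \<Rightarrow> real" where
  "pullback \<phi> F x v = F (\<phi> x) (\<lambda>i. frechet_derivative \<phi> (at x) (v i))"

lemma euler_form:
  fixes f :: "(nat \<Rightarrow> real^'d) \<Rightarrow> real"
  assumes "f \<in> alt_forms (Suc k)"
  shows "f = (\<lambda>v. inverse (Suc k) * (\<Sum>b\<in>UNIV. alt_wedge (Suc 0) k (coord b) (contract (axis b 1) f) v))"
  using fun_cong[OF euler_identity[OF assms]] by (simp add: fun_eq_iff field_simps)

context
  fixes S T :: "(real^'d) set" and \<phi> :: "real^'d \<Rightarrow> real^'d"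
  assumes S: "open S" and T: "open T" and phi: "smooth_on S \<phi>" and ST: "\<phi> ` S \<subseteq> T"
begin

lemma phi_in: "x \<in> S \<Longrightarrow> \<phi> x \<in> T"
  using ST by blast

lemma pullback_alt_forms: "F (\<phi> x) \<in> alt_forms k \<Longrightarrow> x \<in> S \<Longrightarrow> pullback \<phi> F x \<in> alt_forms k"
  using alt_forms_pullback[OF _ linear_frechet_derivative[OF smooth_on_differentiable[OF phi]]]
  by (simp add: pullback_def[abs_def])

lemma pullback_coord_eq: "pullback \<phi> (\<lambda>y. coord b) x = extd 0 (\<lambda>y v. \<phi> y $ b) x" if "x \<in> S"
proof -
  have "((\<lambda>y. \<phi> y $ b) has_derivative (\<lambda>h. frechet_derivative \<phi> (at x) h $ b)) (at x)"
    by (rule bounded_linear.has_derivative[OF bounded_linear_vec_nth smooth_on_has_derivative[OF phi that]])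
  then show ?thesis by (simp add: fun_eq_iff pullback_def coord_def extd_def fderiv_eqI)
qed

lemma sform_component: "sform S 0 (\<lambda>y v. \<phi> y $ b)"
  by (rule sformI) (simp_all add: smooth_on_vec_nth[OF S phi])

lemma sform_pullback_coord: "sform S (Suc 0) (pullback \<phi> (\<lambda>y. coord b))"
  by (rule sform_cong[OF S _ sform_extd[OF S sform_component[of b]]]) (simp add: pullback_coord_eq)

text \<open>Contraction with a fixed vector is not compatible with pullback along a general map, so
  the degree cannot be lowered by contracting the pullback. Euler's identity on the target does it
  instead: pullback respects products, and the pullback of dx_b is d\<phi>_b.\<close>

lemma pullback_euler:
  assumes F: "sform T (Suc k) F" and x: "x \<in> S"
  shows "pullback \<phi> F x = (\<lambda>v. inverse (Suc k) * (\<Sum>b\<in>UNIV. alt_wedge (Suc 0) k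
     (pullback \<phi> (\<lambda>y. coord b) x) (pullback \<phi> (\<lambda>y. contract (axis b 1) (F y)) x) v))"
  unfolding pullback_def[abs_def] alt_wedge_pullback
  using fun_cong[OF euler_form[OF sformD(1)[OF F phi_in[OF x]]]] by (simp add: fun_eq_iff)

lemma sform_pullback:
  assumes "sform T k F"
  shows "sform S k (pullback \<phi> F)"
  using assms
proof (induction k arbitrary: F)
  case 0
  have c: "F (\<phi> x) v = F (\<phi> x) w" if "x \<in> S" for x v w
    using sformD(1)[OF 0 phi_in[OF that]] by (auto elim: alt_forms_0E)
  show ?case
  proof (rule sformI)
    show "pullback \<phi> F x \<in> alt_forms 0" if "x \<in> S" for x
      using pullback_alt_forms[of F x 0] sformD(1)[OF 0 phi_in[OF that]] that by blast
    show "smooth_on S (\<lambda>x. pullback \<phi> F x v)" for v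
    proof (rule smooth_on_cong[OF S])
      show "smooth_on S (\<lambda>x. F (\<phi> x) v)"
        using smooth_on_compose[OF S phi sformD(2)[OF 0, of v] ST] .
      show "F (\<phi> x) v = pullback \<phi> F x v" if "x \<in> S" for x
        using c[OF that] by (simp add: pullback_def)
    qed
  qed
next
  case (Suc k)
  show ?case
  proof (rule sform_cong[OF S])
    have "sform T k (\<lambda>y. contract (axis b 1) (F y))" for b
      using sform_iprod[OF Suc.prems, of "axis b 1"] by simp
    then have "sform S (Suc k) (\<lambda>x. alt_wedge (Suc 0) k (pullback \<phi> (\<lambda>y. coord b) x) (pullback \<phi> (\<lambda>y. contract (axis b 1) (F y)) x))" for b
      using sform_wedge[OF S sform_pullback_coord Suc.IH] by simp
    then show "sform S (Suc k) (\<lambda>x v. inverse (Suc k) * (\<Sum>b\<in>UNIV. alt_wedge (Suc 0) k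
       (pullback \<phi> (\<lambda>y. coord b) x) (pullback \<phi> (\<lambda>y. contract (axis b 1) (F y)) x) v))"
      by (intro sform_scale sform_sum S)
  qed (rule pullback_euler[OF Suc.prems, symmetric])
qed

lemma extd_pullback_coord: "x \<in> S \<Longrightarrow> extd (Suc 0) (pullback \<phi> (\<lambda>y. coord b)) x = (\<lambda>v. 0)"
  using extd_cong[OF S _ pullback_coord_eq sform_pullback_coord[of b]]
    extd_extd[OF S sform_component[of b]] by simp

text \<open>In positive degree both sides become the same multiple of the sum of the terms -
  d\<phi>_b \<and> \<phi>^* d \<iota>_b F: on the target because dx_b is closed, on the source
  because d\<phi>_b is and by induction for \<iota>_b F. Degree 0 is the chain rule.\<close>

lemma extd_pullback:
  assumes "sform T k F" and x: "x \<in> S"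
  shows "extd k (pullback \<phi> F) x = pullback \<phi> (extd k F) x"
  using assms
proof (induction k arbitrary: F)
  case 0
  note F = 0(1)
  have c: "F (\<phi> x) v = F (\<phi> x) w" if "x \<in> S" for x v w
    using sformD(1)[OF F phi_in[OF that]] by (auto elim: alt_forms_0E)
  show ?case
  proof
    fix v :: "nat \<Rightarrow> real^'d"
    have "((\<lambda>y. F (\<phi> y) v) has_derivative (\<lambda>h. dird (frechet_derivative \<phi> (at x) h) F (\<phi> x) v)) (at x)" for v
      by (rule has_derivative_compose[OF smooth_on_has_derivative[OF phi x] sform_has_derivative[OF F phi_in[OF x]]])
    note D = fderiv_eqI[OF this]
    let ?v = "\<lambda>j. v (Suc j)"
    let ?w = "\<lambda>j. frechet_derivative \<phi> (at x) (v (Suc j))"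
    have "extd 0 (pullback \<phi> F) x v = frechet_derivative (\<lambda>y. F (\<phi> y) ?w) (at x) (v 0)"
      unfolding extd_def using c smooth_on_differentiable[OF sformD(2)[OF sform_pullback[OF F]] x, of ?v]
      by (simp, intro fun_cong[OF fderiv_cong_open[OF S x]]) (auto simp: pullback_def)
    also have "\<dots> = pullback \<phi> (extd 0 F) x v"
      unfolding D by (simp add: pullback_def extd_def dird_def)
    finally show "extd 0 (pullback \<phi> F) x v = pullback \<phi> (extd 0 F) x v" .
  qed
next
  case (Suc k)
  note F = Suc.prems(1)
  let ?G = "\<lambda>b y. contract (axis b 1) (F y)" and ?e = "\<lambda>b. pullback \<phi> (\<lambda>y. coord b)"
  have G: "sform T k (?G b)" for b
    using sform_iprod[OF F, of "axis b 1"] by simp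
  have W: "sform T (Suc k) (\<lambda>x. alt_wedge (Suc 0) k (coord b) (?G b x))" for b
    using sform_wedge[OF T sform_const[OF coord_alt_forms] G] by simp
  have W': "sform S (Suc k) (\<lambda>x. alt_wedge (Suc 0) k (?e b x) (pullback \<phi> (?G b) x))" for b
    using sform_wedge[OF S sform_pullback_coord sform_pullback[OF G]] by simp
  have dF: "extd (Suc k) F y = (\<lambda>v. inverse (Suc k) * (\<Sum>b\<in>UNIV. - alt_wedge (Suc 0) (Suc k) (coord b) (extd k (?G b) y) v))"
    if y: "y \<in> T" for y
  proof -
    have "extd (Suc k) F y = extd (Suc k) (\<lambda>x v. inverse (Suc k) * (\<Sum>b\<in>UNIV. alt_wedge (Suc 0) k (coord b) (?G b x) v)) y"
      by (rule extd_cong[OF T y euler_form F]) (rule sformD(1)[OF F])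
    also have "\<dots> = (\<lambda>v. inverse (Suc k) * (\<Sum>b\<in>UNIV. extd (Suc k) (\<lambda>x. alt_wedge (Suc 0) k (coord b) (?G b x)) y v))"
      by (simp add: extd_sform_scale[OF sform_sum[OF T W] y] extd_sform_sum[OF T W y])
    also have "(\<lambda>b. extd (Suc k) (\<lambda>x. alt_wedge (Suc 0) k (coord b) (?G b x)) y) =
        (\<lambda>b v. - alt_wedge (Suc 0) (Suc k) (coord b) (extd k (?G b) y) v)"
      using extd_wedge[OF T sform_const[OF coord_alt_forms] G y] by simp
    finally show ?thesis by meson
  qed
  have "extd (Suc k) (pullback \<phi> F) x = extd (Suc k) (\<lambda>x v. inverse (Suc k) * (\<Sum>b\<in>UNIV. alt_wedge (Suc 0) k (?e b x) (pullback \<phi> (?G b) x) v)) x"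
    by (rule extd_cong[OF S x pullback_euler[OF F] sform_pullback[OF F]])
  also have "\<dots> = (\<lambda>v. inverse (Suc k) * (\<Sum>b\<in>UNIV. extd (Suc k) (\<lambda>x. alt_wedge (Suc 0) k (?e b x) (pullback \<phi> (?G b) x)) x v))"
    by (simp add: extd_sform_scale[OF sform_sum[OF S W'] x] extd_sform_sum[OF S W' x])
  also have "(\<lambda>b. extd (Suc k) (\<lambda>x. alt_wedge (Suc 0) k (?e b x) (pullback \<phi> (?G b) x)) x) =
      (\<lambda>b v. - alt_wedge (Suc 0) (Suc k) (?e b x) (pullback \<phi> (extd k (?G b)) x) v)"
    using extd_wedge[OF S sform_pullback_coord sform_pullback[OF G] x] extd_pullback_coord[OF x] Suc.IH[OF G x]
    by simp
  also have "(\<lambda>b v. - alt_wedge (Suc 0) (Suc k) (?e b x) (pullback \<phi> (extd k (?G b)) x) v) =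
    (\<lambda>b v. - alt_wedge (Suc 0) (Suc k) (coord b) (extd k (?G b) (\<phi> x)) (\<lambda>i. frechet_derivative \<phi> (at x) (v i)))"
    unfolding pullback_def[abs_def] alt_wedge_pullback ..
  finally show ?case
    using dF[OF phi_in[OF x]] by (simp add: pullback_def[abs_def])
qed

end

section \<open>Smooth Lefschetz theory\<close>

lemma one_form_expand:
  fixes \<theta> :: "(nat \<Rightarrow> real^'d) \<Rightarrow> real"
  assumes "\<theta> \<in> alt_forms (Suc 0)"
  shows "\<theta> = (\<lambda>v. \<Sum>b\<in>UNIV. \<theta> (\<lambda>_. axis b 1) * coord b v)"
    and "\<theta> (\<lambda>_. X) = (\<Sum>b\<in>UNIV. \<theta> (\<lambda>_. axis b 1) * X $ b)"
proof -
  show 1: "\<theta> (\<lambda>_. X) = (\<Sum>b\<in>UNIV. \<theta> (\<lambda>_. axis b 1) * X $ b)" for X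
    using fun_cong[OF iprod_axis_sum[OF assms, of X], of undefined]
    by (simp add: contract_1_form[OF assms] mult.commute)
  show "\<theta> = (\<lambda>v. \<Sum>b\<in>UNIV. \<theta> (\<lambda>_. axis b 1) * coord b v)"
  proof
    fix v
    have "\<theta> v = \<theta> (\<lambda>_. v 0)" by (rule alt_forms_cong[OF assms]) simp
    then show "\<theta> v = (\<Sum>b\<in>UNIV. \<theta> (\<lambda>_. axis b 1) * coord b v)"
      using 1[of "v 0"] by (simp add: coord_def)
  qed
qed

context contact_point
begin

text \<open>The version of \<open>wedge_coord_iprod_sum\<close> for the coordinate vectors projected
  to the kernel of \<theta> along T. The difference of the two sums is \<theta>(T) \<rho> - \<theta>
  \<and> \<iota>_T \<rho>, which is \<iota>_T (\<theta> \<and> \<rho>) = 0. The projection matters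
  because \<open>wedge_th_step\<close> allows contraction only with vectors in the kernel.\<close>

lemma frame_identity:
  assumes r: "\<rho> \<in> alt_forms k" and thr: "alt_wedge (Suc 0) k \<theta> \<rho> = (\<lambda>v. 0)" and T: "\<theta> (\<lambda>_. T) = 1"
  shows "(\<lambda>v. \<Sum>b\<in>UNIV. contract (axis b 1 - \<theta> (\<lambda>_. axis b 1) *\<^sub>R T) (alt_wedge (Suc 0) k (coord b) \<rho>) v)
    = (\<lambda>v. (real CARD('d) - real k) * \<rho> v)"
proof
  fix v
  let ?t = "\<lambda>b. \<theta> (\<lambda>_. axis b 1)"
  have W: "alt_wedge (Suc 0) k (coord b) \<rho> \<in> alt_forms (Suc k)" for b
    using alt_wedge_alt_forms[OF coord_alt_forms r] by simp
  note lin = contract_linear[OF W]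
  have "(\<Sum>b\<in>UNIV. ?t b * contract T (alt_wedge (Suc 0) k (coord b) \<rho>) v) =
    (\<Sum>b\<in>UNIV. ?t b * T $ b) * \<rho> v - (\<Sum>b\<in>UNIV. ?t b * alt_wedge (Suc 0) (k - 1) (coord b) (iprod k T \<rho>) v)"
    by (simp add: iprod_wedge_1[OF coord_alt_forms r] coord_def right_diff_distrib sum_subtractf sum_distrib_right mult.assoc)
  also have "(\<Sum>b\<in>UNIV. ?t b * alt_wedge (Suc 0) (k - 1) (coord b) (iprod k T \<rho>) v) =
      alt_wedge (Suc 0) (k - 1) (\<lambda>v. \<Sum>b\<in>UNIV. ?t b * coord b v) (iprod k T \<rho>) v"
    by (simp add: alt_wedge_sum_left alt_wedge_scale_left)
  also have "\<dots> = alt_wedge (Suc 0) (k - 1) \<theta> (iprod k T \<rho>) v"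
    unfolding one_form_expand(1)[OF th, symmetric] ..
  also have "\<dots> = \<rho> v"
    using fun_cong[OF iprod_wedge_1[OF th r, of T, unfolded thr], of v] by (simp add: T)
  also have "(\<Sum>b\<in>UNIV. ?t b * T $ b) = 1"
    using one_form_expand(2)[OF th, of T] T by simp
  finally have "(\<Sum>b\<in>UNIV. ?t b * contract T (alt_wedge (Suc 0) k (coord b) \<rho>) v) = 0" by simp
  then show "(\<Sum>b\<in>UNIV. contract (axis b 1 - ?t b *\<^sub>R T) (alt_wedge (Suc 0) k (coord b) \<rho>) v) =
    (real CARD('d) - real k) * \<rho> v"
    using fun_cong[OF wedge_coord_iprod_sum[OF r], of v]
    by (simp add: linear_diff[OF lin] linear_scale[OF lin] sum_subtractf)
qed

text \<open>Contraction turns an element of the image of \<Omega>^(j+1) into an element of the image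
  of \<Omega>^j, with an explicit preimage: this is the recursion behind surjectivity.\<close>

lemma contract_lef_Suc:
  assumes f: "f \<in> alt_forms m" and m: "m \<noteq> 0"
  shows "contract X (lef (Suc j) m \<Omega> f) = lef j (Suc m) \<Omega>
    (\<lambda>v. alt_wedge 2 (m - 1) \<Omega> (iprod m X f) v + Suc j * alt_wedge (Suc 0) m (contract X \<Omega>) f v)"
proof -
  have m': "m - 1 + 2 = Suc m" using m by simp
  have "lef (Suc j) (m - 1) \<Omega> g = lef j (Suc m) \<Omega> (alt_wedge 2 (m - 1) \<Omega> g)" for g
    using lef_Suc'[of j "m - 1" \<Omega> g] unfolding m' .
  then show ?thesis
    unfolding contract_lef[OF om f] lef_add lef_scale lef_wedge_1[OF om f contract_om] by simp
qed

text \<open>The preimage from \<open>contract_lef_Suc\<close> stays among the forms killed by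
  \<theta>. For the summand with \<iota>_X f this relies on \<theta>(X) = 0.\<close>

lemma wedge_th_step:
  assumes f: "f \<in> alt_forms m" and m: "m \<noteq> 0" and thf: "alt_wedge (Suc 0) m \<theta> f = (\<lambda>v. 0)"
    and X: "\<theta> (\<lambda>_. X) = 0"
  shows "alt_wedge (Suc 0) (Suc m) \<theta>
    (\<lambda>v. alt_wedge 2 (m - 1) \<Omega> (iprod m X f) v + c * alt_wedge (Suc 0) m (contract X \<Omega>) f v) = (\<lambda>v. 0)"
proof -
  have i: "iprod m X f \<in> alt_forms (m - 1)" by (rule iprod_alt_forms[OF f])
  have "alt_wedge (Suc 0) (m - 1) \<theta> (iprod m X f) = (\<lambda>v. 0)"
    using iprod_wedge_1[OF th f, of X, unfolded thf] by (simp add: X fun_eq_iff)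
  then have 1: "alt_wedge (Suc 0) (Suc m) \<theta> (alt_wedge 2 (m - 1) \<Omega> (iprod m X f)) = (\<lambda>v. 0)"
    using alt_wedge_exchange[OF th om i] m by simp
  have 2: "alt_wedge (Suc 0) (Suc m) \<theta> (alt_wedge (Suc 0) m (contract X \<Omega>) f) = (\<lambda>v. 0)"
    using alt_wedge_exchange[OF th contract_om f, of X] thf by simp
  show ?thesis unfolding alt_wedge_add_right alt_wedge_scale_right 1 2 by simp
qed

end

locale contact_open =
  fixes S :: "(real^'d) set" and \<theta> \<Omega> :: "real^'d \<Rightarrow> (nat \<Rightarrow> real^'d) \<Rightarrow> real" and n :: nat
  assumes S: "open S" and th_form: "sform S (Suc 0) \<theta>" and om_form: "sform S 2 \<Omega>"
    and pt: "\<And>x. x \<in> S \<Longrightarrow> contact_point (\<theta> x) (\<Omega> x) n"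
    and dim: "CARD('d) = 2 * n + 1"
begin

text \<open>The Euclidean dual of \<theta> divided by its squared norm. Unlike the Reeb field it is
  given by a formula that is visibly smooth, and only its property \<theta>(T) = 1 matters.\<close>

definition transversal :: "real^'d \<Rightarrow> real^'d" where
  "transversal x = (\<chi> b. \<theta> x (\<lambda>_. axis b 1) / (\<Sum>b\<in>UNIV. \<theta> x (\<lambda>_. axis b 1) ^ 2))"

lemma norm_th_nonzero: "x \<in> S \<Longrightarrow> (\<Sum>b\<in>UNIV. \<theta> x (\<lambda>_. axis b 1) ^ 2) \<noteq> 0"
proof
  assume x: "x \<in> S" and "(\<Sum>b\<in>UNIV. \<theta> x (\<lambda>_. axis b 1) ^ 2) = 0"
  then have "\<theta> x (\<lambda>_. axis b 1) = 0" for b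
    by (subst (asm) sum_nonneg_eq_0_iff) auto
  then have "\<theta> x (\<lambda>_. X) = 0" for X
    using one_form_expand(2)[OF sformD(1)[OF th_form x], of X] by simp
  then show False using contact_point.nz[OF pt[OF x]] by simp
qed

lemma th_transversal: "x \<in> S \<Longrightarrow> \<theta> x (\<lambda>_. transversal x) = 1"
  using norm_th_nonzero
  by (subst one_form_expand(2)[OF sformD(1)[OF th_form]])
    (simp_all add: transversal_def power2_eq_square flip: sum_divide_distrib)

lemma smooth_transversal: "smooth_on S (\<lambda>x. transversal x $ b)"
  unfolding transversal_def vec_lambda_beta
  by (intro smooth_on_divide S smooth_on_sum smooth_on_power sformD(2)[OF th_form] norm_th_nonzero)

text \<open>The coordinate fields projected to the kernel of \<theta>. These 2n + 1 fields span a
  distribution of rank 2n; the redundancy spares the choice of a basis.\<close>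

definition hframe :: "'d \<Rightarrow> real^'d \<Rightarrow> real^'d" where
  "hframe b x = axis b 1 - \<theta> x (\<lambda>_. axis b 1) *\<^sub>R transversal x"

lemma smooth_hframe: "smooth_on S (\<lambda>x. hframe b x $ c)"
  unfolding hframe_def vector_minus_component vector_scaleR_component
  by (intro smooth_on_diff smooth_on_scaleR S smooth_on_const sformD(2)[OF th_form] smooth_transversal)

lemma th_hframe:
  assumes x: "x \<in> S" shows "\<theta> x (\<lambda>_. hframe b x) = 0"
  using linear_diff[OF contact_point.linear_th[OF pt[OF x]]] linear_scale[OF contact_point.linear_th[OF pt[OF x]]]
  by (simp add: hframe_def th_transversal[OF x])

text \<open>In degree 2n + 1 every form is a multiple f of the volume form \<theta> \<and>
  \<Omega>^n, so \<mu> = f \<theta> works. The factor f is a quotient of values at one fixed ordered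
  basis and hence smooth.\<close>

lemma lef_surjective_top:
  assumes r: "sform S (2 * n + 1) \<rho>"
  shows "\<exists>\<mu>. sform S (Suc 0) \<mu> \<and> (\<forall>x\<in>S. alt_wedge (Suc 0) (Suc 0) (\<theta> x) (\<mu> x) = (\<lambda>v. 0) \<and>
    lef n (Suc 0) (\<Omega> x) (\<mu> x) = \<rho> x)"
proof -
  obtain B where B: "bij_betw B {..<CARD('d)} (UNIV :: 'd set)"
    using ex_bij_betw_nat_finite[of "UNIV :: 'd set"] by (auto simp: lessThan_atLeast0)
  let ?b = "\<lambda>i. axis (B i) (1::real)"
  let ?V = "\<lambda>x. lef n (Suc 0) (\<Omega> x) (\<theta> x)"
  have V: "sform S (2 * n + 1) ?V" using sform_lef[OF S om_form th_form, of n] by simp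
  have nz: "?V x ?b \<noteq> 0" if x: "x \<in> S" for x
    using contact_point.volume_nonzero[OF pt[OF x], of n] sformD(1)[OF V x]
      alt_form_top_eq0[OF _ B, of "?V x"] dim by auto
  define f where "f x = \<rho> x ?b / ?V x ?b" for x
  have f: "smooth_on S f"
    unfolding f_def by (intro smooth_on_divide S sformD(2)[OF r] sformD(2)[OF V] nz)
  have eq: "\<rho> x = (\<lambda>v. f x * ?V x v)" if x: "x \<in> S" for x
  proof -
    have "(\<lambda>v. \<rho> x v - f x * ?V x v) \<in> alt_forms CARD('d)"
      using sformD(1)[OF r x] sformD(1)[OF V x] dim by (auto intro: alt_forms_diff alt_forms_scale)
    from alt_form_top_eq0[OF this B] have "(\<lambda>v. \<rho> x v - f x * ?V x v) = (\<lambda>v. 0)"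
      using nz[OF x] by (simp add: f_def)
    then show ?thesis by (simp add: fun_eq_iff)
  qed
  show ?thesis
  proof (intro exI conjI ballI)
    show "sform S (Suc 0) (\<lambda>x v. f x * \<theta> x v)" by (rule sform_smooth_scale[OF S f th_form])
    fix x assume x: "x \<in> S"
    show "alt_wedge (Suc 0) (Suc 0) (\<theta> x) (\<lambda>v. f x * \<theta> x v) = (\<lambda>v. 0)"
      unfolding alt_wedge_scale_right alt_wedge_1_1_self[OF sformD(1)[OF th_form x]] by simp
    show "lef n (Suc 0) (\<Omega> x) (\<lambda>v. f x * \<theta> x v) = \<rho> x"
      unfolding lef_scale using eq[OF x] by simp
  qed
qed

text \<open>Downward induction on \<open>j\<close>: write \<open>\<rho>\<close> as a combination of contractions of the forms
  \<open>coord b \<and> \<rho>\<close> and apply the induction hypothesis to these.\<close>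

lemma lef_surjective_le:
  assumes "j \<le> n" "sform S (n + 1 + j) \<rho>" "\<And>x. x \<in> S \<Longrightarrow> alt_wedge (Suc 0) (n + 1 + j) (\<theta> x) (\<rho> x) = (\<lambda>v. 0)"
  shows "\<exists>\<mu>. sform S (n + 1 - j) \<mu> \<and> (\<forall>x\<in>S. alt_wedge (Suc 0) (n + 1 - j) (\<theta> x) (\<mu> x) = (\<lambda>v. 0) \<and>
    lef j (n + 1 - j) (\<Omega> x) (\<mu> x) = \<rho> x)"
  using assms
proof (induction arbitrary: \<rho> rule: inc_induct)
  case base
  then show ?case using lef_surjective_top[of \<rho>] by (simp add: mult_2)
next
  case (step j)
  note r = step.prems(1) and thr = step.prems(2)
  define m where "m = n - j"
  have m: "m \<noteq> 0" "n + 1 - Suc j = m" "n + 1 - j = Suc m" "m - 1 + 2 = Suc m" using step.hyps by (auto simp: m_def)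
  let ?q = "n + 1 + j"
  have W: "sform S (n + 1 + Suc j) (\<lambda>x. alt_wedge (Suc 0) ?q (coord b) (\<rho> x))" for b
    using sform_wedge[OF S sform_const[OF coord_alt_forms] r, of b] by simp
  have thW: "alt_wedge (Suc 0) (n + 1 + Suc j) (\<theta> x) (alt_wedge (Suc 0) ?q (coord b) (\<rho> x)) = (\<lambda>v. 0)"
    if x: "x \<in> S" for x b
    using alt_wedge_exchange[OF sformD(1)[OF th_form x] coord_alt_forms sformD(1)[OF r x], of b] thr[OF x] by simp
  have "\<exists>\<mu>. sform S m \<mu> \<and> (\<forall>x\<in>S. alt_wedge (Suc 0) m (\<theta> x) (\<mu> x) = (\<lambda>v. 0) \<and>
    lef (Suc j) m (\<Omega> x) (\<mu> x) = alt_wedge (Suc 0) ?q (coord b) (\<rho> x))" for b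
    using step.IH[OF W thW, of b] unfolding m(2) .
  then obtain a where a: "\<And>b. sform S m (a b)"
    and tha: "\<And>b x. x \<in> S \<Longrightarrow> alt_wedge (Suc 0) m (\<theta> x) (a b x) = (\<lambda>v. 0)"
    and lefa: "\<And>b x. x \<in> S \<Longrightarrow> lef (Suc j) m (\<Omega> x) (a b x) = alt_wedge (Suc 0) ?q (coord b) (\<rho> x)"
    by metis
  \<comment> \<open>This is the form whose image under \<Omega>^j is, by
    \<open>contract_lef_Suc\<close>, the contraction of dx_b \<and> \<rho> with the b-th frame
    field.\<close>
  define \<nu> where "\<nu> b x v = alt_wedge 2 (m - 1) (\<Omega> x) (iprod m (hframe b x) (a b x)) v +
    Suc j * alt_wedge (Suc 0) m (contract (hframe b x) (\<Omega> x)) (a b x) v" for b x v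
  have nu: "sform S (Suc m) (\<nu> b)" for b
  proof -
    have "sform S (Suc m) (\<lambda>x. alt_wedge 2 (m - 1) (\<Omega> x) (iprod m (hframe b x) (a b x)))"
      using sform_wedge[OF S om_form sform_iprod_field[OF S a[of b] smooth_hframe[of b]]] m(4)
      by (simp add: add.commute)
    moreover have "sform S (Suc m) (\<lambda>x. alt_wedge (Suc 0) m (contract (hframe b x) (\<Omega> x)) (a b x))"
    proof -
      have "sform S (Suc 0) (\<lambda>x. contract (hframe b x) (\<Omega> x))"
        using sform_iprod_field[OF S om_form smooth_hframe[of b]] by (simp add: numeral_2_eq_2)
      from sform_wedge[OF S this a[of b]] show ?thesis by simp
    qed
    ultimately show ?thesis unfolding \<nu>_def[abs_def] by (intro sform_add sform_scale S)
  qed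
  \<comment> \<open>The factor in \<open>frame_identity\<close> is (2n + 1) - (n + 1 + j) = n - j,
    nonzero since j < n in the induction step.\<close>
  define c where "c = 1 / (real CARD('d) - real ?q)"
  have c: "c * (real CARD('d) - real ?q) = 1"
  proof -
    have "real CARD('d) - real ?q \<noteq> 0" using step.hyps dim by simp
    then show ?thesis by (simp add: c_def)
  qed
  show ?case unfolding m(3)
  proof (intro exI conjI ballI)
    show "sform S (Suc m) (\<lambda>x v. c * (\<Sum>b\<in>UNIV. \<nu> b x v))"
      by (intro sform_scale sform_sum S nu)
    fix x assume x: "x \<in> S"
    interpret contact_point "\<theta> x" "\<Omega> x" n by (rule pt[OF x])
    have "alt_wedge (Suc 0) (Suc m) (\<theta> x) (\<nu> b x) = (\<lambda>v. 0)" for b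
      unfolding \<nu>_def by (rule wedge_th_step[OF sformD(1)[OF a x] m(1) tha[OF x] th_hframe[OF x]])
    then show "alt_wedge (Suc 0) (Suc m) (\<theta> x) (\<lambda>v. c * (\<Sum>b\<in>UNIV. \<nu> b x v)) = (\<lambda>v. 0)"
      by (simp add: alt_wedge_scale_right alt_wedge_sum_right)
    have L: "lef j (Suc m) (\<Omega> x) (\<nu> b x) = contract (hframe b x) (alt_wedge (Suc 0) ?q (coord b) (\<rho> x))" for b
      unfolding \<nu>_def contract_lef_Suc[OF sformD(1)[OF a x] m(1), symmetric] lefa[OF x] ..
    have "(\<lambda>v. \<Sum>b\<in>UNIV. contract (hframe b x) (alt_wedge (Suc 0) ?q (coord b) (\<rho> x)) v) =
        (\<lambda>v. (real CARD('d) - real ?q) * \<rho> x v)"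
      unfolding hframe_def
      by (rule frame_identity[OF sformD(1)[OF r x] thr[OF x] th_transversal[OF x]])
    then show "lef j (Suc m) (\<Omega> x) (\<lambda>v. c * (\<Sum>b\<in>UNIV. \<nu> b x v)) = \<rho> x"
      using c by (simp add: lef_scale lef_sum L flip: mult.assoc)
  qed
qed

lemma lef_surjective:
  assumes j: "j \<le> n + 1" and r: "sform S (n + 1 + j) \<rho>"
    and thr: "\<And>x. x \<in> S \<Longrightarrow> alt_wedge (Suc 0) (n + 1 + j) (\<theta> x) (\<rho> x) = (\<lambda>v. 0)"
  obtains \<mu> where "sform S (n + 1 - j) \<mu>"
    "\<And>x. x \<in> S \<Longrightarrow> alt_wedge (Suc 0) (n + 1 - j) (\<theta> x) (\<mu> x) = (\<lambda>v. 0)"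
    "\<And>x. x \<in> S \<Longrightarrow> lef j (n + 1 - j) (\<Omega> x) (\<mu> x) = \<rho> x"
proof (cases "j \<le> n")
  case True
  then show ?thesis using lef_surjective_le[OF True r thr] that by blast
next
  case False
  \<comment> \<open>The remaining case j = n + 1 has target degree 2n + 2, above the dimension. It
    occurs when correcting forms of degree 1 and of degree 2n + 1.\<close>
  then have "\<rho> x = (\<lambda>v. 0)" if "x \<in> S" for x
    using alt_form_eq0_above_dim[OF sformD(1)[OF r that]] dim j by simp
  then show ?thesis by (intro that[of "\<lambda>x v. 0"]) simp_all
qed

end

section \<open>Forms on manifolds\<close>

locale smooth_mfd =
  fixes A :: "('m::topological_space, 'd::finite) chart set"
  assumes atlas: "smooth_atlas A"
begin

definition img :: "('m, 'd) chart \<Rightarrow> 'm set \<Rightarrow> (real^'d) set" where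
  "img c U = snd c ` (dom_of c \<inter> U)"

lemma chart:
  assumes "c \<in> A"
  shows open_dom: "open (dom_of c)" and open_img_dom: "open (snd c ` dom_of c)"
    and chart_homeomorphism: "homeomorphism (dom_of c) (snd c ` dom_of c) (snd c) (chart_inv c)"
  using atlas assms unfolding smooth_atlas_def by auto

lemma chart_inv [simp]: "c \<in> A \<Longrightarrow> p \<in> dom_of c \<Longrightarrow> chart_inv c (snd c p) = p"
  using chart_homeomorphism unfolding homeomorphism_def by blast

lemma chart_at: obtains c where "c \<in> A" "p \<in> dom_of c"
  using atlas unfolding smooth_atlas_def by blast

lemma imgI: "p \<in> dom_of c \<Longrightarrow> p \<in> U \<Longrightarrow> snd c p \<in> img c U"
  by (simp add: img_def)

lemma imgE:
  assumes "c \<in> A" "x \<in> img c U"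
  obtains p where "p \<in> dom_of c" "p \<in> U" "x = snd c p"
  using assms by (auto simp: img_def)

lemma open_img:
  assumes c: "c \<in> A" and U: "open U" shows "open (img c U)"
proof -
  have "openin (top_of_set (dom_of c)) (dom_of c \<inter> U)" using U by (simp add: openin_open_Int)
  from homeomorphism_imp_open_map[OF chart_homeomorphism[OF c] this]
  show ?thesis unfolding img_def using openin_open_trans open_img_dom[OF c] by blast
qed

lemma img_mono: "U \<subseteq> V \<Longrightarrow> img c U \<subseteq> img c V"
  by (auto simp: img_def)

definition loc :: "('m, 'd) form \<Rightarrow> ('m, 'd) chart \<Rightarrow> real^'d \<Rightarrow> (nat \<Rightarrow> real^'d) \<Rightarrow> real" where
  "loc \<omega> c x = \<omega> c (chart_inv c x)"

lemma loc_chart [simp]: "c \<in> A \<Longrightarrow> p \<in> dom_of c \<Longrightarrow> loc \<omega> c (snd c p) = \<omega> c p"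
  by (simp add: loc_def)

lemma transition_chart: "c \<in> A \<Longrightarrow> p \<in> dom_of c \<Longrightarrow> transition c c' (snd c p) = snd c' p"
  by (simp add: transition_def)

lemma smooth_transition:
  assumes "c \<in> A" "c' \<in> A" shows "smooth_on (img c (dom_of c' \<inter> U)) (transition c c')"
proof -
  have "smooth_on (snd c ` (dom_of c \<inter> dom_of c')) (transition c c')"
    using atlas assms unfolding smooth_atlas_def by blast
  then show ?thesis by (rule smooth_on_subset) (auto simp: img_def)
qed

lemma transition_img:
  assumes "c \<in> A" shows "transition c c' ` img c (dom_of c' \<inter> U) \<subseteq> img c' (dom_of c \<inter> U)"
  using assms by (auto elim!: imgE[OF assms] simp: transition_chart intro!: imgI)

lemma jacobian_has_derivative:
  assumes "c \<in> A" "c' \<in> A" "p \<in> dom_of c" "p \<in> dom_of c'"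
  shows "(transition c c' has_derivative jacobian c c' p) (at (snd c p))"
  unfolding jacobian_def
  using assms by (intro smooth_on_has_derivative[OF smooth_transition[of c c' UNIV]] imgI) auto

lemma linear_jacobian:
  assumes "c \<in> A" "c' \<in> A" "p \<in> dom_of c" "p \<in> dom_of c'"
  shows "linear (jacobian c c' p)"
  using jacobian_has_derivative[OF assms] has_derivative_linear by blast

lemma jacobian_self:
  assumes c: "c \<in> A" and p: "p \<in> dom_of c"
  shows "jacobian c c p = (\<lambda>v. v)"
proof -
  have "(transition c c has_derivative (\<lambda>v. v)) (at (snd c p))"
  proof (rule has_derivative_transform_within_open[of "\<lambda>x. x"])
    show "open (img c UNIV)" by (rule open_img[OF c]) simp
    show "x = transition c c x" if "x \<in> img c UNIV" for x
      using that c by (auto elim!: imgE[OF c] simp: transition_chart)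
  qed (use p in \<open>auto intro: imgI\<close>)
  then show ?thesis using jacobian_has_derivative[OF c c p p] has_derivative_unique by blast
qed

lemma jacobian_cocycle:
  assumes c: "c \<in> A" "c' \<in> A" "c'' \<in> A" and p: "p \<in> dom_of c" "p \<in> dom_of c'" "p \<in> dom_of c''"
  shows "jacobian c c'' p v = jacobian c' c'' p (jacobian c c' p v)"
proof -
  have "((\<lambda>x. transition c' c'' (transition c c' x)) has_derivative
      (\<lambda>v. jacobian c' c'' p (jacobian c c' p v))) (at (snd c p))"
    using has_derivative_compose[OF jacobian_has_derivative[OF c(1,2) p(1,2)], of "transition c' c''"]
      jacobian_has_derivative[OF c(2,3) p(2,3)] by (simp add: transition_chart[OF c(1) p(1)])
  then have "(transition c c'' has_derivative (\<lambda>v. jacobian c' c'' p (jacobian c c' p v))) (at (snd c p))"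
  proof (rule has_derivative_transform_within_open)
    show "open (img c (dom_of c'))" by (rule open_img[OF c(1) open_dom[OF c(2)]])
    show "transition c' c'' (transition c c' x) = transition c c'' x" if "x \<in> img c (dom_of c')" for x
      using that c by (auto elim!: imgE[OF c(1)] simp: transition_chart)
  qed (use p in \<open>auto intro: imgI\<close>)
  then show ?thesis using jacobian_has_derivative[OF c(1,3) p(1,3)] has_derivative_unique by metis
qed

lemma forms_alt: "\<omega> \<in> forms A U k \<Longrightarrow> c \<in> A \<Longrightarrow> p \<in> dom_of c \<Longrightarrow> p \<in> U \<Longrightarrow> \<omega> c p \<in> alt_forms k"
  unfolding forms_def mem_Collect_eq by (metis IntI)

lemma forms_outside: "\<omega> \<in> forms A U k \<Longrightarrow> \<not> (c \<in> A \<and> p \<in> dom_of c \<and> p \<in> U) \<Longrightarrow> \<omega> c p = (\<lambda>v. 0)"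
  unfolding forms_def mem_Collect_eq by (metis IntD1 IntD2)

lemma forms_compat:
  assumes "\<omega> \<in> forms A U k" "c \<in> A" "c' \<in> A" "p \<in> dom_of c" "p \<in> dom_of c'" "p \<in> U"
  shows "\<omega> c p = (\<lambda>v. \<omega> c' p (\<lambda>i. jacobian c c' p (v i)))"
proof -
  have "\<forall>c\<in>A. \<forall>c'\<in>A. \<forall>p \<in> dom_of c \<inter> dom_of c' \<inter> U. \<forall>v.
      \<omega> c p v = \<omega> c' p (\<lambda>i. jacobian c c' p (v i))"
    using assms(1) unfolding forms_def mem_Collect_eq by (elim conjE)
  from this[rule_format, OF assms(2,3)] show ?thesis using assms by (intro ext) blast
qed

lemma sform_loc:
  assumes "\<omega> \<in> forms A U k" "c \<in> A" shows "sform (img c U) k (loc \<omega> c)"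
proof (rule sformI)
  show "loc \<omega> c x \<in> alt_forms k" if "x \<in> img c U" for x
    using imgE[OF assms(2) that] forms_alt[OF assms] assms(2) by (metis loc_chart)
  show "smooth_on (img c U) (\<lambda>x. loc \<omega> c x v)" for v
    using assms unfolding forms_def loc_def img_def by blast
qed

lemma formsI:
  assumes "\<And>c. c \<in> A \<Longrightarrow> sform (img c U) k (loc \<omega> c)"
    and "\<And>c p. \<not> (c \<in> A \<and> p \<in> dom_of c \<and> p \<in> U) \<Longrightarrow> \<omega> c p = (\<lambda>v. 0)"
    and "\<And>c c' p v. c \<in> A \<Longrightarrow> c' \<in> A \<Longrightarrow> p \<in> dom_of c \<Longrightarrow> p \<in> dom_of c' \<Longrightarrow> p \<in> U \<Longrightarrow>
      \<omega> c p v = \<omega> c' p (\<lambda>i. jacobian c c' p (v i))"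
  shows "\<omega> \<in> forms A U k"
  unfolding forms_def mem_Collect_eq
proof (intro conjI allI ballI)
  show "if c \<in> A \<and> p \<in> dom_of c \<inter> U then \<omega> c p \<in> alt_forms k else \<omega> c p = (\<lambda>v. 0)" for c p
    using assms(2)[of c p] sformD(1)[OF assms(1), of c "snd c p"] imgI[of p c U] by auto
  show "smooth_on (snd c ` (dom_of c \<inter> U)) (\<lambda>x. \<omega> c (chart_inv c x) v)" if "c \<in> A" for c v
    using sformD(2)[OF assms(1)[OF that], of v] by (simp add: loc_def img_def)
qed (use assms(3) in blast)

lemma loc_pullback:
  assumes w: "\<omega> \<in> forms A U k" and c: "c \<in> A" "c' \<in> A" and x: "x \<in> img c (dom_of c' \<inter> U)"
  shows "loc \<omega> c x = pullback (transition c c') (loc \<omega> c') x"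
proof -
  obtain p where p: "p \<in> dom_of c" "p \<in> dom_of c'" "p \<in> U" "x = snd c p"
    using imgE[OF c(1) x] by blast
  then show ?thesis
    using forms_compat[OF w c p(1-3)] c
    by (simp add: pullback_def[abs_def] transition_chart jacobian_def)
qed

lemma ext_deriv_eq:
  "c \<in> A \<Longrightarrow> p \<in> dom_of c \<Longrightarrow> p \<in> U \<Longrightarrow> ext_deriv A U k \<omega> c p = extd k (loc \<omega> c) (snd c p)"
  by (simp add: ext_deriv_def extd_def loc_def fun_eq_iff)

lemma ext_deriv_outside: "\<not> (c \<in> A \<and> p \<in> dom_of c \<and> p \<in> U) \<Longrightarrow> ext_deriv A U k \<omega> c p = (\<lambda>v. 0)"
  by (auto simp: ext_deriv_def fun_eq_iff)

lemma loc_ext_deriv: "c \<in> A \<Longrightarrow> x \<in> img c U \<Longrightarrow> loc (ext_deriv A U k \<omega>) c x = extd k (loc \<omega> c) x"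
  by (metis ext_deriv_eq imgE loc_chart)

text \<open>Compatibility of the local derivatives is naturality of d under the transition maps,
  whose pullback relates the local representatives.\<close>

lemma ext_deriv_forms:
  assumes w: "\<omega> \<in> forms A U k" and U: "open U"
  shows "ext_deriv A U k \<omega> \<in> forms A U (Suc k)"
proof (rule formsI)
  show "sform (img c U) (Suc k) (loc (ext_deriv A U k \<omega>) c)" if c: "c \<in> A" for c
    using sform_cong[OF open_img[OF c U] _ sform_extd[OF open_img[OF c U] sform_loc[OF w c]]]
      loc_ext_deriv[OF c] by metis
  fix c c' p v assume c: "c \<in> A" "c' \<in> A" and p: "p \<in> dom_of c" "p \<in> dom_of c'" "p \<in> U"
  let ?S = "img c (dom_of c' \<inter> U)" and ?T = "img c' (dom_of c \<inter> U)"
  have S: "open ?S" "open ?T" using c U by (auto intro!: open_img open_Int open_dom)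
  have x: "snd c p \<in> ?S" using p by (auto intro: imgI)
  have l: "sform ?S k (loc \<omega> c)" "sform ?T k (loc \<omega> c')"
    using sform_subset[OF sform_loc[OF w c(1)] img_mono] sform_subset[OF sform_loc[OF w c(2)] img_mono] by blast+
  have "extd k (loc \<omega> c) (snd c p) = extd k (pullback (transition c c') (loc \<omega> c')) (snd c p)"
    by (rule extd_cong[OF S(1) x loc_pullback[OF w c] l(1)])
  also have "\<dots> = pullback (transition c c') (extd k (loc \<omega> c')) (snd c p)"
    by (rule extd_pullback[OF S smooth_transition[OF c] transition_img[OF c(1)] l(2) x])
  finally show "ext_deriv A U k \<omega> c p v = ext_deriv A U k \<omega> c' p (\<lambda>i. jacobian c c' p (v i))"
    using c p by (simp add: ext_deriv_eq pullback_def transition_chart jacobian_def)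
qed (rule ext_deriv_outside)

lemma loc_zero_form: "loc zero_form c = (\<lambda>x v. 0)"
  by (simp add: loc_def[abs_def] zero_form_def)

lemma zero_form_forms [simp]: "zero_form \<in> forms A U k"
  by (rule formsI) (simp_all add: loc_zero_form, simp_all add: zero_form_def)

lemma form_add_forms:
  assumes w: "\<omega> \<in> forms A U k" "\<eta> \<in> forms A U k" and U: "open U"
  shows "form_add \<omega> \<eta> \<in> forms A U k"
proof (rule formsI)
  show "sform (img c U) k (loc (form_add \<omega> \<eta>) c)" if c: "c \<in> A" for c
    using sform_add[OF open_img[OF c U] sform_loc[OF w(1) c] sform_loc[OF w(2) c]]
    by (simp add: loc_def[abs_def] form_add_def)
  show "form_add \<omega> \<eta> c p = (\<lambda>v. 0)" if "\<not> (c \<in> A \<and> p \<in> dom_of c \<and> p \<in> U)" for c p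
    using forms_outside[OF w(1) that] forms_outside[OF w(2) that] by (simp add: form_add_def)
  show "form_add \<omega> \<eta> c p v = form_add \<omega> \<eta> c' p (\<lambda>i. jacobian c c' p (v i))"
    if "c \<in> A" "c' \<in> A" "p \<in> dom_of c" "p \<in> dom_of c'" "p \<in> U" for c c' p v
    unfolding form_add_def forms_compat[OF w(1) that] forms_compat[OF w(2) that] ..
qed

lemma form_scale_forms:
  assumes w: "\<omega> \<in> forms A U k" and U: "open U"
  shows "form_scale r \<omega> \<in> forms A U k"
proof (rule formsI)
  show "sform (img c U) k (loc (form_scale r \<omega>) c)" if c: "c \<in> A" for c
    using sform_scale[OF open_img[OF c U] sform_loc[OF w c]]
    by (simp add: loc_def[abs_def] form_scale_def)
  show "form_scale r \<omega> c p = (\<lambda>v. 0)" if "\<not> (c \<in> A \<and> p \<in> dom_of c \<and> p \<in> U)" for c p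
    using forms_outside[OF w that] by (simp add: form_scale_def)
  show "form_scale r \<omega> c p v = form_scale r \<omega> c' p (\<lambda>i. jacobian c c' p (v i))"
    if "c \<in> A" "c' \<in> A" "p \<in> dom_of c" "p \<in> dom_of c'" "p \<in> U" for c c' p v
    unfolding form_scale_def forms_compat[OF w that] ..
qed

lemma ext_deriv_add:
  assumes w: "\<omega> \<in> forms A U k" "\<eta> \<in> forms A U k"
  shows "ext_deriv A U k (form_add \<omega> \<eta>) = form_add (ext_deriv A U k \<omega>) (ext_deriv A U k \<eta>)"
proof (intro ext)
  fix c p v
  show "ext_deriv A U k (form_add \<omega> \<eta>) c p v = form_add (ext_deriv A U k \<omega>) (ext_deriv A U k \<eta>) c p v"
  proof (cases "c \<in> A \<and> p \<in> dom_of c \<and> p \<in> U")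
    case True
    then have c: "c \<in> A" and p: "p \<in> dom_of c" "p \<in> U" by auto
    have "loc (form_add \<omega> \<eta>) c = (\<lambda>x v. loc \<omega> c x v + loc \<eta> c x v)"
      by (simp add: loc_def[abs_def] form_add_def)
    then show ?thesis
      using extd_sform_add[OF sform_loc[OF w(1) c] sform_loc[OF w(2) c] imgI[OF p]] c p
      by (simp add: ext_deriv_eq form_add_def)
  qed (simp add: ext_deriv_outside form_add_def)
qed

lemma ext_deriv_scale:
  assumes w: "\<omega> \<in> forms A U k"
  shows "ext_deriv A U k (form_scale r \<omega>) = form_scale r (ext_deriv A U k \<omega>)"
proof (intro ext)
  fix c p v
  show "ext_deriv A U k (form_scale r \<omega>) c p v = form_scale r (ext_deriv A U k \<omega>) c p v"
  proof (cases "c \<in> A \<and> p \<in> dom_of c \<and> p \<in> U")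
    case True
    then have c: "c \<in> A" and p: "p \<in> dom_of c" "p \<in> U" by auto
    have "loc (form_scale r \<omega>) c = (\<lambda>x v. r * loc \<omega> c x v)"
      by (simp add: loc_def[abs_def] form_scale_def)
    then show ?thesis
      using extd_sform_scale[OF sform_loc[OF w c] imgI[OF p]] c p
      by (simp add: ext_deriv_eq form_scale_def)
  qed (simp add: ext_deriv_outside form_scale_def)
qed

lemma ext_deriv_ext_deriv:
  assumes w: "\<omega> \<in> forms A U k" and U: "open U"
  shows "ext_deriv A U (Suc k) (ext_deriv A U k \<omega>) = zero_form"
proof (intro ext)
  fix c p v
  show "ext_deriv A U (Suc k) (ext_deriv A U k \<omega>) c p v = zero_form c p v"
  proof (cases "c \<in> A \<and> p \<in> dom_of c \<and> p \<in> U")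
    case True
    then have c: "c \<in> A" and p: "p \<in> dom_of c" "p \<in> U" by auto
    note S = open_img[OF c U] and x = imgI[OF p] and l = sform_loc[OF w c]
    have "extd (Suc k) (loc (ext_deriv A U k \<omega>) c) (snd c p) = extd (Suc k) (extd k (loc \<omega> c)) (snd c p)"
      by (rule extd_cong[OF S x loc_ext_deriv[OF c] sform_loc[OF ext_deriv_forms[OF w U] c]])
    then show ?thesis using extd_extd[OF S l x] c p by (simp add: ext_deriv_eq zero_form_def)
  qed (simp add: ext_deriv_outside zero_form_def)
qed

lemma ext_deriv_zero [simp]: "ext_deriv A U k zero_form = zero_form"
proof (intro ext)
  fix c p v
  show "ext_deriv A U k zero_form c p v = zero_form c p v"
    by (cases "c \<in> A \<and> p \<in> dom_of c \<and> p \<in> U") (simp_all add: ext_deriv_eq loc_zero_form, simp_all add: ext_deriv_outside zero_form_def)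
qed

text \<open>A form given in a single chart determines its representatives in all others; the cocycle
  rule for the Jacobians makes them compatible.\<close>

lemma transport_forms:
  assumes c: "c \<in> A" and V: "open V" "V \<subseteq> dom_of c" and F: "sform (img c V) k F"
  shows "(\<lambda>c' p v. if c' \<in> A \<and> p \<in> dom_of c' \<and> p \<in> V
      then F (snd c p) (\<lambda>i. jacobian c' c p (v i)) else 0) \<in> forms A V k" (is "?w \<in> _")
proof (rule formsI)
  fix c' assume c': "c' \<in> A"
  have VV: "dom_of c \<inter> V = V" using V(2) by blast
  show "sform (img c' V) k (loc ?w c')"
  proof (rule sform_cong[OF open_img[OF c' V(1)]])
    have ST: "transition c' c ` img c' V \<subseteq> img c V"
      using transition_img[OF c', of c V] img_mono[of "dom_of c' \<inter> V" V c] unfolding VV by blast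
    have sm: "smooth_on (img c' V) (transition c' c)" using smooth_transition[OF c' c, of V] unfolding VV .
    show "sform (img c' V) k (pullback (transition c' c) F)"
      by (rule sform_pullback[OF open_img[OF c' V(1)] open_img[OF c V(1)] sm ST F])
    show "pullback (transition c' c) F x = loc ?w c' x" if x: "x \<in> img c' V" for x
    proof -
      obtain p where "p \<in> dom_of c'" "p \<in> V" "x = snd c' p" using imgE[OF c' x] by blast
      then show ?thesis using c' by (simp add: pullback_def[abs_def] transition_chart jacobian_def)
    qed
  qed
next
  fix c1 c2 p v assume "c1 \<in> A" "c2 \<in> A" "p \<in> dom_of c1" "p \<in> dom_of c2" "p \<in> V"
  then show "?w c1 p v = ?w c2 p (\<lambda>i. jacobian c1 c2 p (v i))"
    using jacobian_cocycle[of c1 c2 c p] c V(2) by auto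
qed auto

end

section \<open>Contact forms of a CR manifold\<close>

lemma Re_vec_add: "Re_vec (Z + W) = Re_vec Z + Re_vec W"
  and Im_vec_add: "Im_vec (Z + W) = Im_vec Z + Im_vec W"
  and Re_vec_diff: "Re_vec (Z - W) = Re_vec Z - Re_vec W"
  and Im_vec_diff: "Im_vec (Z - W) = Im_vec Z - Im_vec W"
  and Re_vec_smult: "Re_vec (a *s Z) = Re a *\<^sub>R Re_vec Z - Im a *\<^sub>R Im_vec Z"
  and Im_vec_smult: "Im_vec (a *s Z) = Re a *\<^sub>R Im_vec Z + Im a *\<^sub>R Re_vec Z"
  and Re_vec_scaleR: "Re_vec (r *\<^sub>R Z) = r *\<^sub>R Re_vec Z"
  and Im_vec_scaleR: "Im_vec (r *\<^sub>R Z) = r *\<^sub>R Im_vec Z"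
  and Re_vec_cnj: "Re_vec (cnj_vec Z) = Re_vec Z"
  and Im_vec_cnj: "Im_vec (cnj_vec Z) = - Im_vec Z"
  and Re_vec_minus: "Re_vec (- Z) = - Re_vec Z" and Im_vec_minus: "Im_vec (- Z) = - Im_vec Z"
  and Re_vec_0: "Re_vec 0 = 0" and Im_vec_0: "Im_vec 0 = 0"
  by (simp_all add: Re_vec_def Im_vec_def cnj_vec_def vec_eq_iff)

lemma bounded_linear_Re_vec: "bounded_linear (Re_vec :: complex^'d \<Rightarrow> real^'d)"
  by (subst linear_conv_bounded_linear[symmetric]) (auto intro!: linearI simp: Re_vec_add Re_vec_scaleR)

lemma bounded_linear_Im_vec: "bounded_linear (Im_vec :: complex^'d \<Rightarrow> real^'d)"
  by (subst linear_conv_bounded_linear[symmetric]) (auto intro!: linearI simp: Im_vec_add Im_vec_scaleR)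

lemma Re_Im_vec_eqI: "Re_vec Z = Re_vec W \<Longrightarrow> Im_vec Z = Im_vec W \<Longrightarrow> Z = W"
  by (simp add: Re_vec_def Im_vec_def vec_eq_iff complex_eq_iff)

lemma Re_vec_sum: "Re_vec (\<Sum>i\<in>I. Z i) = (\<Sum>i\<in>I. Re_vec (Z i))"
  using linear_sum[OF bounded_linear.linear[OF bounded_linear_Re_vec]] .

lemma Re_vec_complexify: "Re_vec (complexify L Z) = L (Re_vec Z)"
  by (simp add: Re_vec_def complexify_def)

lemma sum_lessThan_double: "(\<Sum>i<2 * n. h i) = (\<Sum>j<n. h (2 * j) + h (Suc (2 * j)))"
  for h :: "nat \<Rightarrow> 'a::comm_monoid_add"
  by (induction n) (simp_all add: add_ac)

text \<open>The rows are \<open>v\<close>, \<open>Re z\<^sub>0\<close>, \<open>Im z\<^sub>0\<close>, \<open>Re z\<^sub>1\<close>, \<open>Im z\<^sub>1\<close>, and so on; for a frame \<open>z\<close> of \<open>T\<close> the determinant, as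
  a function of \<open>v\<close>, is a one-form with kernel \<open>Re T\<close>.\<close>

definition hyper_row :: "real^'d \<Rightarrow> (nat \<Rightarrow> complex^'d) \<Rightarrow> nat \<Rightarrow> real^'d" where
  "hyper_row v z i = (case i of 0 \<Rightarrow> v
     | Suc j \<Rightarrow> if even j then Re_vec (z (j div 2)) else Im_vec (z (j div 2)))"

definition hyper_det :: "('d::finite \<Rightarrow> nat) \<Rightarrow> (nat \<Rightarrow> complex^'d) \<Rightarrow> real^'d \<Rightarrow> real" where
  "hyper_det idx z v = det (\<chi> r. hyper_row v z (idx r))"

lemma linear_hyper_det:
  fixes idx :: "'d::finite \<Rightarrow> nat"
  assumes "inj idx" and r0: "idx r0 = 0"
  shows "linear (hyper_det idx z)"
proof -
  have e: "(\<chi> r. hyper_row v z (idx r)) = (\<chi> r. if r = r0 then v else hyper_row 0 z (idx r))" for v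
  proof -
    have "hyper_row v z (idx r) = (if r = r0 then v else hyper_row 0 z (idx r))" for r
    proof (cases "r = r0")
      case False
      then have "idx r \<noteq> 0" using assms by (metis injD)
      then show ?thesis using False by (cases "idx r") (simp_all add: hyper_row_def)
    qed (simp add: r0 hyper_row_def)
    then show ?thesis by (simp add: vec_eq_iff)
  qed
  show ?thesis
  proof (rule linearI)
    fix a b :: "real^'d" and s :: real
    show "hyper_det idx z (a + b) = hyper_det idx z a + hyper_det idx z b"
      unfolding hyper_det_def e by (rule det_row_add)
    show "hyper_det idx z (s *\<^sub>R a) = s *\<^sub>R hyper_det idx z a"
    proof -
      have "s *\<^sub>R a = s *s a" by (simp add: vec_eq_iff)
      show ?thesis
        unfolding \<open>s *\<^sub>R a = s *s a\<close> hyper_det_def e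
        using det_row_mul[of r0 s "\<lambda>_. a" "\<lambda>r. hyper_row 0 z (idx r)"] by simp
    qed
  qed
qed

text \<open>The assumption \<open>ind\<close> says that the rows other than v are independent over
  the reals, so the determinant vanishes exactly when v is a real combination of them.\<close>

lemma hyper_det_eq0_iff:
  fixes B :: "nat \<Rightarrow> 'd::finite"
  assumes B: "bij_betw B {..<Suc (2 * n)} UNIV"
    and ind: "\<And>\<alpha>. Re_vec (\<Sum>j<n. \<alpha> j *s z j) = 0 \<Longrightarrow> \<forall>j<n. \<alpha> j = 0"
  shows "hyper_det (inv_into {..<Suc (2 * n)} B) z v = 0 \<longleftrightarrow> (\<exists>\<alpha>. v = Re_vec (\<Sum>j<n. \<alpha> j *s z j))"
proof -
  let ?idx = "inv_into {..<Suc (2 * n)} B"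
  let ?M = "\<chi> r. hyper_row v z (?idx r)"
  have idx: "?idx (B i) = i" if "i < Suc (2 * n)" for i
    using B that by (intro inv_into_f_f) (auto simp: bij_betw_def)
  \<comment> \<open>a Re z + b Im z = Re ((a - i b) z), whence the minus sign: real relations
    between the rows correspond to complex combinations of the z_j.\<close>
  define al where "al c j = Complex (c (B (Suc (2 * j)))) (- c (B (Suc (Suc (2 * j)))))" for c j
  have comb: "(\<Sum>r\<in>UNIV. c r *s row r ?M) = c (B 0) *\<^sub>R v + Re_vec (\<Sum>j<n. al c j *s z j)" for c :: "'d \<Rightarrow> real"
  proof -
    have "(\<Sum>r\<in>UNIV. c r *s row r ?M) = (\<Sum>i<Suc (2 * n). c (B i) *s hyper_row v z i)"
      by (subst sum.reindex_bij_betw[OF B, symmetric]) (simp add: row_def vec_nth_inverse idx)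
    also have "\<dots> = c (B 0) *\<^sub>R v + (\<Sum>i<2 * n. c (B (Suc i)) *s hyper_row v z (Suc i))"
      by (simp only: sum.lessThan_Suc_shift) (simp add: hyper_row_def scalar_mult_eq_scaleR)
    also have "(\<Sum>i<2 * n. c (B (Suc i)) *s hyper_row v z (Suc i)) = (\<Sum>j<n. Re_vec (al c j *s z j))"
      unfolding sum_lessThan_double
      by (intro sum.cong refl) (simp add: hyper_row_def al_def Re_vec_smult scalar_mult_eq_scaleR)
    finally show ?thesis by (simp add: Re_vec_sum)
  qed
  have all_zero: "\<forall>r. c r = 0" if "c (B 0) = 0" and z: "\<forall>j<n. al c j = 0" for c
  proof
    fix r
    obtain i where i: "i < Suc (2 * n)" "r = B i" using B by (auto simp: bij_betw_def)
    show "c r = 0"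
    proof (cases i)
      case 0 then show ?thesis using i that by simp
    next
      case (Suc k)
      have "k div 2 < n" using i Suc by auto
      with z have "al c (k div 2) = 0" by blast
      then have "c (B (Suc (2 * (k div 2)))) = 0" "c (B (Suc (Suc (2 * (k div 2))))) = 0"
        by (simp_all add: al_def complex_eq_iff)
      moreover have "k = 2 * (k div 2) \<or> k = Suc (2 * (k div 2))" by presburger
      ultimately show ?thesis using i Suc by metis
    qed
  qed
  have "hyper_det ?idx z v = 0 \<longleftrightarrow> (\<exists>c. (\<Sum>r\<in>UNIV. c r *s row r ?M) = 0 \<and> \<not> (\<forall>r. c r = 0))"
    unfolding hyper_det_def
    using invertible_det_nz[of ?M] invertible_right_inverse[of ?M] matrix_right_invertible_independent_rows[of ?M]
    by blast
  also have "\<dots> \<longleftrightarrow> (\<exists>\<alpha>. v = Re_vec (\<Sum>j<n. \<alpha> j *s z j))"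
  proof
    assume "\<exists>c. (\<Sum>r\<in>UNIV. c r *s row r ?M) = 0 \<and> \<not> (\<forall>r. c r = 0)"
    then obtain c where c: "c (B 0) *\<^sub>R v + Re_vec (\<Sum>j<n. al c j *s z j) = 0" "\<not> (\<forall>r. c r = 0)"
      unfolding comb by blast
    have c0: "c (B 0) \<noteq> 0"
    proof
      assume "c (B 0) = 0"
      with c have "\<forall>j<n. al c j = 0" by (intro ind) simp
      with \<open>c (B 0) = 0\<close> all_zero c(2) show False by blast
    qed
    define r where "r = - inverse (c (B 0))"
    have "v = r *\<^sub>R Re_vec (\<Sum>j<n. al c j *s z j)"
    proof -
      have "Re_vec (\<Sum>j<n. al c j *s z j) = - c (B 0) *\<^sub>R v" using c(1) by (simp add: add_eq_0_iff)
      then show ?thesis using c0 by (simp add: r_def)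
    qed
    also have "\<dots> = Re_vec (\<Sum>j<n. (of_real r * al c j) *s z j)"
      by (simp add: Re_vec_sum Re_vec_smult scaleR_sum_right algebra_simps)
    finally show "\<exists>\<alpha>. v = Re_vec (\<Sum>j<n. \<alpha> j *s z j)" by (intro exI)
  next
    assume "\<exists>\<alpha>. v = Re_vec (\<Sum>j<n. \<alpha> j *s z j)"
    then obtain \<alpha> where v: "v = Re_vec (\<Sum>j<n. \<alpha> j *s z j)" by blast
    \<comment> \<open>The coefficients of the relation - v + Re (sum of \<alpha>_j z_j) = 0, read
      back through the numbering of the rows.\<close>
    define c where "c r = (case ?idx r of 0 \<Rightarrow> -1
      | Suc k \<Rightarrow> if even k then Re (\<alpha> (k div 2)) else - Im (\<alpha> (k div 2)))" for r
    have c0: "c (B 0) = -1" by (simp add: c_def idx)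
    have "al c j = \<alpha> j" if "j < n" for j
    proof -
      have "c (B (Suc (2 * j))) = Re (\<alpha> j)" "c (B (Suc (Suc (2 * j)))) = - Im (\<alpha> j)"
        using that by (simp_all add: c_def idx)
      then show ?thesis by (simp add: al_def complex_eq_iff)
    qed
    then have "c (B 0) *\<^sub>R v + Re_vec (\<Sum>j<n. al c j *s z j) = 0" by (simp add: c0 v)
    then show "\<exists>c. (\<Sum>r\<in>UNIV. c r *s row r ?M) = 0 \<and> \<not> (\<forall>r. c r = 0)"
      unfolding comb using c0 by (intro exI[of _ c]) (auto intro!: exI[of _ "B 0"])
  qed
  finally show ?thesis .
qed

lemma smooth_on_hyper_det:
  assumes S: "open S" and z: "\<And>j. j < n \<Longrightarrow> smooth_on S (\<lambda>x. z x j)"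
    and idx: "\<And>r. idx r < Suc (2 * n)"
  shows "smooth_on S (\<lambda>x. hyper_det idx (z x) v)"
  unfolding hyper_det_def det_def vec_lambda_beta
proof (intro smooth_on_sum smooth_on_mult smooth_on_prod S smooth_on_const)
  fix r q
  show "smooth_on S (\<lambda>x. hyper_row v (z x) (idx r) $ q)"
  proof (cases "idx r")
    case (Suc j)
    have "j div 2 < n" using idx[of r] Suc by auto
    then have "smooth_on S (\<lambda>x. Re_vec (z x (j div 2)))" "smooth_on S (\<lambda>x. Im_vec (z x (j div 2)))"
      using z by (auto intro: smooth_on_bounded_linear[OF S bounded_linear_Re_vec] smooth_on_bounded_linear[OF S bounded_linear_Im_vec])
    then show ?thesis using Suc by (cases "even j") (simp_all add: hyper_row_def smooth_on_vec_nth[OF S])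
  qed (simp add: hyper_row_def)
qed

lemma complexify2_bilinear:
  fixes f :: "(nat \<Rightarrow> real^'d) \<Rightarrow> real"
  assumes f: "f \<in> alt_forms 2"
  shows "complexify2 f (Z + Z') W = complexify2 f Z W + complexify2 f Z' W"
    and "complexify2 f (a *s Z) W = a * complexify2 f Z W"
    and "complexify2 f W Z = - complexify2 f Z W"
proof -
  define b where "b u v = f (\<lambda>i. if i = 0 then u else v)" for u v
  have e: "b u v = contract u f (\<lambda>_. v)" for u v
    unfolding b_def contract_def by (intro arg_cong[where f = f]) (auto split: nat.split)
  have l: "linear (\<lambda>u. b u v)" for v
    unfolding e using contract_linear[of f "Suc 0"] f by (simp add: numeral_2_eq_2)
  have as: "b v u = - b u v" for u v
  proof -
    have "(\<lambda>m. (if Transposition.transpose 0 1 m = (0::nat) then u else v)) = (\<lambda>m. if m = 1 then u else v)"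
      by (auto simp: Transposition.transpose_def)
    moreover have "f (\<lambda>m. if m = 1 then u else v) = f (\<lambda>m. if m = 0 then v else u)"
      by (rule alt_forms_cong[OF f]) (auto simp: less_2_cases_iff)
    ultimately show ?thesis
      using alt_forms_swap[OF f, of 0 1 "\<lambda>i. if i = 0 then u else v"] unfolding b_def by simp
  qed
  have C: "complexify2 f Z W = Complex (b (Re_vec Z) (Re_vec W) - b (Im_vec Z) (Im_vec W))
      (b (Re_vec Z) (Im_vec W) + b (Im_vec Z) (Re_vec W))" for Z W
    by (simp add: complexify2_def b_def)
  show "complexify2 f (Z + Z') W = complexify2 f Z W + complexify2 f Z' W"
    by (simp add: C Re_vec_add Im_vec_add linear_add[OF l] complex_eq_iff)
  show "complexify2 f (a *s Z) W = a * complexify2 f Z W"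
    by (simp add: C Re_vec_smult Im_vec_smult linear_add[OF l] linear_diff[OF l] linear_scale[OF l] complex_eq_iff algebra_simps)
  show "complexify2 f W Z = - complexify2 f Z W"
    by (simp add: C as[of _ "Re_vec W"] as[of _ "Im_vec W"] complex_eq_iff)
qed

lemma extd_1_const_fields:
  "contract X (extd (Suc 0) F x) (\<lambda>_. Y) = dird X F x (\<lambda>_. Y) - dird Y F x (\<lambda>_. X)" if "sform S (Suc 0) F" "x \<in> S" "open S"
proof -
  have "extd 0 (\<lambda>y. contract X (F y)) x (\<lambda>_. Y) = extd 0 (\<lambda>y v. F y (\<lambda>_. X)) x (\<lambda>_. Y)"
    using sform_iprod[OF that(1), of X] contract_1_form[OF sformD(1)[OF that(1)], of _ X] that
    by (intro fun_cong[OF extd_cong[OF that(3,2)]]) auto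
  then show ?thesis by (simp add: contract_extd) (simp add: extd_def dird_def)
qed

text \<open>Differentiate F(Y) = 0 along X with the product rule.\<close>

lemma dird_kernel_field:
  fixes F :: "real^'d \<Rightarrow> (nat \<Rightarrow> real^'d) \<Rightarrow> real"
  assumes S: "open S" and F: "sform S (Suc 0) F" and x: "x \<in> S"
    and Y: "(Y has_derivative DY) (at x)" and z: "\<And>y. y \<in> S \<Longrightarrow> F y (\<lambda>_. Y y) = 0"
  shows "dird X F x (\<lambda>_. Y x) = - F x (\<lambda>_. DY X)"
proof -
  have e: "F y (\<lambda>_. V) = (\<Sum>b\<in>UNIV. F y (\<lambda>_. axis b 1) * V $ b)" if "y \<in> S" for y V
    by (rule one_form_expand(2)[OF sformD(1)[OF F that]])
  have Yb: "((\<lambda>y. Y y $ b) has_derivative (\<lambda>h. DY h $ b)) (at x)" for b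
    by (rule bounded_linear.has_derivative[OF bounded_linear_vec_nth Y])
  have "((\<lambda>y. \<Sum>b\<in>UNIV. F y (\<lambda>_. axis b 1) * Y y $ b) has_derivative
    (\<lambda>h. \<Sum>b\<in>UNIV. F x (\<lambda>_. axis b 1) * DY h $ b + dird h F x (\<lambda>_. axis b 1) * Y x $ b)) (at x)"
    by (intro has_derivative_sum has_derivative_mult sform_has_derivative[OF F x] Yb)
  moreover have "((\<lambda>y. \<Sum>b\<in>UNIV. F y (\<lambda>_. axis b 1) * Y y $ b) has_derivative (\<lambda>h. 0)) (at x)"
    by (rule has_derivative_transform_within_open[OF has_derivative_const[of 0] S x]) (simp add: e[symmetric] z)
  ultimately have "(\<lambda>h. \<Sum>b\<in>UNIV. F x (\<lambda>_. axis b 1) * DY h $ b + dird h F x (\<lambda>_. axis b 1) * Y x $ b) = (\<lambda>h. 0)"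
    by (rule has_derivative_unique)
  from fun_cong[OF this, of X]
  have "(\<Sum>b\<in>UNIV. dird X F x (\<lambda>_. axis b 1) * Y x $ b) = - F x (\<lambda>_. DY X)"
    unfolding e[OF x, of "DY X"] by (simp add: sum.distrib)
  moreover have "dird X F x (\<lambda>_. Y x) = (\<Sum>b\<in>UNIV. dird X F x (\<lambda>_. axis b 1) * Y x $ b)"
    by (rule one_form_expand(2)[OF dird_alt_forms[OF S F x]])
  ultimately show ?thesis by simp
qed

locale cr_mfd =
  fixes A :: "('m::{t2_space, second_countable_topology}, 'd::finite) chart set"
    and T :: "('m, 'd) cdistribution" and n :: nat
  assumes cr: "cr_manifold n A T"
begin

sublocale smooth_mfd A
  using cr by unfold_locales (simp add: cr_manifold_def)

lemma dim: "CARD('d) = 2 * n + 1"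
  using cr by (simp add: cr_manifold_def)

lemma distribution: "smooth_cdistribution n A T"
  using cr by (simp add: cr_manifold_def)

lemma T_transverse: "c \<in> A \<Longrightarrow> p \<in> dom_of c \<Longrightarrow> T c p \<inter> cnj_vec ` T c p = {0}"
proof -
  have "\<forall>c\<in>A. \<forall>p\<in>dom_of c. T c p \<inter> cnj_vec ` T c p = {0}"
    using cr unfolding cr_manifold_def by (elim conjE)
  then show "c \<in> A \<Longrightarrow> p \<in> dom_of c \<Longrightarrow> T c p \<inter> cnj_vec ` T c p = {0}" by blast
qed

lemma T_bracket:
  assumes "open U" "Z \<in> sections A T U" "W \<in> sections A T U"
  shows "lie_bracket Z W \<in> sections A T U"
proof -
  have "\<forall>U. open U \<longrightarrow> (\<forall>Z \<in> sections A T U. \<forall>W \<in> sections A T U. lie_bracket Z W \<in> sections A T U)"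
    using cr unfolding cr_manifold_def by (elim conjE)
  from this[rule_format, OF assms] show ?thesis .
qed

lemma levi_nondegenerate:
  assumes "open U" "\<theta> \<in> contact_forms A T U" "c \<in> A" "p \<in> dom_of c" "p \<in> U"
  shows "nondegenerate_hermitian_on (T c p) (levi_form A U \<theta> c p)"
proof -
  have "\<forall>U. open U \<longrightarrow> (\<forall>\<theta> \<in> contact_forms A T U. \<forall>c\<in>A. \<forall>p \<in> dom_of c \<inter> U.
        nondegenerate_hermitian_on (T c p) (levi_form A U \<theta> c p))"
    using cr unfolding cr_manifold_def by (elim conjE)
  from this[rule_format, OF assms(1-3), of p] assms(4,5) show ?thesis by blast
qed

lemma T_subspace: "c \<in> A \<Longrightarrow> p \<in> dom_of c \<Longrightarrow> vec.subspace (T c p)"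
  and T_dim: "c \<in> A \<Longrightarrow> p \<in> dom_of c \<Longrightarrow> vec.dim (T c p) = n"
  and T_compat: "c \<in> A \<Longrightarrow> c' \<in> A \<Longrightarrow> p \<in> dom_of c \<Longrightarrow> p \<in> dom_of c' \<Longrightarrow> T c' p = complexify (jacobian c c' p) ` T c p"
  using distribution unfolding smooth_cdistribution_def by blast+

lemma T_frame:
  obtains U Z where "open U" "p \<in> U" "\<And>j. j < n \<Longrightarrow> Z j \<in> cvfields A U"
    "\<And>c q. c \<in> A \<Longrightarrow> q \<in> dom_of c \<Longrightarrow> q \<in> U \<Longrightarrow> T c q = vec.span {Z j c q | j. j < n}"
proof -
  have "\<exists>U Z. open U \<and> p \<in> U \<and> (\<forall>j<n. Z j \<in> cvfields A U) \<and>
        (\<forall>c\<in>A. \<forall>q \<in> dom_of c \<inter> U. T c q = vec.span {Z j c q | j. j < n})"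
    using distribution unfolding smooth_cdistribution_def by blast
  then obtain U Z where U: "open U" "p \<in> U" and Z: "\<forall>j<n. Z j \<in> cvfields A U"
    and T: "\<forall>c\<in>A. \<forall>q \<in> dom_of c \<inter> U. T c q = vec.span {Z j c q | j. j < n}" by blast
  show ?thesis
  proof (rule that[OF U])
    show "Z j \<in> cvfields A U" if "j < n" for j using Z that by blast
    show "T c q = vec.span {Z j c q | j. j < n}" if "c \<in> A" "q \<in> dom_of c" "q \<in> U" for c q
      using T that by blast
  qed
qed

section \<open>The contact hyperplanes and local contact forms\<close>

abbreviation H :: "('m, 'd) chart \<Rightarrow> 'm \<Rightarrow> (real^'d) set" where
  "H \<equiv> real_part_distribution T"

lemma H_eq:
  assumes c: "c \<in> A" and p: "p \<in> dom_of c" shows "H c p = Re_vec ` T c p"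
proof
  show "H c p \<subseteq> Re_vec ` T c p"
  proof
    fix v assume "v \<in> H c p"
    then obtain Z W where "Z \<in> T c p" "W \<in> T c p" "v = Re_vec (Z + W)"
      by (auto simp: real_part_distribution_def Re_vec_add Re_vec_cnj)
    then show "v \<in> Re_vec ` T c p" using vec.subspace_add[OF T_subspace[OF c p]] by blast
  qed
  show "Re_vec ` T c p \<subseteq> H c p"
  proof
    fix v assume "v \<in> Re_vec ` T c p"
    then obtain Z where "Z \<in> T c p" "v = Re_vec (Z + cnj_vec 0)"
      by (auto simp: Re_vec_add Re_vec_cnj Re_vec_0)
    then show "v \<in> H c p" unfolding real_part_distribution_def
      using vec.subspace_0[OF T_subspace[OF c p]] by blast
  qed
qed

lemma Im_vec_H:
  assumes c: "c \<in> A" and p: "p \<in> dom_of c" and Z: "Z \<in> T c p" shows "Im_vec Z \<in> H c p"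
proof -
  have "Im_vec Z = Re_vec ((- \<i>) *s Z)" by (simp add: Re_vec_smult Re_vec_minus)
  then show ?thesis unfolding H_eq[OF c p] using vec.subspace_scale[OF T_subspace[OF c p] Z] by blast
qed

text \<open>If Re Z = 0 then Z is the conjugate of -Z and lies in both T and its conjugate. So Re
  identifies T with H as real vector spaces.\<close>

lemma Re_vec_inj:
  assumes c: "c \<in> A" and p: "p \<in> dom_of c" and Z: "Z \<in> T c p" "Re_vec Z = 0" shows "Z = 0"
proof -
  have "Z = cnj_vec ((-1) *s Z)"
    by (rule Re_Im_vec_eqI) (simp_all add: Re_vec_cnj Im_vec_cnj Re_vec_smult Im_vec_smult Re_vec_minus Im_vec_minus Z(2))
  moreover have "(-1) *s Z \<in> T c p" using vec.subspace_scale[OF T_subspace[OF c p] Z(1)] .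
  ultimately have "Z \<in> T c p \<inter> cnj_vec ` T c p" using Z(1) by blast
  then show ?thesis using T_transverse[OF c p] by blast
qed

text \<open>The set of frame vectors could a priori have fewer than n elements. Since it spans a
  space of dimension n it has exactly n, so the indexing is injective and the vectors are
  independent.\<close>

lemma span_frame:
  fixes z :: "nat \<Rightarrow> complex^'d"
  assumes c: "c \<in> A" and p: "p \<in> dom_of c" and T: "T c p = vec.span {z j | j. j < n}"
  shows "T c p = {\<Sum>j<n. \<alpha> j *s z j | \<alpha>. True}"
    and "(\<Sum>j<n. \<alpha> j *s z j) = 0 \<Longrightarrow> \<forall>j<n. \<alpha> j = 0"
proof -
  have s: "{z j | j. j < n} = z ` {..<n}" by auto
  have n: "n \<le> card (z ` {..<n})"
    using vec.dim_le_card[of "T c p" "z ` {..<n}"] T_dim[OF c p] T s by simp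
  then have card: "card (z ` {..<n}) = n" using card_image_le[of "{..<n}" z] by simp
  then have inj: "inj_on z {..<n}" by (intro eq_card_imp_inj_on) simp_all
  have indep: "vec.independent (z ` {..<n})"
    using vec.card_eq_dim[of "z ` {..<n}" "T c p"] card T_dim[OF c p] vec.span_superset[of "z ` {..<n}"]
    unfolding T s by simp
  show "T c p = {\<Sum>j<n. \<alpha> j *s z j | \<alpha>. True}"
  proof
    show "T c p \<subseteq> {\<Sum>j<n. \<alpha> j *s z j | \<alpha>. True}"
      unfolding T s by (subst vec.span_finite) (auto simp: sum.reindex[OF inj])
    show "{\<Sum>j<n. \<alpha> j *s z j | \<alpha>. True} \<subseteq> T c p"
    proof
      fix Z assume "Z \<in> {\<Sum>j<n. \<alpha> j *s z j | \<alpha>. True}"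
      then obtain \<alpha> where "Z = (\<Sum>j<n. \<alpha> j *s z j)" by blast
      then show "Z \<in> T c p" unfolding T s by (auto intro: vec.span_sum vec.span_scale vec.span_base)
    qed
  qed
  assume z0: "(\<Sum>j<n. \<alpha> j *s z j) = 0"
  let ?u = "\<lambda>v. \<alpha> (inv_into {..<n} z v)"
  have "(\<Sum>v\<in>z ` {..<n}. ?u v *s v) = 0"
  proof -
    have "(\<Sum>v\<in>z ` {..<n}. ?u v *s v) = (\<Sum>j<n. ?u (z j) *s z j)" by (simp add: sum.reindex[OF inj])
    also have "\<dots> = (\<Sum>j<n. \<alpha> j *s z j)" by (intro sum.cong) (simp_all add: inv_into_f_f[OF inj])
    finally show ?thesis using z0 by simp
  qed
  then have "?u (z j) = 0" if "j < n" for j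
    using vec.independentD[OF indep, of "z ` {..<n}" ?u "z j"] that by simp
  then show "\<forall>j<n. \<alpha> j = 0" by (simp add: inv_into_f_f[OF inj])
qed

text \<open>H is spanned over the reals by the 2n vectors Re z_j and Im z_j. This guarantees that
  contact forms vanish nowhere.\<close>

lemma H_proper:
  assumes c: "c \<in> A" and p: "p \<in> dom_of c"
  shows "H c p \<noteq> UNIV"
proof
  assume U: "H c p = UNIV"
  obtain U Z where fr: "p \<in> U" "\<And>c q. c \<in> A \<Longrightarrow> q \<in> dom_of c \<Longrightarrow> q \<in> U \<Longrightarrow> T c q = vec.span {Z j c q | j. j < n}"
    by (rule T_frame[of p]) blast
  let ?z = "\<lambda>j. Z j c p"
  let ?W = "(\<lambda>j. Re_vec (?z j)) ` {..<n} \<union> (\<lambda>j. Im_vec (?z j)) ` {..<n}"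
  have "Re_vec (\<Sum>j<n. \<alpha> j *s ?z j) \<in> span ?W" for \<alpha>
    unfolding Re_vec_sum Re_vec_smult by (intro span_sum span_diff span_scale span_base) auto
  then have "(UNIV :: (real^'d) set) \<subseteq> span ?W"
    unfolding U[symmetric] H_eq[OF c p] span_frame(1)[OF c p fr(2)[OF c p fr(1)]] by blast
  then have "dim (UNIV :: (real^'d) set) \<le> card ?W" by (intro dim_le_card) auto
  also have "\<dots> \<le> n + n"
    by (rule order_trans[OF card_Un_le add_mono]) (auto intro: order_trans[OF card_image_le])
  finally show False using dim by simp
qed

text \<open>The determinant with a local frame of T in its rows is a smooth one-form with kernel Re
  T = H in one chart; it is then transported to the others. Without this the conditions quantified
  over contact forms near p would say nothing.\<close>

lemma contact_form_exists:
  obtains V \<theta> where "open V" "p \<in> V" "\<theta> \<in> contact_forms A T V"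
proof -
  obtain c where c: "c \<in> A" "p \<in> dom_of c" by (rule chart_at)
  obtain U Z where U: "open U" "p \<in> U" and Z: "\<And>j. j < n \<Longrightarrow> Z j \<in> cvfields A U"
    and TZ: "\<And>c q. c \<in> A \<Longrightarrow> q \<in> dom_of c \<Longrightarrow> q \<in> U \<Longrightarrow> T c q = vec.span {Z j c q | j. j < n}"
    by (rule T_frame[of p]) blast
  define V where "V = dom_of c \<inter> U"
  have V: "open V" "V \<subseteq> dom_of c" "p \<in> V" using U c open_dom[OF c(1)] by (auto simp: V_def)
  let ?S = "img c V"
  have S: "open ?S" by (rule open_img[OF c(1) V(1)])
  obtain B where B: "bij_betw B {..<Suc (2 * n)} (UNIV :: 'd set)"
    using ex_bij_betw_nat_finite[of "UNIV :: 'd set"] dim by (auto simp: lessThan_atLeast0)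
  define idx where "idx = inv_into {..<Suc (2 * n)} B"
  have idxb: "bij_betw idx UNIV {..<Suc (2 * n)}" unfolding idx_def by (rule bij_betw_inv_into[OF B])
  then have idx: "inj idx" "\<And>r. idx r < Suc (2 * n)" by (auto simp: bij_betw_def)
  have "0 \<in> range idx" using idxb by (simp add: bij_betw_def)
  then obtain r0 where r0: "idx r0 = 0" by (metis imageE)
  define z where "z x j = Z j c (chart_inv c x)" for x j
  define F where "F x = covec (hyper_det idx (z x))" for x
  have F: "sform ?S (Suc 0) F"
  proof (rule sformI)
    show "F x \<in> alt_forms (Suc 0)" for x
      unfolding F_def by (rule covec_alt_forms[OF linear_hyper_det[OF idx(1) r0]])
    show "smooth_on ?S (\<lambda>x. F x v)" for v
      unfolding F_def covec_def
    proof (rule smooth_on_hyper_det[OF S _ idx(2)])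
      show "smooth_on ?S (\<lambda>x. z x j)" if "j < n" for j
      proof -
        have "smooth_on (snd c ` (dom_of c \<inter> U)) (\<lambda>x. z x j)"
          using Z[OF that] c(1) unfolding cvfields_def z_def by blast
        then show ?thesis by (rule smooth_on_subset) (auto simp: img_def V_def)
      qed
    qed
  qed
  have ker: "F (snd c q) (\<lambda>_. v) = 0 \<longleftrightarrow> v \<in> H c q" if q: "q \<in> V" for q v
  proof -
    have qc: "q \<in> dom_of c" "q \<in> U" using q by (auto simp: V_def)
    note sp = span_frame[OF c(1) qc(1) TZ[OF c(1) qc]]
    have zq: "z (snd c q) = (\<lambda>j. Z j c q)" using c qc by (simp add: z_def fun_eq_iff)
    have ind: "\<forall>j<n. \<alpha> j = 0" if "Re_vec (\<Sum>j<n. \<alpha> j *s Z j c q) = 0" for \<alpha>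
    proof (rule sp(2), rule Re_vec_inj[OF c(1) qc(1) _ that])
      show "(\<Sum>j<n. \<alpha> j *s Z j c q) \<in> T c q" unfolding sp(1) by blast
    qed
    show ?thesis
      using hyper_det_eq0_iff[OF B ind, where v = v] sp(1)
      by (auto simp: F_def covec_def zq idx_def H_eq[OF c(1) qc(1)])
  qed
  let ?th = "\<lambda>c' p v. if c' \<in> A \<and> p \<in> dom_of c' \<and> p \<in> V then F (snd c p) (\<lambda>i. jacobian c' c p (v i)) else 0"
  have "?th \<in> forms A V 1" using transport_forms[OF c(1) V(1,2) F] by simp
  moreover have "{v. ?th c' q (\<lambda>_. v) = 0} = H c' q" if c': "c' \<in> A" and q: "q \<in> dom_of c'" "q \<in> V" for c' q
  proof -
    have qc: "q \<in> dom_of c" using q V by blast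
    \<comment> \<open>The Jacobian carries H in one chart onto H in the other, and its injectivity
      turns this into the equality of kernels.\<close>
    have HH: "H c q = jacobian c' c q ` H c' q"
      unfolding H_eq[OF c(1) qc] H_eq[OF c' q(1)] T_compat[OF c' c(1) q(1) qc]
      by (simp add: image_image Re_vec_complexify)
    have "inj (jacobian c' c q)"
      by (rule inj_on_inverseI[of _ "jacobian c c' q"])
        (use jacobian_cocycle[OF c' c(1) c' q(1) qc q(1)] jacobian_self[OF c' q(1)] in metis)
    then show ?thesis using ker[OF q(2)] c' q HH by (auto dest: injD)
  qed
  ultimately have "?th \<in> contact_forms A T V" by (simp add: contact_forms_def)
  then show ?thesis using that V by blast
qed

lemma contact_forms_form: "\<theta> \<in> contact_forms A T V \<Longrightarrow> \<theta> \<in> forms A V (Suc 0)"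
  by (simp add: contact_forms_def)

lemma contact_kernel:
  "\<theta> \<in> contact_forms A T V \<Longrightarrow> c \<in> A \<Longrightarrow> p \<in> dom_of c \<Longrightarrow> p \<in> V \<Longrightarrow> \<theta> c p (\<lambda>_. v) = 0 \<longleftrightarrow> v \<in> H c p"
  unfolding contact_forms_def by blast

text \<open>Integrability: \<open>d\<theta>(Z, W) = - \<theta>([Z, W]) = 0\<close> for sections \<open>Z, W\<close> of \<open>T\<close>.\<close>

lemma dtheta_sections:
  assumes V: "open V" and th: "\<theta> \<in> contact_forms A T V" and c: "c \<in> A" and p: "p \<in> dom_of c" "p \<in> V"
    and U: "open U" "p \<in> U" and Z: "Z \<in> sections A T U" and W: "W \<in> sections A T U"
  shows "complexify2 (ext_deriv A V 1 \<theta> c p) (Z c p) (W c p) = 0"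
proof -
  let ?F = "loc \<theta> c" and ?S = "img c (U \<inter> V)" and ?x = "snd c p"
  have S: "open ?S" using U V c by (intro open_img open_Int)
  have x: "?x \<in> ?S" using U p by (auto intro: imgI)
  have F: "sform ?S (Suc 0) ?F"
    by (rule sform_subset[OF sform_loc[OF contact_forms_form[OF th] c]]) (auto simp: img_mono)
  have br: "lie_bracket Z W c p \<in> T c p"
    using T_bracket[OF U(1) Z W] c p(1) U(2) unfolding sections_def by blast
  define D where "D Y h = frechet_derivative (\<lambda>x. Y c (chart_inv c x)) (at ?x) h" for Y :: "('m, 'd) cvfield" and h
  have cp [simp]: "chart_inv c ?x = p" using c p by simp
  have der: "((\<lambda>x. Y c (chart_inv c x)) has_derivative D Y) (at ?x)" if "Y \<in> sections A T U" for Y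
  proof -
    have "smooth_on (snd c ` (dom_of c \<inter> U)) (\<lambda>x. Y c (chart_inv c x))"
      using that c unfolding sections_def cvfields_def by blast
    from smooth_on_has_derivative[OF this, of ?x] show ?thesis
      using p U unfolding D_def by blast
  qed
  have kerR: "?F y (\<lambda>_. Re_vec (Y c (chart_inv c y))) = 0" "?F y (\<lambda>_. Im_vec (Y c (chart_inv c y))) = 0"
    if Y: "Y \<in> sections A T U" and y: "y \<in> ?S" for Y y
  proof -
    obtain q where q: "q \<in> dom_of c" "q \<in> U" "q \<in> V" "y = snd c q" using imgE[OF c y] by blast
    then have "Y c q \<in> T c q" using Y c unfolding sections_def by blast
    then show "?F y (\<lambda>_. Re_vec (Y c (chart_inv c y))) = 0" "?F y (\<lambda>_. Im_vec (Y c (chart_inv c y))) = 0"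
      using contact_kernel[OF th c q(1,3)] Im_vec_H[OF c q(1)] H_eq[OF c q(1)] q c by auto
  qed
  have dR: "dird X ?F ?x (\<lambda>_. Re_vec (Y c p)) = - \<theta> c p (\<lambda>_. Re_vec (D Y X))"
    and dI: "dird X ?F ?x (\<lambda>_. Im_vec (Y c p)) = - \<theta> c p (\<lambda>_. Im_vec (D Y X))"
    if Y: "Y \<in> sections A T U" for X Y
    using dird_kernel_field[OF S F x bounded_linear.has_derivative[OF bounded_linear_Re_vec der[OF Y]] kerR(1)[OF Y], of X]
      dird_kernel_field[OF S F x bounded_linear.has_derivative[OF bounded_linear_Im_vec der[OF Y]] kerR(2)[OF Y], of X]
      c p by simp_all
  have b: "ext_deriv A V 1 \<theta> c p (\<lambda>i. if i = 0 then X else Y) = dird X ?F ?x (\<lambda>_. Y) - dird Y ?F ?x (\<lambda>_. X)" for X Y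
  proof -
    have "(\<lambda>i. if i = 0 then X else Y) = case_nat X (\<lambda>_. Y)" by (auto split: nat.split)
    then show ?thesis
      using extd_1_const_fields[OF F x S, of X Y] c p by (simp add: ext_deriv_eq contract_def)
  qed
  have lin: "linear (\<lambda>v. \<theta> c p (\<lambda>_. v))"
    using contract_linear[OF forms_alt[OF contact_forms_form[OF th] c p]]
    unfolding contract_1_form[OF forms_alt[OF contact_forms_form[OF th] c p]] .
  have brk: "lie_bracket Z W c p = D W (Re_vec (Z c p)) + \<i> *s D W (Im_vec (Z c p))
      - (D Z (Re_vec (W c p)) + \<i> *s D Z (Im_vec (W c p)))"
    by (simp add: lie_bracket_def cderiv_def Let_def D_def)
  have "\<theta> c p (\<lambda>_. Re_vec (lie_bracket Z W c p)) = 0" "\<theta> c p (\<lambda>_. Im_vec (lie_bracket Z W c p)) = 0"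
    using contact_kernel[OF th c p] Im_vec_H[OF c p(1) br] br H_eq[OF c p(1)] by auto
  then show ?thesis
    unfolding complexify2_def Let_def b dR[OF Z] dI[OF Z] dR[OF W] dI[OF W] brk
    by (simp add: Re_vec_add Im_vec_add Re_vec_diff Im_vec_diff Re_vec_smult Im_vec_smult complex_eq_iff
        linear_add[OF lin] linear_diff[OF lin])
qed

text \<open>The value depends only on the vectors at p, and there T is spanned by the values of a
  local frame, to which \<open>dtheta_sections\<close> applies.\<close>

lemma dtheta_T:
  assumes V: "open V" and th: "\<theta> \<in> contact_forms A T V" and c: "c \<in> A" and p: "p \<in> dom_of c" "p \<in> V"
    and Z: "Z \<in> T c p" and W: "W \<in> T c p"
  shows "complexify2 (ext_deriv A V 1 \<theta> c p) Z W = 0"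
proof -
  define f where "f = ext_deriv A V 1 \<theta> c p"
  have f: "f \<in> alt_forms 2"
    unfolding f_def using forms_alt[OF ext_deriv_forms[OF contact_forms_form[OF th] V] c p] by (simp add: numeral_2_eq_2)
  note bil = complexify2_bilinear[OF f]
  obtain U \<zeta> where U: "open U" "p \<in> U" and ze: "\<And>j. j < n \<Longrightarrow> \<zeta> j \<in> cvfields A U"
    and TZ: "\<And>c q. c \<in> A \<Longrightarrow> q \<in> dom_of c \<Longrightarrow> q \<in> U \<Longrightarrow> T c q = vec.span {\<zeta> j c q | j. j < n}"
    by (rule T_frame[of p]) blast
  have sec: "\<zeta> j \<in> sections A T U" if "j < n" for j
    unfolding sections_def using ze[OF that] TZ that by (auto intro!: vec.span_base)
  have zero: "complexify2 f 0 W = 0" for W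
    using bil(2)[of 0 0 W] by simp
  have 1: "complexify2 f (\<zeta> j c p) W = 0" if j: "j < n" and W: "W \<in> T c p" for j W
  proof -
    have "complexify2 f W (\<zeta> j c p) = 0"
      using W unfolding TZ[OF c p(1) U(2)]
    proof (induction rule: vec.span_induct_alt)
      case base
      show ?case by (rule zero)
    next
      case (step a y w)
      then show ?case using dtheta_sections[OF V th c p U sec sec[OF j], folded f_def] by (auto simp: bil(1,2))
    qed
    then show ?thesis using bil(3)[of W "\<zeta> j c p"] by simp
  qed
  show ?thesis
    unfolding f_def[symmetric] using Z unfolding TZ[OF c p(1) U(2)]
  proof (induction rule: vec.span_induct_alt)
    case base
    show ?case by (rule zero)
  next
    case (step a y w)
    then show ?case using 1[OF _ W] by (auto simp: bil(1,2))
  qed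
qed

lemma contact_point_at:
  assumes V: "open V" and th: "\<theta> \<in> contact_forms A T V" and c: "c \<in> A" and p: "p \<in> dom_of c" "p \<in> V"
  shows "contact_point (\<theta> c p) (ext_deriv A V 1 \<theta> c p) n"
proof -
  define f where "f = ext_deriv A V 1 \<theta> c p"
  have f: "f \<in> alt_forms 2"
    unfolding f_def using forms_alt[OF ext_deriv_forms[OF contact_forms_form[OF th] V] c p] by (simp add: numeral_2_eq_2)
  show ?thesis unfolding f_def[symmetric]
  proof
  show "f \<in> alt_forms 2" by (rule f)
  show "\<theta> c p \<in> alt_forms (Suc 0)" by (rule forms_alt[OF contact_forms_form[OF th] c p])
  show "CARD('d) = 2 * n + 1" by (rule dim)
  show "\<exists>R. \<theta> c p (\<lambda>_. R) \<noteq> 0" using contact_kernel[OF th c p] H_proper[OF c p(1)] by auto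
  fix X assume X: "\<theta> c p (\<lambda>_. X) = 0" and om: "\<And>Y. \<theta> c p (\<lambda>_. Y) = 0 \<Longrightarrow> contract X f (\<lambda>_. Y) = 0"
  obtain Z where Z: "Z \<in> T c p" "X = Re_vec Z"
    using X contact_kernel[OF th c p] H_eq[OF c p(1)] by auto
  have e: "f (\<lambda>i. if i = 0 then u else v) = contract u f (\<lambda>_. v)" for u v
    unfolding contract_def by (intro arg_cong[where f = f]) (auto split: nat.split)
  have neg: "contract u f (\<lambda>_. - v) = - contract u f (\<lambda>_. v)" for u v
  proof -
    have g: "contract u f \<in> alt_forms (Suc 0)" using contract_alt_forms[of f "Suc 0"] f by (simp add: numeral_2_eq_2)
    show ?thesis using linear_neg[OF contract_linear[OF g]] unfolding contract_1_form[OF g] .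
  qed
  \<comment> \<open>With X = Re Z, the products of Re Z with Re W and Im W vanish by assumption. The
    real and imaginary parts of d\<theta>(Z, W) = 0 then make those of Im Z with Im W and Re W
    vanish too, and the Levi form is built from these four numbers.\<close>
  have "levi_form A V \<theta> c p Z W = 0" if W: "W \<in> T c p" for W
  proof -
    have "contract X f (\<lambda>_. Re_vec W) = 0" "contract X f (\<lambda>_. Im_vec W) = 0"
      using om contact_kernel[OF th c p] Im_vec_H[OF c p(1) W] W H_eq[OF c p(1)] by auto
    then show ?thesis using dtheta_T[OF V th c p Z(1) W, folded f_def] Z(2)
      unfolding levi_form_def f_def[symmetric]
      by (simp add: complexify2_def Let_def e Re_vec_cnj Im_vec_cnj complex_eq_iff neg)
  qed
  moreover have "nondegenerate_hermitian_on (T c p) (levi_form A V \<theta> c p)"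
    by (rule levi_nondegenerate[OF V th c p])
  ultimately have "Z = 0" using Z(1) unfolding nondegenerate_hermitian_on_def by blast
  then show "X = 0" using Z(2) by (simp add: Re_vec_0)
  qed
qed

lemma contact_open_at:
  assumes V: "open V" and th: "\<theta> \<in> contact_forms A T V" and c: "c \<in> A"
  shows "contact_open (img c V) (loc \<theta> c) (loc (ext_deriv A V 1 \<theta>) c) n"
proof (rule contact_open.intro)
  show "sform (img c V) (Suc 0) (loc \<theta> c)" by (rule sform_loc[OF contact_forms_form[OF th] c])
  show "sform (img c V) 2 (loc (ext_deriv A V 1 \<theta>) c)"
    using sform_loc[OF ext_deriv_forms[OF contact_forms_form[OF th] V] c] by (simp add: numeral_2_eq_2)
  show "contact_point (loc \<theta> c x) (loc (ext_deriv A V 1 \<theta>) c x) n" if "x \<in> img c V" for x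
    using imgE[OF c that] contact_point_at[OF V th c] c by (metis loc_chart)
qed (use open_img[OF c V] dim in auto)

end

section \<open>Solving the Rumin condition\<close>

lemma Ck_on_local:
  assumes "\<And>x. x \<in> S \<Longrightarrow> \<exists>U. open U \<and> x \<in> U \<and> Ck_on k U f"
  shows "Ck_on k S f"
  using assms
proof (induction k arbitrary: f)
  case 0
  show ?case unfolding Ck_on.simps
  proof (rule continuous_at_imp_continuous_on, rule ballI)
    fix x assume "x \<in> S"
    then obtain U where "open U" "x \<in> U" "continuous_on U f" using 0 by (metis Ck_on.simps(1))
    then show "isCont f x" by (simp add: continuous_on_eq_continuous_at)
  qed
next
  case (Suc k)
  show ?case unfolding Ck_on.simps
  proof (intro conjI ballI allI)
    show "f differentiable at x" if "x \<in> S" for x using Suc.prems[OF that] by auto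
    show "Ck_on k S (\<lambda>x. frechet_derivative f (at x) v)" for v
    proof (rule Suc.IH)
      show "\<exists>U. open U \<and> x \<in> U \<and> Ck_on k U (\<lambda>x. frechet_derivative f (at x) v)" if "x \<in> S" for x
        using Suc.prems[OF that] by auto
    qed
  qed
qed

text \<open>Smoothness is local. This is what shows that a form defined point by point, by
  uniqueness, is smooth.\<close>

lemma sform_local:
  assumes "\<And>x. x \<in> S \<Longrightarrow> \<exists>U G. open U \<and> x \<in> U \<and> sform U k G \<and> (\<forall>y\<in>U. G y = F y)"
  shows "sform S k F"
proof (rule sformI)
  fix x assume "x \<in> S"
  then obtain U G where "x \<in> U" "sform U k G" "\<forall>y\<in>U. G y = F y" using assms by blast
  then show "F x \<in> alt_forms k" using sformD(1)[of U k G x] by simp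
next
  fix v
  show "smooth_on S (\<lambda>x. F x v)"
    unfolding smooth_on_def
  proof (intro allI Ck_on_local)
    fix j x assume "x \<in> S"
    then obtain U G where U: "open U" "x \<in> U" "sform U k G" "\<forall>y\<in>U. G y = F y" using assms by blast
    have "smooth_on U (\<lambda>x. F x v)"
      by (rule smooth_on_cong[OF U(1) _ sformD(2)[OF U(3), of v]]) (use U(4) in simp)
    then show "\<exists>U. open U \<and> x \<in> U \<and> Ck_on j U (\<lambda>x. F x v)" using U unfolding smooth_on_def by blast
  qed
qed

text \<open>For \<open>\<eta>\<close> of degree \<open>k\<close> the two cases \<open>k \<le> n\<close> and \<open>k > n\<close> of the Rumin condition are treated
  simultaneously: with the truncated differences \<open>e = n + 1 - k\<close> and \<open>i = k - (n + 1)\<close>, one of which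
  is zero, the condition reads \<open>\<theta> \<and> \<eta> \<and> d\<theta>\<^sup>e = 0\<close>, and it is corrected by \<open>d\<beta>\<close>, where
  \<open>\<beta> = d\<theta>\<^sup>i \<and> \<mu>\<close> and \<open>\<mu>\<close> is the solution of \<open>\<theta> \<and> \<mu> = 0\<close>,
  \<open>d\<theta> \<and> d\<theta>\<^sup>e \<and> d\<theta>\<^sup>i \<and> \<mu> = \<theta> \<and> \<eta> \<and> d\<theta>\<^sup>e\<close>.\<close>

definition rumin_correction ::
  "nat \<Rightarrow> nat \<Rightarrow> ((nat \<Rightarrow> 'v) \<Rightarrow> real) \<Rightarrow> ((nat \<Rightarrow> 'v) \<Rightarrow> real) \<Rightarrow> ((nat \<Rightarrow> 'v::real_vector) \<Rightarrow> real)
     \<Rightarrow> ((nat \<Rightarrow> 'v) \<Rightarrow> real) \<Rightarrow> bool" where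
  "rumin_correction n k \<theta> \<Omega> \<eta> \<beta> \<longleftrightarrow>
     (let e = Suc n - k; i = k - Suc n; m = n - (e + i) in
      \<exists>\<mu>\<in>alt_forms m. alt_wedge (Suc 0) m \<theta> \<mu> = (\<lambda>v. 0) \<and>
        lef (Suc (e + i)) m \<Omega> \<mu> = lef e (Suc k) \<Omega> (alt_wedge (Suc 0) k \<theta> \<eta>) \<and>
        \<beta> = lef i m \<Omega> \<mu>)"

text \<open>In order: the degree of \<beta>, the balance asked by \<open>lef_injective\<close>, the
  degree of the right-hand side, and the degree and range in \<open>lef_surjective\<close>. Since e
  or i is zero, the truncated differences cause no loss.\<close>

lemma correction_degrees:
  fixes n k :: nat
  defines "e \<equiv> Suc n - k" and "i \<equiv> k - Suc n"
  assumes "0 < k" "k \<le> 2 * n + 1"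
  shows "n - (e + i) + 2 * i = k - 1" "n - (e + i) + Suc (e + i) = n + 1"
    "Suc k + 2 * e = n + 1 + Suc (e + i)" "n + 1 - Suc (e + i) = n - (e + i)" "Suc (e + i) \<le> n + 1"
  using assms by (cases "k \<le> n"; simp add: e_def i_def)+

lemma (in contact_point) rumin_correction_unique:
  assumes k: "0 < k" "k \<le> 2 * n + 1"
    and "rumin_correction n k \<theta> \<Omega> \<eta> \<beta>" "rumin_correction n k \<theta> \<Omega> \<eta> \<beta>'"
  shows "\<beta> = \<beta>'"
proof -
  define e i where "e = Suc n - k" and "i = k - Suc n"
  let ?m = "n - (e + i)"
  obtain \<mu> where mu: "\<mu> \<in> alt_forms ?m" "alt_wedge (Suc 0) ?m \<theta> \<mu> = (\<lambda>v. 0)"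
      "lef (Suc (e + i)) ?m \<Omega> \<mu> = lef e (Suc k) \<Omega> (alt_wedge (Suc 0) k \<theta> \<eta>)" "\<beta> = lef i ?m \<Omega> \<mu>"
    using assms(3) unfolding rumin_correction_def Let_def e_def i_def by blast
  obtain \<mu>' where mu': "\<mu>' \<in> alt_forms ?m" "alt_wedge (Suc 0) ?m \<theta> \<mu>' = (\<lambda>v. 0)"
      "lef (Suc (e + i)) ?m \<Omega> \<mu>' = lef e (Suc k) \<Omega> (alt_wedge (Suc 0) k \<theta> \<eta>)" "\<beta>' = lef i ?m \<Omega> \<mu>'"
    using assms(4) unfolding rumin_correction_def Let_def e_def i_def by blast
  have "(\<lambda>v. \<mu> v - \<mu>' v) = (\<lambda>v. 0)"
  proof (rule lef_injective)
    show "?m + Suc (e + i) = n + 1" using correction_degrees(2)[OF k] by (simp add: e_def i_def)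
    show "(\<lambda>v. \<mu> v - \<mu>' v) \<in> alt_forms ?m" by (rule alt_forms_diff[OF mu(1) mu'(1)])
  qed (simp_all add: alt_wedge_diff_right lef_diff mu(2,3) mu'(2,3) del: lef.simps)
  then have "\<mu> = \<mu>'" by (simp add: fun_eq_iff)
  then show ?thesis by (simp add: mu(4) mu'(4))
qed

text \<open>The change of d\<theta> when \<theta> is multiplied by a function, with \<xi> in the
  role of the differential of the factor. The summand \<xi> \<and> \<theta> has no effect on forms
  killed by \<theta>.\<close>

lemma lef_rescaled:
  fixes \<Omega> :: "(nat \<Rightarrow> 'v::real_vector) \<Rightarrow> real"
  assumes th: "\<theta> \<in> alt_forms (Suc 0)" and om: "\<Omega> \<in> alt_forms 2" and xi: "\<xi> \<in> alt_forms (Suc 0)"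
    and om': "\<Omega>' = (\<lambda>v. f * \<Omega> v + alt_wedge (Suc 0) (Suc 0) \<xi> \<theta> v)"
    and mu: "\<mu> \<in> alt_forms m" "alt_wedge (Suc 0) m \<theta> \<mu> = (\<lambda>v. 0)"
  shows "lef j m \<Omega>' \<mu> = (\<lambda>v. f ^ j * lef j m \<Omega> \<mu> v)"
proof (induction j)
  case (Suc j)
  have l: "lef j m \<Omega> \<mu> \<in> alt_forms (m + 2 * j)" by (rule lef_alt_forms[OF om mu(1)])
  have "alt_wedge (Suc 0) (m + 2 * j) \<theta> (lef j m \<Omega> \<mu>) = (\<lambda>v. 0)"
    by (simp add: lef_wedge_1[OF om mu(1) th] mu(2))
  then have "alt_wedge 2 (m + 2 * j) (alt_wedge (Suc 0) (Suc 0) \<xi> \<theta>) (lef j m \<Omega> \<mu>) = (\<lambda>v. 0)"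
    using alt_wedge_assoc[OF xi th l] by (simp add: numeral_2_eq_2)
  then have "alt_wedge 2 (m + 2 * j) \<Omega>' (lef j m \<Omega> \<mu>) = (\<lambda>v. f * alt_wedge 2 (m + 2 * j) \<Omega> (lef j m \<Omega> \<mu>) v)"
    unfolding om' alt_wedge_add_left alt_wedge_scale_left by simp
  then show ?case by (simp add: Suc.IH alt_wedge_scale_right mult_ac)
qed simp

lemma rumin_correction_rescale:
  fixes \<theta> :: "(nat \<Rightarrow> 'v::real_vector) \<Rightarrow> real"
  assumes th: "\<theta> \<in> alt_forms (Suc 0)" and om: "\<Omega> \<in> alt_forms 2" and xi: "\<xi> \<in> alt_forms (Suc 0)"
    and f: "f \<noteq> 0" and th': "\<theta>' = (\<lambda>v. f * \<theta> v)"
    and om': "\<Omega>' = (\<lambda>v. f * \<Omega> v + alt_wedge (Suc 0) (Suc 0) \<xi> \<theta> v)"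
    and et: "\<eta> \<in> alt_forms k" and sol: "rumin_correction n k \<theta> \<Omega> \<eta> \<beta>"
  shows "rumin_correction n k \<theta>' \<Omega>' \<eta> \<beta>"
proof -
  define e i where "e = Suc n - k" and "i = k - Suc n"
  let ?m = "n - (e + i)"
  obtain \<mu> where mu: "\<mu> \<in> alt_forms ?m" "alt_wedge (Suc 0) ?m \<theta> \<mu> = (\<lambda>v. 0)"
      "lef (Suc (e + i)) ?m \<Omega> \<mu> = lef e (Suc k) \<Omega> (alt_wedge (Suc 0) k \<theta> \<eta>)" "\<beta> = lef i ?m \<Omega> \<mu>"
    using sol unfolding rumin_correction_def Let_def e_def i_def by blast
  note resc = lef_rescaled[OF th om xi om']
  have te: "alt_wedge (Suc 0) k \<theta> \<eta> \<in> alt_forms (Suc k)" using alt_wedge_alt_forms[OF th et] by simp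
  have tte: "alt_wedge (Suc 0) (Suc k) \<theta> (alt_wedge (Suc 0) k \<theta> \<eta>) = (\<lambda>v. 0)"
    using alt_wedge_assoc[OF th th et] by (simp add: alt_wedge_1_1_self[OF th])
  \<comment> \<open>The right-hand side of the equation for \<mu> scales by f^(e + 1) and the
    operator on the left by f^(e + i + 1), so \<mu> scales by f^(-i). This cancels the factor f^i of
    the operator that produces \<beta>.\<close>
  let ?mu = "\<lambda>v. inverse (f ^ i) * \<mu> v"
  have 1: "?mu \<in> alt_forms ?m" by (rule alt_forms_scale[OF mu(1)])
  have 2: "alt_wedge (Suc 0) ?m \<theta> ?mu = (\<lambda>v. 0)" by (simp add: alt_wedge_scale_right mu(2))
  show ?thesis
    unfolding rumin_correction_def Let_def e_def[symmetric] i_def[symmetric]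
  proof (intro bexI conjI)
    show "alt_wedge (Suc 0) ?m \<theta>' ?mu = (\<lambda>v. 0)" unfolding th' alt_wedge_scale_left 2 by simp
    show "lef (Suc (e + i)) ?m \<Omega>' ?mu = lef e (Suc k) \<Omega>' (alt_wedge (Suc 0) k \<theta>' \<eta>)"
      unfolding th' alt_wedge_scale_left lef_scale resc[OF mu(1,2)] resc[OF te tte] mu(3)
      using f by (simp add: fun_eq_iff power_add del: lef.simps)
    show "\<beta> = lef i ?m \<Omega>' ?mu"
      unfolding lef_scale resc[OF mu(1,2)] mu(4) using f by (simp add: fun_eq_iff)
    show "?mu \<in> alt_forms ?m" by (rule 1)
  qed
qed

lemma rumin_correction_pullback:
  assumes L: "linear L" and sol: "rumin_correction n k \<theta> \<Omega> \<eta> \<beta>"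
  shows "rumin_correction n k (\<lambda>v. \<theta> (\<lambda>i. L (v i))) (\<lambda>v. \<Omega> (\<lambda>i. L (v i))) (\<lambda>v. \<eta> (\<lambda>i. L (v i)))
    (\<lambda>v. \<beta> (\<lambda>i. L (v i)))"
proof -
  define e i where "e = Suc n - k" and "i = k - Suc n"
  let ?m = "n - (e + i)"
  obtain \<mu> where mu: "\<mu> \<in> alt_forms ?m" "alt_wedge (Suc 0) ?m \<theta> \<mu> = (\<lambda>v. 0)"
      "lef (Suc (e + i)) ?m \<Omega> \<mu> = lef e (Suc k) \<Omega> (alt_wedge (Suc 0) k \<theta> \<eta>)" "\<beta> = lef i ?m \<Omega> \<mu>"
    using sol unfolding rumin_correction_def Let_def e_def i_def by blast
  show ?thesis
    unfolding rumin_correction_def Let_def e_def[symmetric] i_def[symmetric] alt_wedge_pullback lef_pullback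
    by (intro bexI[of _ "\<lambda>v. \<mu> (\<lambda>i. L (v i))"] conjI)
      (simp_all add: alt_wedge_pullback lef_pullback mu(2,3,4) alt_forms_pullback[OF mu(1) L] del: lef.simps)
qed

context contact_open
begin

lemma rumin_correction_exists:
  assumes k: "0 < k" "k \<le> 2 * n + 1" and et: "sform S k \<eta>"
  obtains \<beta> where "sform S (k - 1) \<beta>" "\<And>x. x \<in> S \<Longrightarrow> rumin_correction n k (\<theta> x) (\<Omega> x) (\<eta> x) (\<beta> x)"
proof -
  define e i where "e = Suc n - k" and "i = k - Suc n"
  let ?m = "n - (e + i)"
  note deg = correction_degrees[OF k, folded e_def i_def]
  let ?te = "\<lambda>x. alt_wedge (Suc 0) k (\<theta> x) (\<eta> x)"
  let ?r = "\<lambda>x. lef e (Suc k) (\<Omega> x) (?te x)"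
  have te: "sform S (Suc k) ?te" using sform_wedge[OF S th_form et] by simp
  have r: "sform S (n + 1 + Suc (e + i)) ?r" using sform_lef[OF S om_form te, of e] unfolding deg(3) .
  \<comment> \<open>The right-hand side contains the factor \<theta>, so \<theta> \<and> \<theta> =
    0 puts it in the domain of the Lefschetz inverse.\<close>
  have thr: "alt_wedge (Suc 0) (n + 1 + Suc (e + i)) (\<theta> x) (?r x) = (\<lambda>v. 0)" if x: "x \<in> S" for x
  proof -
    note t = sformD(1)[OF th_form x] and o = sformD(1)[OF om_form x] and h = sformD(1)[OF et x]
    have "alt_wedge (Suc 0) (Suc k) (\<theta> x) (?te x) = (\<lambda>v. 0)"
      using alt_wedge_assoc[OF t t h] by (simp add: alt_wedge_1_1_self[OF t])
    then show ?thesis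
      unfolding deg(3)[symmetric] lef_wedge_1[OF o sformD(1)[OF te x] t] by simp
  qed
  obtain \<mu> where mu: "sform S ?m \<mu>" "\<And>x. x \<in> S \<Longrightarrow> alt_wedge (Suc 0) ?m (\<theta> x) (\<mu> x) = (\<lambda>v. 0)"
    "\<And>x. x \<in> S \<Longrightarrow> lef (Suc (e + i)) ?m (\<Omega> x) (\<mu> x) = ?r x"
    using lef_surjective[OF deg(5) r thr] unfolding deg(4) by blast
  show ?thesis
  proof (rule that)
    show "sform S (k - 1) (\<lambda>x. lef i ?m (\<Omega> x) (\<mu> x))"
      using sform_lef[OF S om_form mu(1), of i] unfolding deg(1) .
    show "rumin_correction n k (\<theta> x) (\<Omega> x) (\<eta> x) (lef i ?m (\<Omega> x) (\<mu> x))" if x: "x \<in> S" for x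
      unfolding rumin_correction_def Let_def e_def[symmetric] i_def[symmetric]
      using mu(2,3)[OF x] sformD(1)[OF mu(1) x] by blast
  qed
qed

text \<open>\<open>d(\<theta> \<and> \<beta>) = 0\<close> gives \<open>\<theta> \<and> d\<beta> = d\<theta> \<and> \<beta>\<close>.\<close>

lemma rumin_correction_works:
  assumes k: "0 < k" "k \<le> 2 * n + 1" and be: "sform S (k - 1) \<beta>"
    and om: "\<And>x. x \<in> S \<Longrightarrow> \<Omega> x = extd (Suc 0) \<theta> x"
    and sol: "\<And>x. x \<in> S \<Longrightarrow> rumin_correction n k (\<theta> x) (\<Omega> x) (\<eta> x) (\<beta> x)"
    and x: "x \<in> S"
  shows "lef (Suc n - k) (Suc k) (\<Omega> x) (alt_wedge (Suc 0) k (\<theta> x) (extd (k - 1) \<beta> x)) =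
    lef (Suc n - k) (Suc k) (\<Omega> x) (alt_wedge (Suc 0) k (\<theta> x) (\<eta> x))"
proof -
  define e i where "e = Suc n - k" and "i = k - Suc n"
  let ?m = "n - (e + i)"
  note deg = correction_degrees[OF k, folded e_def i_def]
  obtain j where j: "k = Suc j" using k(1) by (cases k) auto
  have ex: "\<exists>\<mu>\<in>alt_forms ?m. alt_wedge (Suc 0) ?m (\<theta> y) \<mu> = (\<lambda>v. 0) \<and>
      lef (Suc (e + i)) ?m (\<Omega> y) \<mu> = lef e (Suc k) (\<Omega> y) (alt_wedge (Suc 0) k (\<theta> y) (\<eta> y)) \<and> \<beta> y = lef i ?m (\<Omega> y) \<mu>"
    if "y \<in> S" for y
    using sol[OF that] unfolding rumin_correction_def Let_def e_def i_def .
  have z: "alt_wedge (Suc 0) j (\<theta> y) (\<beta> y) = (\<lambda>v. 0)" if y: "y \<in> S" for y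
  proof -
    obtain \<mu> where mu: "\<mu> \<in> alt_forms ?m" "alt_wedge (Suc 0) ?m (\<theta> y) \<mu> = (\<lambda>v. 0)" "\<beta> y = lef i ?m (\<Omega> y) \<mu>"
      using ex[OF y] by blast
    show ?thesis
      using lef_wedge_1[OF sformD(1)[OF om_form y] mu(1) sformD(1)[OF th_form y], of i] deg(1) j
      by (simp add: mu(2,3))
  qed
  have be': "sform S j \<beta>" using be j by simp
  \<comment> \<open>The equation \<theta> \<and> \<beta> = 0 holds on the whole open set and may be
    differentiated.\<close>
  have "extd (Suc j) (\<lambda>y. alt_wedge (Suc 0) j (\<theta> y) (\<beta> y)) x = extd (Suc j) (\<lambda>y v. 0) x"
    by (rule extd_cong[OF S x z]) (use sform_wedge[OF S th_form be'] in simp_all)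
  then have d: "alt_wedge (Suc 0) k (\<theta> x) (extd j \<beta> x) = alt_wedge 2 j (\<Omega> x) (\<beta> x)"
    using extd_wedge[OF S th_form be' x, folded om[OF x]] j by (simp add: fun_eq_iff numeral_2_eq_2)
  obtain \<mu> where mu: "lef (Suc (e + i)) ?m (\<Omega> x) \<mu> = lef e (Suc k) (\<Omega> x) (alt_wedge (Suc 0) k (\<theta> x) (\<eta> x))"
      "\<beta> x = lef i ?m (\<Omega> x) \<mu>"
    using ex[OF x] by blast
  have "lef e (Suc k) (\<Omega> x) (alt_wedge 2 j (\<Omega> x) (\<beta> x)) = lef (Suc e) j (\<Omega> x) (\<beta> x)"
    using lef_Suc'[of e j "\<Omega> x" "\<beta> x"] j by (simp del: lef.simps)
  also have "\<dots> = lef (Suc e + i) ?m (\<Omega> x) \<mu>"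
    using lef_lef[of "Suc e" i ?m "\<Omega> x" \<mu>] deg(1) j mu(2) by simp
  finally show ?thesis using mu(1) d j unfolding e_def[symmetric] by simp
qed

end

context cr_mfd
begin

abbreviation d\<theta> :: "'m set \<Rightarrow> ('m, 'd) form \<Rightarrow> ('m, 'd) form" where
  "d\<theta> V \<theta> \<equiv> ext_deriv A V 1 \<theta>"

text \<open>Two contact forms have the same kernel H, so they differ by a nowhere zero factor f, and
  \<xi> is df at the point.\<close>

lemma contact_forms_related:
  assumes V: "open V" and th: "\<theta> \<in> contact_forms A T V" and V': "open V'" and th': "\<theta>' \<in> contact_forms A T V'"
    and c: "c \<in> A" and p: "p \<in> dom_of c" "p \<in> V" "p \<in> V'"
  obtains f \<xi> where "f \<noteq> 0" "\<xi> \<in> alt_forms (Suc 0)" "\<theta>' c p = (\<lambda>v. f * \<theta> c p v)"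
    "d\<theta> V' \<theta>' c p = (\<lambda>v. f * d\<theta> V \<theta> c p v + alt_wedge (Suc 0) (Suc 0) \<xi> (\<theta> c p) v)"
proof -
  let ?S = "img c (V \<inter> V')" and ?x = "snd c p"
  have S: "open ?S" using V V' c by (intro open_img open_Int)
  have x: "?x \<in> ?S" using p by (auto intro: imgI)
  have F: "sform ?S (Suc 0) (loc \<theta> c)" and F': "sform ?S (Suc 0) (loc \<theta>' c)"
    using sform_subset[OF sform_loc[OF contact_forms_form[OF th] c] img_mono]
      sform_subset[OF sform_loc[OF contact_forms_form[OF th'] c] img_mono] by blast+
  interpret co: contact_open "img c V" "loc \<theta> c" "loc (d\<theta> V \<theta>) c" n
    by (rule contact_open_at[OF V th c])
  \<comment> \<open>On the transversal field of \<open>\<theta>\<close> the form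
    \<open>\<theta>\<close> is 1, so evaluating \<open>\<theta>'\<close> there yields the factor as
    a smooth function.\<close>
  define f where "f y = loc \<theta>' c y (\<lambda>_. co.transversal y)" for y
  have VS: "?S \<subseteq> img c V" by (rule img_mono) simp
  have fs: "smooth_on ?S f"
  proof (rule smooth_on_cong[OF S])
    show "smooth_on ?S (\<lambda>y. \<Sum>b\<in>UNIV. loc \<theta>' c y (\<lambda>_. axis b 1) * co.transversal y $ b)"
      by (intro smooth_on_sum smooth_on_mult S sformD(2)[OF F'] smooth_on_subset[OF co.smooth_transversal VS])
    show "(\<Sum>b\<in>UNIV. loc \<theta>' c y (\<lambda>_. axis b 1) * co.transversal y $ b) = f y" if "y \<in> ?S" for y
      unfolding f_def by (rule one_form_expand(2)[OF sformD(1)[OF F' that], symmetric])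
  qed
  have eq: "loc \<theta>' c y = (\<lambda>v. f y * loc \<theta> c y v)" if y: "y \<in> ?S" for y
  proof -
    obtain q where q: "q \<in> dom_of c" "q \<in> V" "q \<in> V'" "y = snd c q" using imgE[OF c y] by blast
    have a: "loc \<theta> c y \<in> alt_forms (Suc 0)" "loc \<theta>' c y \<in> alt_forms (Suc 0)"
      using sformD(1)[OF F y] sformD(1)[OF F' y] .
    note lin = contract_linear[OF a(1), unfolded contract_1_form[OF a(1)]]
      and lin' = contract_linear[OF a(2), unfolded contract_1_form[OF a(2)]]
    have k: "loc \<theta> c y (\<lambda>_. v) = 0 \<longleftrightarrow> loc \<theta>' c y (\<lambda>_. v) = 0" for v
      using contact_kernel[OF th c q(1,2)] contact_kernel[OF th' c q(1,3)] q c by simp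
    have one: "loc \<theta>' c y (\<lambda>_. v) = f y * loc \<theta> c y (\<lambda>_. v)" for v
    proof -
      have "loc \<theta> c y (\<lambda>_. v - loc \<theta> c y (\<lambda>_. v) *\<^sub>R co.transversal y) = 0"
        using co.th_transversal[of y] VS y by (auto simp: linear_diff[OF lin] linear_scale[OF lin])
      then have "loc \<theta>' c y (\<lambda>_. v - loc \<theta> c y (\<lambda>_. v) *\<^sub>R co.transversal y) = 0" unfolding k .
      then show ?thesis by (simp add: linear_diff[OF lin'] linear_scale[OF lin'] f_def mult.commute)
    qed
    show ?thesis
    proof
      fix v
      have "loc \<theta>' c y v = loc \<theta>' c y (\<lambda>_. v 0)" "loc \<theta> c y v = loc \<theta> c y (\<lambda>_. v 0)"
        by (rule alt_forms_cong[OF a(2)] alt_forms_cong[OF a(1)]; simp)+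
      then show "loc \<theta>' c y v = f y * loc \<theta> c y v" using one[of "v 0"] by simp
    qed
  qed
  have f0: "sform ?S 0 (\<lambda>y v. f y)" by (rule sformI) (simp_all add: fs)
  define \<xi> where "\<xi> = extd 0 (\<lambda>y v. f y) ?x"
  have xi: "\<xi> \<in> alt_forms (Suc 0)" unfolding \<xi>_def by (rule extd_alt_forms[OF S f0 x])
  have dF: "extd (Suc 0) (loc \<theta> c) ?x \<in> alt_forms (Suc (Suc 0))" by (rule extd_alt_forms[OF S F x])
  have w: "alt_wedge 0 (Suc 0) (\<lambda>v. f y) (loc \<theta> c y) = loc \<theta>' c y" if "y \<in> ?S" for y
    using alt_wedge_const_left[OF sformD(1)[OF F that]] eq[OF that] by simp
  have "extd (Suc 0) (loc \<theta>' c) ?x = extd (Suc 0) (\<lambda>y. alt_wedge 0 (Suc 0) (\<lambda>v. f y) (loc \<theta> c y)) ?x"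
    by (rule extd_cong[OF S x w[symmetric] F'])
  also have "\<dots> = (\<lambda>v. alt_wedge (Suc 0) (Suc 0) \<xi> (loc \<theta> c ?x) v + f ?x * extd (Suc 0) (loc \<theta> c) ?x v)"
    using extd_wedge[OF S f0 F x] by (simp add: \<xi>_def alt_wedge_const_left[OF dF])
  finally have d: "d\<theta> V' \<theta>' c p = (\<lambda>v. f ?x * d\<theta> V \<theta> c p v + alt_wedge (Suc 0) (Suc 0) \<xi> (\<theta> c p) v)"
    using c p by (simp add: ext_deriv_eq add.commute)
  have e: "\<theta>' c p = (\<lambda>v. f ?x * \<theta> c p v)" using eq[OF x] c p by simp
  have "f ?x \<noteq> 0"
    using contact_point.nz[OF contact_point_at[OF V' th' c p(1,3)]] by (auto simp: e)
  then show ?thesis using that xi e d by blast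
qed

text \<open>Some contact form near p is allowed to witness the condition; by
  \<open>is_correctionD\<close> every other one then does as well, so the notion refers to no
  choice.\<close>

definition is_correction :: "nat \<Rightarrow> ('m, 'd) form \<Rightarrow> ('m, 'd) chart \<Rightarrow> 'm \<Rightarrow> ((nat \<Rightarrow> real^'d) \<Rightarrow> real) \<Rightarrow> bool" where
  "is_correction k \<eta> c p b \<longleftrightarrow> (\<exists>V \<theta>. open V \<and> p \<in> V \<and> \<theta> \<in> contact_forms A T V \<and>
     rumin_correction n k (\<theta> c p) (d\<theta> V \<theta> c p) (\<eta> c p) b)"

lemma is_correctionD:
  assumes b: "is_correction k \<eta> c p b" and et: "\<eta> \<in> forms A UNIV k" and c: "c \<in> A" and p: "p \<in> dom_of c" "p \<in> V"
    and V: "open V" and th: "\<theta> \<in> contact_forms A T V"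
  shows "rumin_correction n k (\<theta> c p) (d\<theta> V \<theta> c p) (\<eta> c p) b"
proof -
  obtain W \<tau> where W: "open W" "p \<in> W" "\<tau> \<in> contact_forms A T W"
    "rumin_correction n k (\<tau> c p) (d\<theta> W \<tau> c p) (\<eta> c p) b"
    using b unfolding is_correction_def by blast
  obtain f \<xi> where f: "f \<noteq> 0" "\<xi> \<in> alt_forms (Suc 0)" "\<theta> c p = (\<lambda>v. f * \<tau> c p v)"
    "d\<theta> V \<theta> c p = (\<lambda>v. f * d\<theta> W \<tau> c p v + alt_wedge (Suc 0) (Suc 0) \<xi> (\<tau> c p) v)"
    by (rule contact_forms_related[OF W(1,3) V th c p(1) W(2) p(2)])
  interpret contact_point "\<tau> c p" "d\<theta> W \<tau> c p" n
    by (rule contact_point_at[OF W(1,3) c p(1) W(2)])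
  show ?thesis
    by (rule rumin_correction_rescale[OF th om f(2,1,3,4) forms_alt[OF et c p(1)] W(4)]) simp
qed

lemma is_correction_unique:
  assumes k: "0 < k" "k \<le> 2 * n + 1" and et: "\<eta> \<in> forms A UNIV k" and c: "c \<in> A" and p: "p \<in> dom_of c"
    and b: "is_correction k \<eta> c p b" "is_correction k \<eta> c p b'"
  shows "b = b'"
proof -
  obtain V \<theta> where V: "open V" "p \<in> V" "\<theta> \<in> contact_forms A T V" by (rule contact_form_exists)
  show ?thesis
    using contact_point.rumin_correction_unique[OF contact_point_at[OF V(1,3) c p V(2)] k]
      is_correctionD[OF _ et c p V(2,1,3)] b by blast
qed

lemma is_correction_local:
  assumes k: "0 < k" "k \<le> 2 * n + 1" and et: "\<eta> \<in> forms A UNIV k" and c: "c \<in> A" and p: "p \<in> dom_of c"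
  obtains V \<beta> where "open V" "p \<in> V" "sform (img c V) (k - 1) \<beta>"
    "\<And>q. q \<in> dom_of c \<Longrightarrow> q \<in> V \<Longrightarrow> is_correction k \<eta> c q (\<beta> (snd c q))"
proof -
  obtain V \<theta> where V: "open V" "p \<in> V" "\<theta> \<in> contact_forms A T V" by (rule contact_form_exists)
  interpret co: contact_open "img c V" "loc \<theta> c" "loc (d\<theta> V \<theta>) c" n
    by (rule contact_open_at[OF V(1,3) c])
  have "sform (img c V) k (loc \<eta> c)" by (rule sform_subset[OF sform_loc[OF et c] img_mono]) simp
  from co.rumin_correction_exists[OF k this] obtain \<beta> where
    be: "sform (img c V) (k - 1) \<beta>"
    and sol: "\<And>x. x \<in> img c V \<Longrightarrow> rumin_correction n k (loc \<theta> c x) (loc (d\<theta> V \<theta>) c x) (loc \<eta> c x) (\<beta> x)"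
    by blast
  show ?thesis
  proof (rule that[OF V(1,2) be])
    show "is_correction k \<eta> c q (\<beta> (snd c q))" if q: "q \<in> dom_of c" "q \<in> V" for q
      using sol[OF imgI[OF q]] V q c unfolding is_correction_def by auto
  qed
qed

lemma is_correction_compat:
  assumes et: "\<eta> \<in> forms A UNIV k" and c: "c \<in> A" "c' \<in> A" and p: "p \<in> dom_of c" "p \<in> dom_of c'"
    and b: "is_correction k \<eta> c' p b"
  shows "is_correction k \<eta> c p (\<lambda>v. b (\<lambda>i. jacobian c c' p (v i)))"
proof -
  obtain V \<theta> where V: "open V" "p \<in> V" "\<theta> \<in> contact_forms A T V"
    "rumin_correction n k (\<theta> c' p) (d\<theta> V \<theta> c' p) (\<eta> c' p) b"
    using b unfolding is_correction_def by blast
  note th = contact_forms_form[OF V(3)]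
  have e: "d\<theta> V \<theta> c p = (\<lambda>v. d\<theta> V \<theta> c' p (\<lambda>i. jacobian c c' p (v i)))"
    using forms_compat[OF ext_deriv_forms[OF th V(1)] c p V(2)] by simp
  have "rumin_correction n k (\<theta> c p) (d\<theta> V \<theta> c p) (\<eta> c p) (\<lambda>v. b (\<lambda>i. jacobian c c' p (v i)))"
    unfolding e forms_compat[OF th c p V(2)] forms_compat[OF et c p UNIV_I]
    by (rule rumin_correction_pullback[OF linear_jacobian[OF c p] V(4)])
  then show ?thesis using V(1-3) unfolding is_correction_def by blast
qed

text \<open>The global object is defined point by point as the unique solution. The default value
  zero is the convention that \<open>forms\<close> imposes outside charts.\<close>

definition correction :: "nat \<Rightarrow> ('m, 'd) form \<Rightarrow> ('m, 'd) form" where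
  "correction k \<eta> = (\<lambda>c p. if c \<in> A \<and> p \<in> dom_of c then THE b. is_correction k \<eta> c p b else (\<lambda>v. 0))"

lemma correction_eqI:
  assumes "0 < k" "k \<le> 2 * n + 1" "\<eta> \<in> forms A UNIV k" "c \<in> A" "p \<in> dom_of c" "is_correction k \<eta> c p b"
  shows "correction k \<eta> c p = b"
proof -
  have "correction k \<eta> c p = (THE b. is_correction k \<eta> c p b)"
    using assms(4,5) by (simp add: correction_def)
  also have "\<dots> = b"
    by (rule the_equality) (rule assms(6), rule is_correction_unique[OF assms(1-5) _ assms(6)])
  finally show ?thesis .
qed

lemma correction_is_correction:
  assumes "0 < k" "k \<le> 2 * n + 1" "\<eta> \<in> forms A UNIV k" "c \<in> A" "p \<in> dom_of c"
  shows "is_correction k \<eta> c p (correction k \<eta> c p)"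
proof -
  obtain V \<beta> where "p \<in> V" "\<And>q. q \<in> dom_of c \<Longrightarrow> q \<in> V \<Longrightarrow> is_correction k \<eta> c q (\<beta> (snd c q))"
    by (rule is_correction_local[OF assms]) blast
  then have "is_correction k \<eta> c p (\<beta> (snd c p))" using assms(5) by blast
  then show ?thesis using correction_eqI[OF assms] by simp
qed

text \<open>Uniqueness does both jobs: near each point the global object agrees with a smooth local
  solution, and its representatives in two charts are related because the pulled back solution
  solves the equation in the other chart.\<close>

lemma correction_forms:
  assumes k: "0 < k" "k \<le> 2 * n + 1" and et: "\<eta> \<in> forms A UNIV k"
  shows "correction k \<eta> \<in> forms A UNIV (k - 1)"
proof (rule formsI)
  fix c assume c: "c \<in> A"
  show "sform (img c UNIV) (k - 1) (loc (correction k \<eta>) c)"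
  proof (rule sform_local)
    fix x assume "x \<in> img c UNIV"
    then obtain p where p: "p \<in> dom_of c" "x = snd c p" using imgE[OF c] by blast
    obtain V \<beta> where V: "open V" "p \<in> V" "sform (img c V) (k - 1) \<beta>"
      and b: "\<And>q. q \<in> dom_of c \<Longrightarrow> q \<in> V \<Longrightarrow> is_correction k \<eta> c q (\<beta> (snd c q))"
      using is_correction_local[OF k et c p(1)] by metis
    have "\<beta> y = loc (correction k \<eta>) c y" if y: "y \<in> img c V" for y
    proof -
      obtain q where q: "q \<in> dom_of c" "q \<in> V" "y = snd c q" using imgE[OF c y] by blast
      then show ?thesis using correction_eqI[OF k et c q(1) b[OF q(1,2)]] c by simp
    qed
    then show "\<exists>U G. open U \<and> x \<in> U \<and> sform U (k - 1) G \<and> (\<forall>y\<in>U. G y = loc (correction k \<eta>) c y)"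
      using open_img[OF c V(1)] V(3) imgI[OF p(1) V(2)] p(2) by blast
  qed
next
  fix c c' p v assume c: "c \<in> A" "c' \<in> A" and p: "p \<in> dom_of c" "p \<in> dom_of c'"
  show "correction k \<eta> c p v = correction k \<eta> c' p (\<lambda>i. jacobian c c' p (v i))"
    using correction_eqI[OF k et c(1) p(1) is_correction_compat[OF et c p correction_is_correction[OF k et c(2) p(2)]]]
    by simp
qed (auto simp: correction_def)

text \<open>The first of the two Rumin conditions in all degrees at once: for k > n the truncated
  exponent \<open>Suc n - k\<close> is 0 and \<open>lef 0\<close> is the identity.\<close>

definition rumin_cond :: "nat \<Rightarrow> ('m, 'd) form \<Rightarrow> bool" where
  "rumin_cond k \<omega> \<longleftrightarrow> (\<forall>V \<theta> c p. open V \<and> \<theta> \<in> contact_forms A T V \<and> c \<in> A \<and> p \<in> dom_of c \<and> p \<in> V \<longrightarrow>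
     lef (Suc n - k) (Suc k) (d\<theta> V \<theta> c p) (alt_wedge (Suc 0) k (\<theta> c p) (\<omega> c p)) = (\<lambda>v. 0))"

lemma wedge_power2_eq: "wedge_power2 \<Omega> j c p = alt_power2 (\<Omega> c p) j"
  by (induction j) (simp_all add: wedge_def)

lemma wedge_lef_eq:
  assumes V: "open V" and th: "\<theta> \<in> contact_forms A T V" and w: "\<omega> \<in> forms A UNIV k"
  shows "wedge (k + 1) (2 * j) (wedge 1 k \<theta> \<omega>) (wedge_power2 (d\<theta> V \<theta>) j) = zero_form \<longleftrightarrow>
    (\<forall>c p. c \<in> A \<and> p \<in> dom_of c \<and> p \<in> V \<longrightarrow>
      lef j (Suc k) (d\<theta> V \<theta> c p) (alt_wedge (Suc 0) k (\<theta> c p) (\<omega> c p)) = (\<lambda>v. 0))"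
proof -
  have "wedge (k + 1) (2 * j) (wedge 1 k \<theta> \<omega>) (wedge_power2 (d\<theta> V \<theta>) j) c p =
      (if c \<in> A \<and> p \<in> dom_of c \<and> p \<in> V then lef j (Suc k) (d\<theta> V \<theta> c p) (alt_wedge (Suc 0) k (\<theta> c p) (\<omega> c p)) else (\<lambda>v. 0))" for c p
  proof (cases "c \<in> A \<and> p \<in> dom_of c \<and> p \<in> V")
    case True
    then have c: "c \<in> A" and p: "p \<in> dom_of c" "p \<in> V" by auto
    note cp = contact_point_at[OF V th c p]
    have "alt_wedge (Suc 0) k (\<theta> c p) (\<omega> c p) \<in> alt_forms (Suc k)"
      using alt_wedge_alt_forms[OF contact_point.th[OF cp] forms_alt[OF w c p(1)]] by simp
    from wedge_alt_power2[OF contact_point.om[OF cp] this, of j] show ?thesis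
      using True by (simp add: wedge_def wedge_power2_eq)
  next
    case False
    then have "\<theta> c p = (\<lambda>v. 0)" using forms_outside[OF contact_forms_form[OF th]] by blast
    then show ?thesis using False by (simp add: wedge_def)
  qed
  then show ?thesis by (simp add: fun_eq_iff zero_form_def)
qed

text \<open>Multiplication by the zeroth power of d\<theta> changes nothing, so the clause for k > n
  is the clause for k \<le> n with exponent 0.\<close>

lemma wedge_one_eq:
  "wedge 1 k \<theta> \<omega> = zero_form \<longleftrightarrow> wedge (k + 1) (2 * 0) (wedge 1 k \<theta> \<omega>) (wedge_power2 (d\<theta> V \<theta>) 0) = zero_form"
  if "open V" "\<theta> \<in> contact_forms A T V" "\<omega> \<in> forms A UNIV k"
proof -
  have "wedge (k + 1) (2 * 0) (wedge 1 k \<theta> \<omega>) (wedge_power2 (d\<theta> V \<theta>) 0) c p = wedge 1 k \<theta> \<omega> c p" for c p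
  proof (cases "c \<in> A \<and> p \<in> dom_of c \<and> p \<in> V")
    case True
    then have c: "c \<in> A" and p: "p \<in> dom_of c" "p \<in> V" by auto
    have "alt_wedge (Suc 0) k (\<theta> c p) (\<omega> c p) \<in> alt_forms (Suc k)"
      using alt_wedge_alt_forms[OF forms_alt[OF contact_forms_form[OF that(2)] c p] forms_alt[OF that(3) c p(1)]] by simp
    then show ?thesis by (simp add: wedge_def alt_wedge_const_right)
  next
    case False
    then have "\<theta> c p = (\<lambda>v. 0)" using forms_outside[OF contact_forms_form[OF that(2)]] by blast
    then show ?thesis by (simp add: wedge_def)
  qed
  then show ?thesis by (metis ext)
qed

text \<open>The exponent n - k in the second condition is Suc n - Suc k, so that condition is the
  first one for d\<omega> in degree k + 1.\<close>

lemma rumin_forms_iff: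
  "\<omega> \<in> rumin_forms n A T UNIV k \<longleftrightarrow> \<omega> \<in> forms A UNIV k \<and> rumin_cond k \<omega> \<and> rumin_cond (Suc k) (ext_deriv A UNIV k \<omega>)"
proof (cases "\<omega> \<in> forms A UNIV k")
  case w: True
  let ?dw = "ext_deriv A UNIV k \<omega>"
  have dw: "?dw \<in> forms A UNIV (Suc k)" by (rule ext_deriv_forms[OF w]) simp
  have e: "Suc n - Suc k = n - k" by simp
  have "(if k \<le> n then
          wedge (k + 1) (2 * (n + 1 - k)) (wedge 1 k \<theta> \<omega>) (wedge_power2 (d\<theta> V \<theta>) (n + 1 - k)) = zero_form \<and>
          wedge (k + 2) (2 * (n - k)) (wedge 1 (k + 1) \<theta> ?dw) (wedge_power2 (d\<theta> V \<theta>) (n - k)) = zero_form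
        else
          wedge 1 k \<theta> \<omega> = zero_form \<and>
          wedge 1 (k + 1) \<theta> ?dw = zero_form) \<longleftrightarrow>
     (\<forall>c p. c \<in> A \<and> p \<in> dom_of c \<and> p \<in> V \<longrightarrow>
       lef (Suc n - k) (Suc k) (d\<theta> V \<theta> c p) (alt_wedge (Suc 0) k (\<theta> c p) (\<omega> c p)) = (\<lambda>v. 0)) \<and>
     (\<forall>c p. c \<in> A \<and> p \<in> dom_of c \<and> p \<in> V \<longrightarrow>
       lef (Suc n - Suc k) (Suc (Suc k)) (d\<theta> V \<theta> c p) (alt_wedge (Suc 0) (Suc k) (\<theta> c p) (?dw c p)) = (\<lambda>v. 0))"
    if V: "open V" and th: "\<theta> \<in> contact_forms A T V" for V \<theta>
  proof (cases "k \<le> n")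
    case True
    then show ?thesis
      using wedge_lef_eq[OF V th w, of "n + 1 - k"] wedge_lef_eq[OF V th dw, of "n - k"] unfolding e by simp
  next
    case False
    then have z: "Suc n - k = 0" "n - k = 0" by auto
    have 1: "wedge 1 k \<theta> \<omega> = zero_form \<longleftrightarrow> (\<forall>c p. c \<in> A \<and> p \<in> dom_of c \<and> p \<in> V \<longrightarrow>
       lef 0 (Suc k) (d\<theta> V \<theta> c p) (alt_wedge (Suc 0) k (\<theta> c p) (\<omega> c p)) = (\<lambda>v. 0))"
      unfolding wedge_one_eq[OF V th w] by (rule wedge_lef_eq[OF V th w])
    have 2: "wedge 1 (Suc k) \<theta> ?dw = zero_form \<longleftrightarrow> (\<forall>c p. c \<in> A \<and> p \<in> dom_of c \<and> p \<in> V \<longrightarrow>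
       lef 0 (Suc (Suc k)) (d\<theta> V \<theta> c p) (alt_wedge (Suc 0) (Suc k) (\<theta> c p) (?dw c p)) = (\<lambda>v. 0))"
      unfolding wedge_one_eq[OF V th dw] by (rule wedge_lef_eq[OF V th dw])
    show ?thesis unfolding e z using 1 2 False by simp
  qed
  then show ?thesis
    using w unfolding rumin_forms_def mem_Collect_eq Let_def rumin_cond_def by (simp cong: conj_cong imp_cong) blast
qed (simp add: rumin_forms_def)

lemma rumin_cond_zero [simp]: "rumin_cond k zero_form"
  by (simp add: rumin_cond_def zero_form_def)

lemma rumin_cond_add: "rumin_cond k \<omega> \<Longrightarrow> rumin_cond k \<eta> \<Longrightarrow> rumin_cond k (form_add \<omega> \<eta>)"
  by (simp add: rumin_cond_def form_add_def alt_wedge_add_right lef_add)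

lemma rumin_cond_scale: "rumin_cond k \<omega> \<Longrightarrow> rumin_cond k (form_scale r \<omega>)"
  by (simp add: rumin_cond_def form_scale_def alt_wedge_scale_right lef_scale)

text \<open>The form \<theta> \<and> \<omega> \<and> d\<theta>^(n+1) has degree 2n + 3, above the
  dimension. So functions, which cannot be corrected by an exact form, need no correction.\<close>

lemma rumin_cond_0:
  assumes "\<omega> \<in> forms A UNIV 0" shows "rumin_cond 0 \<omega>"
  unfolding rumin_cond_def
proof (intro allI impI, elim conjE)
  fix V \<theta> c p assume V: "open V" and th: "\<theta> \<in> contact_forms A T V" and c: "c \<in> A" and p: "p \<in> dom_of c" "p \<in> V"
  note cp = contact_point_at[OF V th c p]
  have "alt_wedge (Suc 0) 0 (\<theta> c p) (\<omega> c p) \<in> alt_forms (Suc 0)"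
    using alt_wedge_alt_forms[OF contact_point.th[OF cp] forms_alt[OF assms c p(1)]] by simp
  from lef_alt_forms[OF contact_point.om[OF cp] this, of "Suc n"]
  show "lef (Suc n - 0) (Suc 0) (d\<theta> V \<theta> c p) (alt_wedge (Suc 0) 0 (\<theta> c p) (\<omega> c p)) = (\<lambda>v. 0)"
    by (intro alt_form_eq0_above_dim) (auto simp: dim)
qed

lemma correction_rumin_cond:
  assumes k: "k \<le> 2 * n" and et: "\<eta> \<in> forms A UNIV (Suc k)"
  obtains \<beta> where "\<beta> \<in> forms A UNIV k" "rumin_cond (Suc k) (form_add \<eta> (form_scale (-1) (ext_deriv A UNIV k \<beta>)))"
proof (rule that)
  have k': "0 < Suc k" "Suc k \<le> 2 * n + 1" using k by auto
  let ?b = "correction (Suc k) \<eta>"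
  show b: "?b \<in> forms A UNIV k" using correction_forms[OF k' et] by simp
  show "rumin_cond (Suc k) (form_add \<eta> (form_scale (-1) (ext_deriv A UNIV k ?b)))"
    unfolding rumin_cond_def
  proof (intro allI impI, elim conjE)
    fix V \<theta> c p assume V: "open V" and th: "\<theta> \<in> contact_forms A T V" and c: "c \<in> A" and p: "p \<in> dom_of c" "p \<in> V"
    interpret co: contact_open "img c V" "loc \<theta> c" "loc (d\<theta> V \<theta>) c" n
      by (rule contact_open_at[OF V th c])
    have 1: "sform (img c V) (Suc k - 1) (loc ?b c)"
      using sform_subset[OF sform_loc[OF b c] img_mono] by simp
    have 2: "loc (d\<theta> V \<theta>) c x = extd (Suc 0) (loc \<theta> c) x" if "x \<in> img c V" for x
      using loc_ext_deriv[OF c that] by simp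
    have 3: "rumin_correction n (Suc k) (loc \<theta> c x) (loc (d\<theta> V \<theta>) c x) (loc \<eta> c x) (loc ?b c x)"
      if x: "x \<in> img c V" for x
    proof -
      obtain q where q: "q \<in> dom_of c" "q \<in> V" "x = snd c q" using imgE[OF c x] by blast
      show ?thesis
        using is_correctionD[OF correction_is_correction[OF k' et c q(1)] et c q(1,2) V th] q c by simp
    qed
    from co.rumin_correction_works[OF k' 1 2 3 imgI[OF p]]
    show "lef (Suc n - Suc k) (Suc (Suc k)) (d\<theta> V \<theta> c p) (alt_wedge (Suc 0) (Suc k) (\<theta> c p)
        (form_add \<eta> (form_scale (-1) (ext_deriv A UNIV k ?b)) c p)) = (\<lambda>v. 0)"
      using c p by (simp add: form_add_def form_scale_def ext_deriv_eq alt_wedge_diff_right lef_diff)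
  qed
qed

text \<open>Used twice for the isomorphism: with d\<eta> a Rumin form, to replace a primitive by a
  Rumin primitive, and with d\<eta> = 0, to represent a class by a Rumin form.\<close>

lemma rumin_correction_global:
  assumes k: "k \<le> 2 * n" and et: "\<eta> \<in> forms A UNIV (Suc k)"
    and d: "rumin_cond (Suc (Suc k)) (ext_deriv A UNIV (Suc k) \<eta>)"
  obtains \<beta> where "\<beta> \<in> forms A UNIV k"
    "form_add \<eta> (form_scale (-1) (ext_deriv A UNIV k \<beta>)) \<in> rumin_forms n A T UNIV (Suc k)"
    "ext_deriv A UNIV (Suc k) (form_add \<eta> (form_scale (-1) (ext_deriv A UNIV k \<beta>))) = ext_deriv A UNIV (Suc k) \<eta>"
proof -
  obtain \<beta> where b: "\<beta> \<in> forms A UNIV k" "rumin_cond (Suc k) (form_add \<eta> (form_scale (-1) (ext_deriv A UNIV k \<beta>)))"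
    by (rule correction_rumin_cond[OF k et])
  have db: "ext_deriv A UNIV k \<beta> \<in> forms A UNIV (Suc k)" by (rule ext_deriv_forms[OF b(1)]) simp
  have s: "form_scale (-1) (ext_deriv A UNIV k \<beta>) \<in> forms A UNIV (Suc k)" by (rule form_scale_forms[OF db]) simp
  have e: "ext_deriv A UNIV (Suc k) (form_add \<eta> (form_scale (-1) (ext_deriv A UNIV k \<beta>))) = ext_deriv A UNIV (Suc k) \<eta>"
    unfolding ext_deriv_add[OF et s] ext_deriv_scale[OF db] ext_deriv_ext_deriv[OF b(1) open_UNIV]
    by (simp add: form_add_def form_scale_def zero_form_def)
  have "form_add \<eta> (form_scale (-1) (ext_deriv A UNIV k \<beta>)) \<in> rumin_forms n A T UNIV (Suc k)"
    unfolding rumin_forms_iff e using form_add_forms[OF et s] b(2) d by simp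
  with b(1) e show ?thesis using that by blast
qed

end

section \<open>Cohomology\<close>

lemma form_add_zero [simp]: "form_add \<omega> zero_form = \<omega>" "form_add zero_form \<omega> = \<omega>"
  and form_add_assoc: "form_add (form_add \<omega> \<eta>) \<zeta> = form_add \<omega> (form_add \<eta> \<zeta>)"
  and form_add_neg: "form_add \<omega> (form_scale (-1) \<omega>) = zero_form"
  and form_scale_add: "form_scale r (form_add \<omega> \<eta>) = form_add (form_scale r \<omega>) (form_scale r \<eta>)"
  and form_scale_zero [simp]: "form_scale r zero_form = zero_form"
  by (simp_all add: form_add_def form_scale_def zero_form_def fun_eq_iff algebra_simps)

definition form_subspace :: "('m, 'd) form set \<Rightarrow> bool" where
  "form_subspace B \<longleftrightarrow> zero_form \<in> B \<and> (\<forall>x\<in>B. \<forall>y\<in>B. form_add x y \<in> B) \<and> (\<forall>r. \<forall>x\<in>B. form_scale r x \<in> B)"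

abbreviation fcoset :: "('m, 'd) form \<Rightarrow> ('m, 'd) form set \<Rightarrow> ('m, 'd) form set" where
  "fcoset \<omega> B \<equiv> form_add \<omega> ` B"

lemma fcoset_eq_iff:
  assumes B: "form_subspace B"
  shows "fcoset x B = fcoset y B \<longleftrightarrow> form_add x (form_scale (-1) y) \<in> B"
proof
  assume "fcoset x B = fcoset y B"
  moreover have "form_add x zero_form \<in> fcoset x B" using B unfolding form_subspace_def by blast
  ultimately obtain b where "b \<in> B" "x = form_add y b" by auto
  moreover have "form_add (form_add y b) (form_scale (-1) y) = b"
    by (simp add: form_add_def form_scale_def)
  ultimately show "form_add x (form_scale (-1) y) \<in> B" by simp
next
  assume a: "form_add x (form_scale (-1) y) \<in> B"
  have sub: "fcoset u B \<subseteq> fcoset w B" if "form_add u (form_scale (-1) w) \<in> B" for u w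
  proof
    fix z assume "z \<in> fcoset u B"
    then obtain b where b: "b \<in> B" "z = form_add u b" by blast
    have "z = form_add w (form_add (form_add u (form_scale (-1) w)) b)"
      by (simp add: b(2) form_add_def form_scale_def)
    moreover have "form_add (form_add u (form_scale (-1) w)) b \<in> B" using that b(1) B unfolding form_subspace_def by blast
    ultimately show "z \<in> fcoset w B" by blast
  qed
  have "form_add y (form_scale (-1) x) = form_scale (-1) (form_add x (form_scale (-1) y))"
    by (simp add: form_add_def form_scale_def)
  then have "form_add y (form_scale (-1) x) \<in> B" using a B unfolding form_subspace_def by simp
  then show "fcoset x B = fcoset y B" using sub[OF a] sub by blast
qed

lemma fcoset_add:
  assumes B: "form_subspace B"
  shows "{form_add \<xi> \<eta> | \<xi> \<eta>. \<xi> \<in> fcoset x B \<and> \<eta> \<in> fcoset y B} = fcoset (form_add x y) B"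
proof
  show "{form_add \<xi> \<eta> | \<xi> \<eta>. \<xi> \<in> fcoset x B \<and> \<eta> \<in> fcoset y B} \<subseteq> fcoset (form_add x y) B"
  proof clarify
    fix b b' assume "b \<in> B" "b' \<in> B"
    then have "form_add b b' \<in> B" using B unfolding form_subspace_def by blast
    moreover have "form_add (form_add x b) (form_add y b') = form_add (form_add x y) (form_add b b')"
      by (simp add: form_add_def fun_eq_iff)
    ultimately show "form_add (form_add x b) (form_add y b') \<in> fcoset (form_add x y) B" by blast
  qed
  show "fcoset (form_add x y) B \<subseteq> {form_add \<xi> \<eta> | \<xi> \<eta>. \<xi> \<in> fcoset x B \<and> \<eta> \<in> fcoset y B}"
  proof clarify
    fix b assume b: "b \<in> B"
    have "zero_form \<in> B" using B unfolding form_subspace_def by blast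
    moreover have "form_add (form_add x y) b = form_add (form_add x b) (form_add y zero_form)"
      by (simp add: form_add_def zero_form_def fun_eq_iff)
    ultimately show "\<exists>\<xi> \<eta>. form_add (form_add x y) b = form_add \<xi> \<eta> \<and> \<xi> \<in> fcoset x B \<and> \<eta> \<in> fcoset y B"
      using b by blast
  qed
qed

lemma fcoset_scale:
  assumes B: "form_subspace B"
  shows "{form_add (form_scale r \<xi>) \<beta> | \<xi> \<beta>. \<xi> \<in> fcoset x B \<and> \<beta> \<in> B} = fcoset (form_scale r x) B"
proof
  show "{form_add (form_scale r \<xi>) \<beta> | \<xi> \<beta>. \<xi> \<in> fcoset x B \<and> \<beta> \<in> B} \<subseteq> fcoset (form_scale r x) B"
  proof clarify
    fix b b' assume "b \<in> B" "b' \<in> B"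
    then have "form_add (form_scale r b) b' \<in> B" using B unfolding form_subspace_def by blast
    then show "form_add (form_scale r (form_add x b)) b' \<in> fcoset (form_scale r x) B"
      by (simp add: form_scale_add form_add_assoc)
  qed
  show "fcoset (form_scale r x) B \<subseteq> {form_add (form_scale r \<xi>) \<beta> | \<xi> \<beta>. \<xi> \<in> fcoset x B \<and> \<beta> \<in> B}"
  proof clarify
    fix b assume b: "b \<in> B"
    have "form_add x zero_form \<in> fcoset x B" using B unfolding form_subspace_def by blast
    then have "x \<in> fcoset x B" by simp
    then show "\<exists>\<xi> \<beta>. form_add (form_scale r x) b = form_add (form_scale r \<xi>) \<beta> \<and> \<xi> \<in> fcoset x B \<and> \<beta> \<in> B"
      using b by blast
  qed
qed

text \<open>The map induced by the inclusion is written as the enlargement of a coset of B to a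
  coset of B', so no representatives are chosen. The last two hypotheses are its injectivity and its
  surjectivity.\<close>

lemma quotient_space_isomorphic:
  assumes Z: "form_subspace Z" and B: "form_subspace B" and Z': "form_subspace Z'" and B': "form_subspace B'"
    and sub: "Z \<subseteq> Z'" "B \<subseteq> B'"
    and inj: "\<And>x. x \<in> Z \<Longrightarrow> x \<in> B' \<Longrightarrow> x \<in> B"
    and surj: "\<And>y. y \<in> Z' \<Longrightarrow> \<exists>x\<in>Z. form_add x (form_scale (-1) y) \<in> B'"
  shows "vs_isomorphic (quotient_space Z B) (quotient_space Z' B')"
proof -
  define F where "F X = {form_add \<xi> b | \<xi> b. \<xi> \<in> X \<and> b \<in> B'}" for X
  have F: "F (fcoset x B) = fcoset x B'" for x
  proof
    show "F (fcoset x B) \<subseteq> fcoset x B'"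
    proof
      fix z assume "z \<in> F (fcoset x B)"
      then obtain b b' where "b \<in> B" "b' \<in> B'" "z = form_add x (form_add b b')"
        unfolding F_def by (auto simp: form_add_assoc)
      then show "z \<in> fcoset x B'" using sub(2) B' unfolding form_subspace_def by blast
    qed
    have "form_add x zero_form \<in> fcoset x B" using B unfolding form_subspace_def by blast
    then show "fcoset x B' \<subseteq> F (fcoset x B)" unfolding F_def by auto
  qed
  have Zd: "form_add x (form_scale (-1) y) \<in> Z" if "x \<in> Z" "y \<in> Z" for x y
    using that Z unfolding form_subspace_def by blast
  have bij: "bij_betw F (vs_carrier (quotient_space Z B)) (vs_carrier (quotient_space Z' B'))"
    unfolding bij_betw_def
  proof
    show "inj_on F (vs_carrier (quotient_space Z B))"
    proof (rule inj_onI)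
      fix X Y assume "X \<in> vs_carrier (quotient_space Z B)" "Y \<in> vs_carrier (quotient_space Z B)" and FXY: "F X = F Y"
      then obtain x y where xy: "x \<in> Z" "y \<in> Z" "X = fcoset x B" "Y = fcoset y B"
        by (auto simp: quotient_space_def)
      then have "form_add x (form_scale (-1) y) \<in> B'" using FXY by (simp add: F fcoset_eq_iff[OF B'])
      then show "X = Y" using inj Zd xy by (simp add: fcoset_eq_iff[OF B])
    qed
    show "F ` vs_carrier (quotient_space Z B) = vs_carrier (quotient_space Z' B')"
    proof
      show "F ` vs_carrier (quotient_space Z B) \<subseteq> vs_carrier (quotient_space Z' B')"
        using sub(1) by (auto simp: quotient_space_def F)
      show "vs_carrier (quotient_space Z' B') \<subseteq> F ` vs_carrier (quotient_space Z B)"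
      proof
        fix Y assume "Y \<in> vs_carrier (quotient_space Z' B')"
        then obtain y where y: "y \<in> Z'" "Y = fcoset y B'" by (auto simp: quotient_space_def)
        obtain x where x: "x \<in> Z" "form_add x (form_scale (-1) y) \<in> B'" using surj[OF y(1)] by blast
        then have "fcoset x B' = fcoset y B'" using fcoset_eq_iff[OF B'] by blast
        then have "Y = F (fcoset x B)" by (simp add: F y(2))
        then show "Y \<in> F ` vs_carrier (quotient_space Z B)" using x(1) by (auto simp: quotient_space_def)
      qed
    qed
  qed
  show ?thesis
    unfolding vs_isomorphic_def
  proof (intro exI conjI ballI allI)
    show "bij_betw F (vs_carrier (quotient_space Z B)) (vs_carrier (quotient_space Z' B'))" by (rule bij)
    fix X assume "X \<in> vs_carrier (quotient_space Z B)"
    then obtain x where x: "X = fcoset x B" by (auto simp: quotient_space_def)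
    show "F (vs_scale (quotient_space Z B) r X) = vs_scale (quotient_space Z' B') r (F X)" for r
      unfolding x by (simp add: quotient_space_def fcoset_scale[OF B] fcoset_scale[OF B'] F)
    fix Y assume "Y \<in> vs_carrier (quotient_space Z B)"
    then obtain y where y: "Y = fcoset y B" by (auto simp: quotient_space_def)
    show "F (vs_add (quotient_space Z B) X Y) = vs_add (quotient_space Z' B') (F X) (F Y)"
      unfolding x y by (simp add: quotient_space_def fcoset_add[OF B] fcoset_add[OF B'] F)
  qed
qed

section \<open>Comparison of Rumin and de Rham cohomology\<close>

context smooth_mfd
begin

lemma cocycles_subspace:
  assumes C: "form_subspace (C k)" "C k \<subseteq> forms A UNIV k"
  shows "form_subspace (cocycles A C k)"
  unfolding form_subspace_def cocycles_def
  using C by (auto simp: form_subspace_def ext_deriv_add ext_deriv_scale subset_iff)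

lemma coboundaries_subspace:
  assumes C: "\<And>k. form_subspace (C k)" "\<And>k. C k \<subseteq> forms A UNIV k"
  shows "form_subspace (coboundaries A C k)"
proof (cases k)
  case 0
  then show ?thesis by (simp add: coboundaries_def form_subspace_def)
next
  case (Suc j)
  have e: "coboundaries A C k = ext_deriv A UNIV j ` C j" by (simp add: coboundaries_def Suc)
  have sub: "x \<in> forms A UNIV j" if "x \<in> C j" for x using that C(2) by blast
  show ?thesis
    unfolding form_subspace_def e
  proof (intro conjI ballI allI)
    have "zero_form \<in> C j" using C(1) unfolding form_subspace_def by blast
    then show "zero_form \<in> ext_deriv A UNIV j ` C j" using ext_deriv_zero by (metis imageI)
  next
    fix x y assume "x \<in> ext_deriv A UNIV j ` C j" "y \<in> ext_deriv A UNIV j ` C j"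
    then obtain a b where ab: "a \<in> C j" "b \<in> C j" "x = ext_deriv A UNIV j a" "y = ext_deriv A UNIV j b" by blast
    have "form_add a b \<in> C j" using ab C(1) unfolding form_subspace_def by blast
    then show "form_add x y \<in> ext_deriv A UNIV j ` C j"
      using ext_deriv_add[OF sub[OF ab(1)] sub[OF ab(2)]] ab(3,4) by (metis imageI)
  next
    fix r x assume "x \<in> ext_deriv A UNIV j ` C j"
    then obtain a where a: "a \<in> C j" "x = ext_deriv A UNIV j a" by blast
    have "form_scale r a \<in> C j" using a C(1) unfolding form_subspace_def by blast
    then show "form_scale r x \<in> ext_deriv A UNIV j ` C j"
      using ext_deriv_scale[OF sub[OF a(1)]] a(2) by (metis imageI)
  qed
qed

lemma forms_subspace: "form_subspace (forms A UNIV k)"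
  by (simp add: form_subspace_def form_add_forms form_scale_forms)

end

context cr_mfd
begin

lemma rumin_forms_subspace: "form_subspace (rumin_forms n A T UNIV k)"
  by (auto simp: form_subspace_def rumin_forms_iff form_add_forms form_scale_forms ext_deriv_add ext_deriv_scale
      rumin_cond_add rumin_cond_scale)

lemma rumin_forms_subset: "rumin_forms n A T UNIV k \<subseteq> forms A UNIV k"
  by (auto simp: rumin_forms_iff)

theorem rumin_de_rham_isomorphic:
  assumes k: "k \<le> 2 * n + 1"
  shows "vs_isomorphic (rumin_cohomology n A T k) (de_rham_cohomology A k)"
  unfolding rumin_cohomology_def de_rham_cohomology_def cohomology_def
proof (rule quotient_space_isomorphic)
  let ?R = "rumin_forms n A T UNIV" and ?F = "forms A UNIV"
  show "form_subspace (cocycles A ?R k)"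
    by (rule cocycles_subspace) (rule rumin_forms_subspace rumin_forms_subset)+
  show "form_subspace (cocycles A ?F k)"
    by (rule cocycles_subspace) (rule forms_subspace order_refl)+
  show "form_subspace (coboundaries A ?R k)"
    by (rule coboundaries_subspace) (rule rumin_forms_subspace rumin_forms_subset)+
  show "form_subspace (coboundaries A ?F k)"
    by (rule coboundaries_subspace) (rule forms_subspace order_refl)+
  show "cocycles A ?R k \<subseteq> cocycles A ?F k"
    using rumin_forms_subset by (auto simp: cocycles_def)
  show "coboundaries A ?R k \<subseteq> coboundaries A ?F k"
    using rumin_forms_subset by (cases k) (auto simp: coboundaries_def)
  show "x \<in> coboundaries A ?R k" if x: "x \<in> cocycles A ?R k" "x \<in> coboundaries A ?F k" for x
  proof (cases k)
    case 0
    then show ?thesis using x(2) by (simp add: coboundaries_def)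
  next
    case (Suc j)
    obtain \<eta> where et: "\<eta> \<in> ?F j" "x = ext_deriv A UNIV j \<eta>" using x(2) Suc by (auto simp: coboundaries_def)
    have d: "rumin_cond (Suc j) (ext_deriv A UNIV j \<eta>)"
      using x(1) Suc et(2) by (simp add: cocycles_def rumin_forms_iff)
    \<comment> \<open>Injectivity: a Rumin form with a primitive has a Rumin primitive. Subtracting
      an exact form from \<eta> leaves its derivative x unchanged.\<close>
    have "\<exists>\<eta>'\<in>?R j. ext_deriv A UNIV j \<eta>' = x"
    proof (cases j)
      case 0
      then have "\<eta> \<in> ?R j" using et d rumin_cond_0 by (simp add: rumin_forms_iff)
      then show ?thesis using et(2) by blast
    next
      case (Suc i)
      have "i \<le> 2 * n" using k \<open>k = Suc j\<close> Suc by simp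
      from rumin_correction_global[OF this, of \<eta>] et d Suc show ?thesis by metis
    qed
    then show ?thesis using Suc by (auto simp: coboundaries_def)
  qed
  show "\<exists>x\<in>cocycles A ?R k. form_add x (form_scale (-1) y) \<in> coboundaries A ?F k" if y: "y \<in> cocycles A ?F k" for y
  proof -
    have yF: "y \<in> ?F k" and dy: "ext_deriv A UNIV k y = zero_form" using y by (auto simp: cocycles_def)
    show ?thesis
    proof (cases k)
      case 0
      then have "y \<in> cocycles A ?R k"
        using yF dy rumin_cond_0 by (simp add: cocycles_def rumin_forms_iff)
      then show ?thesis using 0 by (intro bexI[of _ y]) (simp_all add: coboundaries_def form_add_neg)
    next
      case (Suc j)
      have j: "j \<le> 2 * n" using k Suc by simp
      have yF': "y \<in> ?F (Suc j)" and dy': "ext_deriv A UNIV (Suc j) y = zero_form" using yF dy Suc by simp_all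
      have "rumin_cond (Suc (Suc j)) (ext_deriv A UNIV (Suc j) y)" using dy' by simp
      from rumin_correction_global[OF j yF' this] obtain \<beta> where b: "\<beta> \<in> ?F j"
        "form_add y (form_scale (-1) (ext_deriv A UNIV j \<beta>)) \<in> ?R (Suc j)"
        "ext_deriv A UNIV (Suc j) (form_add y (form_scale (-1) (ext_deriv A UNIV j \<beta>))) = zero_form"
        using dy' by metis
      let ?x = "form_add y (form_scale (-1) (ext_deriv A UNIV j \<beta>))"
      have "?x \<in> cocycles A ?R k" using b Suc by (simp add: cocycles_def)
      \<comment> \<open>The corrected form differs from y by d(-\<beta>), so it represents the same
        de Rham class.\<close>
      moreover have "form_add ?x (form_scale (-1) y) = ext_deriv A UNIV j (form_scale (-1) \<beta>)"
        unfolding ext_deriv_scale[OF b(1)] by (simp add: form_add_def form_scale_def)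
      moreover have "form_scale (-1) \<beta> \<in> ?F j" by (rule form_scale_forms[OF b(1)]) simp
      ultimately show ?thesis using Suc by (auto simp: coboundaries_def)
    qed
  qed
qed

end

theorem theorem9p1:
  fixes A :: "('m::{t2_space, second_countable_topology}, 'd::finite) chart set"
    and T :: "('m, 'd) cdistribution"
    and n k :: nat
  assumes "cr_manifold n A T"
    and "k \<in> {0..2 * n + 1}"
  shows "vs_isomorphic (rumin_cohomology n A T k) (de_rham_cohomology A k)"
proof -
  interpret cr_mfd A T n by unfold_locales (rule assms(1))
  show ?thesis using assms(2) by (intro rumin_de_rham_isomorphic) simp
qed

end
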